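(* Assume $\mathsf{ZF} + \mathsf{AD}^+ + V = L(\mathscr{P}(\mathbb{R}))$. Let $\kappa$ be an ordinal and let $\langle E_\alpha : \alpha < \kappa\rangle$ be a sequence of equivalence relations on $\mathbb{R}$ such that for every $\alpha<\kappa$, $E_\alpha$ is smooth (i.e. $\mathbb{R}/E_\alpha$ is in bijection with $\mathbb{R}$) and every $E_\alpha$-class is countable. Then $\mathbb{R} \times \kappa$ injects into $\bigsqcup_{\alpha < \kappa} \mathbb{R}/E_\alpha$.
   Context: $\mathsf{AD}^+$ is the conjunction of: (1) $\mathsf{DC}_{\mathbb{R}}$; (2) every $A \subseteq \mathbb{R}$ has an $\infty$-Borel code, i.e. there are a set of ordinals $S$ and a formula $\varphi$ with $A = \{x \in \mathbb{R} : L[S,x] \models \varphi(S,x)\}$; (3) for every $\lambda < \Theta$ (the least ordinal which is not a surjective image of $\mathbb{R}$), every $A \subseteq \mathbb{R}$ and every continuous $\pi : {}^\omega\lambda \to \mathbb{R}$, the set $\pi^{-1}[A]$ is determined. An equivalence relation $E$ on $\mathbb{R}$ is called smooth if $\mathbb{R}/E$ is in bijection with $\mathbb{R}$. $\bigsqcup_{\alpha<\kappa} \mathbb{R}/E_\alpha$ denotes the formal disjoint union $\{(\alpha, c) : \alpha < \kappa,\ c \in \mathbb{R}/E_\alpha\}$. *)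

theory Defs
  imports Main
begin

text \<open>
  HOL proves the axiom of choice, so determinacy hypotheses cannot be stated about HOL sets. A
  theorem of \<open>ZF + T\<close> is rendered as: it holds in every structure \<open>(M, \<in>\<^sub>M)\<close>, \<open>M\<close> being a whole HOL type,
  that satisfies \<open>ZF + T\<close>. Separation and Replacement range over first-order formulas with
  parameters only; ranging over all HOL predicates would reintroduce choice and make the
  hypotheses contradictory.

  Conventions. Elements of the type \<open>'v\<close> are the sets of the structure; terms of type \<open>'v set\<close> are
  collections of such sets. All functions, relations, strategies, ordinals and natural
  numbers that are quantified over are elements of the structure.
\<close>

datatype fm = Mem nat nat | Eq nat nat | Neg fm | And fm fm | All nat fm

primrec sat :: "('v \<Rightarrow> 'v \<Rightarrow> bool) \<Rightarrow> 'v set \<Rightarrow> (nat \<Rightarrow> 'v) \<Rightarrow> fm \<Rightarrow> bool" where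
  "sat m D e (Mem i j) \<longleftrightarrow> m (e i) (e j)"
| "sat m D e (Eq i j) \<longleftrightarrow> e i = e j"
| "sat m D e (Neg p) \<longleftrightarrow> \<not> sat m D e p"
| "sat m D e (And p q) \<longleftrightarrow> sat m D e p \<and> sat m D e q"
| "sat m D e (All i p) \<longleftrightarrow> (\<forall>a\<in>D. sat m D (e(i := a)) p)"

locale set_structure =
  fixes mem :: "'v \<Rightarrow> 'v \<Rightarrow> bool" (infix "\<in>\<^sub>M" 50)
begin

definition elts :: "'v \<Rightarrow> 'v set" where
  "elts x = {y. y \<in>\<^sub>M x}"

subsection \<open>The axioms of ZF\<close>

definition extensionality :: bool where
  "extensionality \<longleftrightarrow> (\<forall>x y. elts x = elts y \<longrightarrow> x = y)"

definition foundation :: bool where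
  "foundation \<longleftrightarrow> (\<forall>x. elts x \<noteq> {} \<longrightarrow> (\<exists>y\<in>elts x. elts y \<inter> elts x = {}))"

definition pairing :: bool where
  "pairing \<longleftrightarrow> (\<forall>x y. \<exists>z. elts z = {x, y})"

definition union_axiom :: bool where
  "union_axiom \<longleftrightarrow> (\<forall>x. \<exists>z. elts z = (\<Union>y\<in>elts x. elts y))"

definition power_set_axiom :: bool where
  "power_set_axiom \<longleftrightarrow> (\<forall>x. \<exists>z. elts z = {y. elts y \<subseteq> elts x})"

definition infinity :: bool where
  "infinity \<longleftrightarrow> (\<exists>x. (\<exists>z\<in>elts x. elts z = {}) \<and>
     (\<forall>y\<in>elts x. \<exists>z\<in>elts x. elts z = insert y (elts y)))"

definition separation :: bool where
  "separation \<longleftrightarrow> (\<forall>\<phi> e x. \<exists>z. elts z = {y \<in> elts x. sat mem UNIV (e(0 := y)) \<phi>})"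

definition replacement :: bool where
  "replacement \<longleftrightarrow> (\<forall>\<phi> e x.
     (\<forall>y\<in>elts x. \<forall>w w'. sat mem UNIV (e(0 := y, 1 := w)) \<phi> \<and> sat mem UNIV (e(0 := y, 1 := w')) \<phi>
        \<longrightarrow> w = w') \<longrightarrow>
     (\<exists>z. elts z = {w. \<exists>y\<in>elts x. sat mem UNIV (e(0 := y, 1 := w)) \<phi>}))"

definition ZF :: bool where
  "ZF \<longleftrightarrow> extensionality \<and> foundation \<and> pairing \<and> union_axiom \<and> power_set_axiom \<and> infinity \<and>
     separation \<and> replacement"

subsection \<open>Basic set-theoretic notions\<close>

text \<open>Meaningful only if the collection \<open>X\<close> is a set of the structure, which ZF ensures at every use
  below.\<close>

definition the_set :: "'v set \<Rightarrow> 'v" where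
  "the_set X = (THE x. elts x = X)"

definition empty :: 'v where
  "empty = the_set {}"

definition succ :: "'v \<Rightarrow> 'v" where
  "succ x = the_set (insert x (elts x))"

definition pair :: "'v \<Rightarrow> 'v \<Rightarrow> 'v" where
  "pair x y = the_set {the_set {x}, the_set {x, y}}"

definition transitive :: "'v \<Rightarrow> bool" where
  "transitive x \<longleftrightarrow> (\<forall>y\<in>elts x. elts y \<subseteq> elts x)"

definition Ord :: "'v \<Rightarrow> bool" where
  "Ord \<alpha> \<longleftrightarrow> transitive \<alpha> \<and> (\<forall>\<beta>\<in>elts \<alpha>. transitive \<beta>)"

definition Nat :: "'v set" where
  "Nat = {n. \<forall>X. empty \<in> elts X \<and> (\<forall>y\<in>elts X. succ y \<in> elts X) \<longrightarrow> n \<in> elts X}"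

definition Even :: "'v set" where
  "Even = {n. \<forall>X. empty \<in> elts X \<and> (\<forall>y\<in>elts X. succ (succ y) \<in> elts X) \<longrightarrow> n \<in> elts X}"

definition func :: "'v \<Rightarrow> 'v set \<Rightarrow> 'v set \<Rightarrow> bool" where
  "func f X Y \<longleftrightarrow> (\<forall>p\<in>elts f. \<exists>x\<in>X. \<exists>y\<in>Y. p = pair x y) \<and> (\<forall>x\<in>X. \<exists>!y. pair x y \<in> elts f)"

definition app :: "'v \<Rightarrow> 'v \<Rightarrow> 'v" where
  "app f x = (THE y. pair x y \<in> elts f)"

definition Fun :: "'v set \<Rightarrow> 'v set \<Rightarrow> 'v set" where
  "Fun X Y = {f. func f X Y}"

definition restrict :: "'v \<Rightarrow> 'v \<Rightarrow> 'v" where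
  "restrict f a = the_set {p \<in> elts f. \<exists>x\<in>elts a. \<exists>y. p = pair x y}"

definition inj_fun :: "'v \<Rightarrow> 'v set \<Rightarrow> 'v set \<Rightarrow> bool" where
  "inj_fun f X Y \<longleftrightarrow> func f X Y \<and> inj_on (app f) X"

definition surj_fun :: "'v \<Rightarrow> 'v set \<Rightarrow> 'v set \<Rightarrow> bool" where
  "surj_fun f X Y \<longleftrightarrow> func f X Y \<and> app f ` X = Y"

definition injects :: "'v set \<Rightarrow> 'v set \<Rightarrow> bool" where
  "injects X Y \<longleftrightarrow> (\<exists>f. inj_fun f X Y)"

definition surjects :: "'v set \<Rightarrow> 'v set \<Rightarrow> bool" where
  "surjects X Y \<longleftrightarrow> (\<exists>f. surj_fun f X Y)"

definition in_bijection :: "'v set \<Rightarrow> 'v set \<Rightarrow> bool" where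
  "in_bijection X Y \<longleftrightarrow> (\<exists>f. inj_fun f X Y \<and> surj_fun f X Y)"

definition is_countable :: "'v set \<Rightarrow> bool" where
  "is_countable X \<longleftrightarrow> injects X Nat"

text \<open>The reals are the elements of Baire space, as usual in this context.\<close>

definition Reals :: "'v set" where
  "Reals = Fun Nat Nat"

subsection \<open>Relative constructibility\<close>

definition Tup :: "'v \<Rightarrow> 'v \<Rightarrow> 'v set" where
  "Tup A n = Fun (elts n) (elts A)"

text \<open>\<open>F\<close> is a set of pairs \<open>(n, R)\<close>, with \<open>R\<close> an \<open>n\<close>-ary relation on \<open>A\<close>. The closure conditions follow
  the formation rules for formulas over \<open>(A, \<in>, Q \<inter> A)\<close> with one unary predicate for each \<open>Q \<in> P\<close>: atomic
  formulas, negation, conjunction, and existential quantification of the last variable (Kunen's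
  definition of \<open>Df(A, n)\<close>). Formulas are thus those of the structure, not only the
  metatheoretic ones given by \<open>fm\<close>; the two differ if the structure has nonstandard natural
  numbers.\<close>

definition def_closed :: "'v set \<Rightarrow> 'v \<Rightarrow> 'v \<Rightarrow> bool" where
  "def_closed P A F \<longleftrightarrow>
     (\<forall>n\<in>Nat. \<forall>i\<in>elts n. \<forall>j\<in>elts n.
        pair n (the_set {s \<in> Tup A n. app s i \<in>\<^sub>M app s j}) \<in> elts F \<and>
        pair n (the_set {s \<in> Tup A n. app s i = app s j}) \<in> elts F) \<and>
     (\<forall>n\<in>Nat. \<forall>i\<in>elts n. \<forall>Q\<in>P. pair n (the_set {s \<in> Tup A n. app s i \<in>\<^sub>M Q}) \<in> elts F) \<and>
     (\<forall>n\<in>Nat. \<forall>R. pair n R \<in> elts F \<longrightarrow> pair n (the_set (Tup A n - elts R)) \<in> elts F) \<and>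
     (\<forall>n\<in>Nat. \<forall>R R'. pair n R \<in> elts F \<and> pair n R' \<in> elts F \<longrightarrow>
        pair n (the_set (elts R \<inter> elts R')) \<in> elts F) \<and>
     (\<forall>n\<in>Nat. \<forall>R. pair (succ n) R \<in> elts F \<longrightarrow>
        pair n (the_set {s \<in> Tup A n. \<exists>t\<in>elts R. restrict t n = s}) \<in> elts F)"

definition definable_rel :: "'v set \<Rightarrow> 'v \<Rightarrow> 'v \<Rightarrow> 'v \<Rightarrow> bool" where
  "definable_rel P A n R \<longleftrightarrow> n \<in> Nat \<and> (\<forall>F. def_closed P A F \<longrightarrow> pair n R \<in> elts F)"

text \<open>The subsets of \<open>A\<close> definable over \<open>(A, \<in>, Q \<inter> A)\<close>, \<open>Q \<in> P\<close>, from a tuple of parameters \<open>s\<close>.\<close>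

definition Def :: "'v set \<Rightarrow> 'v \<Rightarrow> 'v set" where
  "Def P A = {X. \<exists>n\<in>Nat. \<exists>s\<in>Tup A n. \<exists>R. definable_rel P A (succ n) R \<and>
     elts X = {x \<in> elts A. \<exists>t\<in>elts R. restrict t n = s \<and> app t n = x}}"

text \<open>\<open>h\<close> lists the levels \<open>0, \<dots>, \<alpha>\<close> of the constructible hierarchy over the set \<open>B\<close>, relative to the
  predicates in \<open>P\<close>.\<close>

definition hierarchy :: "'v set \<Rightarrow> 'v \<Rightarrow> 'v \<Rightarrow> 'v \<Rightarrow> bool" where
  "hierarchy P B \<alpha> h \<longleftrightarrow> func h (elts (succ \<alpha>)) UNIV \<and>
     app h empty = B \<and>
     (\<forall>\<beta>\<in>elts \<alpha>. elts (app h (succ \<beta>)) = Def P (app h \<beta>)) \<and>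
     (\<forall>\<gamma>\<in>elts (succ \<alpha>). \<gamma> \<noteq> empty \<and> (\<forall>\<beta>\<in>elts \<gamma>. \<gamma> \<noteq> succ \<beta>) \<longrightarrow>
        elts (app h \<gamma>) = (\<Union>\<beta>\<in>elts \<gamma>. elts (app h \<beta>)))"

definition constructible :: "'v set \<Rightarrow> 'v \<Rightarrow> 'v set" where
  "constructible P B = {x. \<exists>\<alpha> h. Ord \<alpha> \<and> hierarchy P B \<alpha> h \<and> x \<in> elts (app h \<alpha>)}"

definition tc_singleton :: "'v \<Rightarrow> 'v" where
  "tc_singleton x = the_set {y. \<forall>T. transitive T \<and> x \<in> elts T \<longrightarrow> y \<in> elts T}"

text \<open>\<open>L(x)\<close>, with \<open>L\<^sub>0(x)\<close> the transitive closure of \<open>{x}\<close>.\<close>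

definition L_over :: "'v \<Rightarrow> 'v set" where
  "L_over x = constructible {} (tc_singleton x)"

text \<open>\<open>L[S, x]\<close>\<close>

definition L_rel :: "'v \<Rightarrow> 'v \<Rightarrow> 'v set" where
  "L_rel S x = constructible {S, x} empty"

definition V_eq_L_power_Reals :: bool where
  "V_eq_L_power_Reals \<longleftrightarrow> L_over (the_set {A. elts A \<subseteq> Reals}) = UNIV"

subsection \<open>\<open>AD\<^sup>+\<close>\<close>

definition DC_Reals :: bool where
  "DC_Reals \<longleftrightarrow> (\<forall>r. (\<forall>x\<in>Reals. \<exists>y\<in>Reals. pair x y \<in> elts r) \<longrightarrow>
     (\<exists>f\<in>Fun Nat Reals. \<forall>n\<in>Nat. pair (app f n) (app f (succ n)) \<in> elts r))"

text \<open>Variable \<open>0\<close> of \<open>\<phi>\<close> denotes \<open>S\<close> and all the others denote \<open>x\<close>; so \<open>\<phi>\<close> has no parameters besides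
  \<open>S\<close> and \<open>x\<close>. Truth in the proper class \<open>L[S, x]\<close> is taken for metatheoretic formulas \<open>\<phi>\<close>, since
  there is no satisfaction relation inside the structure for a proper class.\<close>

definition infinity_Borel :: "'v \<Rightarrow> bool" where
  "infinity_Borel A \<longleftrightarrow> (\<exists>S \<phi>. (\<forall>\<alpha>\<in>elts S. Ord \<alpha>) \<and>
     elts A = {x \<in> Reals. sat mem (L_rel S x) ((\<lambda>_. x)(0 := S)) \<phi>})"

text \<open>The least \<^emph>\<open>nonzero\<close> ordinal that is not a surjective image of the reals: the empty set is
  trivially not one.\<close>

definition is_Theta :: "'v \<Rightarrow> bool" where
  "is_Theta \<theta> \<longleftrightarrow> Ord \<theta> \<and> \<theta> \<noteq> empty \<and> \<not> surjects Reals (elts \<theta>) \<and>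
     (\<forall>\<beta>\<in>elts \<theta>. \<beta> \<noteq> empty \<longrightarrow> surjects Reals (elts \<beta>))"

text \<open>Continuity for the product topologies of discrete spaces.\<close>

definition continuous :: "'v \<Rightarrow> 'v \<Rightarrow> bool" where
  "continuous \<mu> \<pi> \<longleftrightarrow> func \<pi> (Fun Nat (elts \<mu>)) Reals \<and>
     (\<forall>f\<in>Fun Nat (elts \<mu>). \<forall>n\<in>Nat. \<exists>m\<in>Nat. \<forall>g\<in>Fun Nat (elts \<mu>).
        restrict g m = restrict f m \<longrightarrow> restrict (app \<pi> g) n = restrict (app \<pi> f) n)"

definition strategy :: "'v \<Rightarrow> 'v \<Rightarrow> bool" where
  "strategy \<mu> \<sigma> \<longleftrightarrow> func \<sigma> (\<Union>n\<in>Nat. Tup \<mu> n) (elts \<mu>)"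

definition determined :: "'v \<Rightarrow> 'v set \<Rightarrow> bool" where
  "determined \<mu> B \<longleftrightarrow>
     (\<exists>\<sigma>. strategy \<mu> \<sigma> \<and> (\<forall>f\<in>Fun Nat (elts \<mu>).
        (\<forall>n\<in>Nat \<inter> Even. app f n = app \<sigma> (restrict f n)) \<longrightarrow> f \<in> B)) \<or>
     (\<exists>\<tau>. strategy \<mu> \<tau> \<and> (\<forall>f\<in>Fun Nat (elts \<mu>).
        (\<forall>n\<in>Nat - Even. app f n = app \<tau> (restrict f n)) \<longrightarrow> f \<notin> B))"

text \<open>\<open>\<mu> = 0\<close> is excluded because there are no moves, hence no strategies, in that game.\<close>

definition ordinal_determinacy :: bool where
  "ordinal_determinacy \<longleftrightarrow> (\<forall>\<theta> \<mu> A \<pi>.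
     is_Theta \<theta> \<and> \<mu> \<in> elts \<theta> \<and> \<mu> \<noteq> empty \<and> elts A \<subseteq> Reals \<and> continuous \<mu> \<pi> \<longrightarrow>
     determined \<mu> {f \<in> Fun Nat (elts \<mu>). app \<pi> f \<in> elts A})"

definition AD_plus :: bool where
  "AD_plus \<longleftrightarrow> DC_Reals \<and> (\<forall>A. elts A \<subseteq> Reals \<longrightarrow> infinity_Borel A) \<and> ordinal_determinacy"

subsection \<open>Equivalence relations on the reals\<close>

definition rel_of :: "'v \<Rightarrow> ('v \<times> 'v) set" where
  "rel_of r = {(x, y). pair x y \<in> elts r}"

definition equiv_on_Reals :: "'v \<Rightarrow> bool" where
  "equiv_on_Reals r \<longleftrightarrow> (\<forall>p\<in>elts r. \<exists>x\<in>Reals. \<exists>y\<in>Reals. p = pair x y) \<and> equiv Reals (rel_of r)"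

definition Quot :: "'v \<Rightarrow> 'v set" where
  "Quot r = {c. elts c \<in> Reals // rel_of r}"

definition smooth :: "'v \<Rightarrow> bool" where
  "smooth r \<longleftrightarrow> in_bijection (Quot r) Reals"

definition Times :: "'v set \<Rightarrow> 'v set \<Rightarrow> 'v set" where
  "Times X Y = {pair x y | x y. x \<in> X \<and> y \<in> Y}"

definition disjoint_union_Quot :: "'v \<Rightarrow> 'v \<Rightarrow> 'v set" where
  "disjoint_union_Quot \<kappa> E = {pair \<alpha> c | \<alpha> c. \<alpha> \<in> elts \<kappa> \<and> c \<in> Quot (app E \<alpha>)}"

end

end

theory Submission
  imports Defs
begin

text \<open>
  Let \<open>F\<close> be the union of the \<open>E\<^sub>\<alpha>\<close>, pulled back along characteristic functions to a relation on
  subsets of \<open>\<omega>\<close>. Determinacy of the Banach--Mazur game makes every binary relation on \<open>P(\<omega>)\<close> either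
  meager or comeager in some basic open box. If \<open>F\<close> were comeager in a box, then by Kuratowski--Ulam
  some section \<open>F\<^sub>x\<close> would be comeager somewhere. But \<open>F\<^sub>x\<close> is a wellordered union of countable sets,
  ranked by the least \<open>\<alpha>\<close> with \<open>x E\<^sub>\<alpha> y\<close>; comparing the ranks of two generic points and
  applying Kuratowski--Ulam once more, either a level set or a set of points of smaller rank is again
  comeager somewhere, which countability and the minimality of ranks exclude. So \<open>F\<close> is meager. By
  Mycielski's argument there is an injection \<open>g\<close> of the reals with \<open>g(a)\<close>, \<open>g(b)\<close> not \<open>F\<close>-related for
  \<open>a \<noteq> b\<close>, and \<open>(a, \<alpha>) \<mapsto> (\<alpha>, [g(a)])\<close>, the class being that of \<open>E\<^sub>\<alpha>\<close>, is the required map.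

  The structure may have nonstandard natural numbers, so induction, recursion and comprehension are
  available only for predicates definable with parameters; every such use carries a
  definability side condition.
\<close>

text \<open>A wellordered union of meager sets cannot be shown meager by merging dense families, one
  for each ordinal: there are too many of them, and no choice function is at hand to select them.
  Hence the detour through the plane: ranks turn the union into a prewellordering, and its strict
  part is a single binary relation to which determinacy applies. The same lack of choice shapes the
  encodings. A witness of comeagerness is one set of the structure that codes a whole sequence of
  dense sets, so nothing has to be chosen for each n. Sequences are built by taking least codes,
  since conditions and positions of the game are finite objects coded by natural numbers. The
  category argument takes place in P(\<omega>) rather than in Baire space because only finitely many
  conditions have a given length k, and the fusion has to meet a dense set above all of them at
  once.\<close>

primrec rename_fm :: "(nat \<Rightarrow> nat) \<Rightarrow> fm \<Rightarrow> fm" where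
  "rename_fm r (Mem i j) = Mem (r i) (r j)"
| "rename_fm r (Eq i j) = Eq (r i) (r j)"
| "rename_fm r (Neg p) = Neg (rename_fm r p)"
| "rename_fm r (And p q) = And (rename_fm r p) (rename_fm r q)"
| "rename_fm r (All i p) = All (r i) (rename_fm r p)"

text \<open>Injectivity matters at the quantifier: updating variable \<open>r i\<close> must leave
  the images of the other variables alone.\<close>

lemma sat_rename_fm: "inj r \<Longrightarrow> sat m D e (rename_fm r p) \<longleftrightarrow> sat m D (\<lambda>n. e (r n)) p"
proof (induction p arbitrary: e)
  case (All i p)
  have "(\<lambda>n. (e(r i := a)) (r n)) = (\<lambda>n. e (r n))(i := a)" for a
    using All.prems by (auto simp: fun_eq_iff inj_eq)
  then show ?case using All by simp
qed auto

lemma inj_case_nat: "inj r \<Longrightarrow> k \<notin> range r \<Longrightarrow> inj (case_nat k r)"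
  by (rule injI) (auto split: nat.splits dest: injD)

text \<open>The variables of a formula are split: the even ones carry the arguments of the defined predicate,
  the odd ones its parameters.\<close>

definition mix :: "(nat \<Rightarrow> 'a) \<Rightarrow> (nat \<Rightarrow> 'a) \<Rightarrow> nat \<Rightarrow> 'a" where
  "mix e c n = (if even n then e (n div 2) else c (n div 2))"

section \<open>Definability with parameters\<close>

context set_structure
begin

definition dfn :: "((nat \<Rightarrow> 'v) \<Rightarrow> bool) \<Rightarrow> bool" where
  "dfn P \<longleftrightarrow> (\<exists>\<phi> c. \<forall>e. P e \<longleftrightarrow> sat mem UNIV (mix e c) \<phi>)"

lemma dfn_rename:
  assumes "inj r" "dfn P"
  shows "dfn (\<lambda>e. P (\<lambda>n. e (r n)))"
proof -
  obtain \<phi> c where \<phi>: "\<And>e. P e \<longleftrightarrow> sat mem UNIV (mix e c) \<phi>" using assms(2) unfolding dfn_def by blast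
  \<comment> \<open>Only the even variables, which carry the arguments, are renamed; the parameters
    keep their places.\<close>
  let ?r = "\<lambda>n. if even n then 2 * r (n div 2) else n"
  have inj: "inj ?r"
  proof (rule injI)
    fix x y :: nat
    assume "?r x = ?r y"
    then show "x = y"
      using assms(1) by (cases "even x"; cases "even y") (auto simp: inj_eq)
  qed
  have "mix (\<lambda>n. e (r n)) c = (\<lambda>n. mix e c (?r n))" for e by (rule ext) (simp add: mix_def)
  then have "P (\<lambda>n. e (r n)) \<longleftrightarrow> sat mem UNIV (mix e c) (rename_fm ?r \<phi>)" for e
    unfolding \<phi> sat_rename_fm[OF inj] by (rule arg_cong)
  then show ?thesis unfolding dfn_def by blast
qed

lemma dfn_const_fm: "dfn (\<lambda>e. b)"
proof -
  have "\<exists>\<phi>. \<forall>e. b \<longleftrightarrow> sat mem UNIV e \<phi>"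
    by (cases b) (auto intro: exI[of _ "Eq 0 0"] exI[of _ "Neg (Eq 0 0)"])
  then show ?thesis unfolding dfn_def by metis
qed

lemma dfn_not: "dfn P \<Longrightarrow> dfn (\<lambda>e. \<not> P e)"
  unfolding dfn_def by (metis sat.simps(3))

lemma dfn_conj:
  assumes "dfn P" "dfn Q"
  shows "dfn (\<lambda>e. P e \<and> Q e)"
proof -
  obtain \<phi> c where \<phi>: "\<And>e. P e \<longleftrightarrow> sat mem UNIV (mix e c) \<phi>" using assms(1) unfolding dfn_def by blast
  obtain \<psi> c' where \<psi>: "\<And>e. Q e \<longleftrightarrow> sat mem UNIV (mix e c') \<psi>" using assms(2) unfolding dfn_def by blast
  \<comment> \<open>The two parameter lists are interleaved as \<open>mix c c'\<close>: parameter k,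
    found at variable 2k+1, moves to 4k+1 in the first formula and to 4k+3 in the second.\<close>
  let ?r = "\<lambda>n::nat. if even n then n else 2 * n - 1"
  let ?s = "\<lambda>n::nat. if even n then n else 2 * n + 1"
  have "x = y" if "?r x = ?r y" for x y :: nat
    using that by (cases "even x"; cases "even y") (simp; presburger)+
  then have r: "inj ?r" by (rule injI)
  have "x = y" if "?s x = ?s y" for x y :: nat
    using that by (cases "even x"; cases "even y") (simp; presburger)+
  then have s: "inj ?s" by (rule injI)
  have "mix e c n = mix e (mix c c') (?r n)" for e n
    by (cases "even n") (auto simp: mix_def elim: oddE)
  then have 1: "mix e c = (\<lambda>n. mix e (mix c c') (?r n))" for e by (rule ext)
  have "mix e c' n = mix e (mix c c') (?s n)" for e n
    by (cases "even n") (auto simp: mix_def elim: oddE)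
  then have 2: "mix e c' = (\<lambda>n. mix e (mix c c') (?s n))" for e by (rule ext)
  have "P e \<and> Q e \<longleftrightarrow> sat mem UNIV (mix e (mix c c')) (And (rename_fm ?r \<phi>) (rename_fm ?s \<psi>))" for e
    unfolding \<phi> \<psi> sat.simps sat_rename_fm[OF r] sat_rename_fm[OF s] 1[symmetric] 2[symmetric] by (rule refl)
  then show ?thesis unfolding dfn_def by blast
qed

lemma dfn_all:
  assumes "dfn (\<lambda>e. P (\<lambda>n. e (Suc n)) (e 0))"
  shows "dfn (\<lambda>e. \<forall>y. P e y)"
proof -
  obtain \<phi> c where \<phi>: "\<And>e. P (\<lambda>n. e (Suc n)) (e 0) \<longleftrightarrow> sat mem UNIV (mix e c) \<phi>"
    using assms unfolding dfn_def by blast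
  \<comment> \<open>The bound variable 0 moves to variable 1, the slot of parameter 0, which is
    freed by shifting the parameters by one; the other arguments move down to the places they have
    outside the quantifier.\<close>
  let ?r = "\<lambda>n::nat. if n = 0 then 1 else if even n then n - 2 else n + 2"
  have r: "inj ?r"
    by (rule inj_on_inverseI[where g = "\<lambda>m. if m = 1 then 0 else if even m then m + 2 else m - 2"]) (auto elim!: evenE, arith)
  have 1: "mix (case_nat a e) c = (\<lambda>n. ((mix e (case_nat undefined c))(1 := a)) (?r n))" for e a
  proof
    fix n
    show "mix (case_nat a e) c n = ((mix e (case_nat undefined c))(1 := a)) (?r n)"
    proof (cases "even n")
      case True
      then obtain k where "n = 2 * k" by blast
      then show ?thesis by (cases k) (auto simp: mix_def)
    next
      case False
      then obtain k where "n = 2 * k + 1" by (blast elim: oddE)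
      then show ?thesis by (auto simp: mix_def)
    qed
  qed
  have 2: "P e a \<longleftrightarrow> sat mem UNIV (mix (case_nat a e) c) \<phi>" for e a
    using \<phi>[of "case_nat a e"] by simp
  have "(\<forall>y. P e y) \<longleftrightarrow> sat mem UNIV (mix e (case_nat undefined c)) (All 1 (rename_fm ?r \<phi>))" for e
    unfolding 2 1 sat.simps sat_rename_fm[OF r] by blast
  then show ?thesis unfolding dfn_def by blast
qed

lemma dfn_iff_cong: "dfn P \<Longrightarrow> (\<And>e. P e \<longleftrightarrow> Q e) \<Longrightarrow> dfn Q"
  unfolding dfn_def by simp

lemma dfn_disj: "dfn P \<Longrightarrow> dfn Q \<Longrightarrow> dfn (\<lambda>e. P e \<or> Q e)"
  by (rule dfn_iff_cong[OF dfn_not[OF dfn_conj[OF dfn_not dfn_not]]]) auto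

lemma dfn_imp: "dfn P \<Longrightarrow> dfn Q \<Longrightarrow> dfn (\<lambda>e. P e \<longrightarrow> Q e)"
  by (rule dfn_iff_cong[OF dfn_disj[OF dfn_not]]) auto

lemma dfn_iff: "dfn P \<Longrightarrow> dfn Q \<Longrightarrow> dfn (\<lambda>e. P e \<longleftrightarrow> Q e)"
  by (rule dfn_iff_cong[OF dfn_conj[OF dfn_imp dfn_imp, of P Q Q P]]) auto

lemma dfn_ex:
  assumes "dfn (\<lambda>e. P (\<lambda>n. e (Suc n)) (e 0))"
  shows "dfn (\<lambda>e. \<exists>y. P e y)"
  by (rule dfn_iff_cong[OF dfn_not[OF dfn_all[where P = "\<lambda>e y. \<not> P e y"]]]) (auto intro: dfn_not assms)

lemma dfn_mem_var: "dfn (\<lambda>e. e i \<in>\<^sub>M e j)"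
  unfolding dfn_def by (rule exI[of _ "Mem (2*i) (2*j)"]) (simp add: mix_def)

lemma dfn_eq_var: "dfn (\<lambda>e. e i = e j)"
  unfolding dfn_def by (rule exI[of _ "Eq (2*i) (2*j)"]) (simp add: mix_def)

lemma dfn_eq_const: "dfn (\<lambda>e. e i = c)"
  unfolding dfn_def
  by (rule exI[of _ "Eq (2*i) 1"], rule exI[of _ "\<lambda>_. c"]) (simp add: mix_def)

text \<open>A term is definable if its graph is; in the graph, variable \<open>0\<close> is the value and the arguments are
  shifted by one. Binders are treated in the same way: the bound variable becomes variable \<open>0\<close>.\<close>

definition dterm :: "((nat \<Rightarrow> 'v) \<Rightarrow> 'v) \<Rightarrow> bool" where
  "dterm t \<longleftrightarrow> dfn (\<lambda>e. e 0 = t (\<lambda>n. e (Suc n)))"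

lemma dterm_rename:
  assumes "inj r" "dterm t"
  shows "dterm (\<lambda>e. t (\<lambda>n. e (r n)))"
proof -
  have "inj (case_nat 0 (\<lambda>n. Suc (r n)))"
    using assms(1) by (intro inj_case_nat) (auto simp: inj_def)
  from dfn_rename[OF this assms(2)[unfolded dterm_def]]
  show ?thesis unfolding dterm_def by simp
qed

lemma dterm_shift: "dterm t \<Longrightarrow> dterm (\<lambda>e. t (\<lambda>n. e (Suc n)))"
  using dterm_rename[of Suc t] by simp

text \<open>The language of \<open>fm\<close> has no terms, so a term is substituted through its
  graph: some y equals t and satisfies P.\<close>

lemma dfn_subst:
  assumes "dterm t" "dfn (\<lambda>e. P (\<lambda>n. e (Suc n)) (e 0))"
  shows "dfn (\<lambda>e. P e (t e))"
proof -
  have "dfn (\<lambda>e. \<exists>y. y = t e \<and> P e y)"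
    using assms by (intro dfn_ex dfn_conj) (simp_all add: dterm_def)
  then show ?thesis by simp
qed

lemma dfn_lift1: "dfn (\<lambda>e. P (e 0)) \<Longrightarrow> dterm t \<Longrightarrow> dfn (\<lambda>e. P (t e))"
  using dfn_subst[of t "\<lambda>e. P"] by simp

lemma dfn_lift2:
  assumes "dfn (\<lambda>e. P (e 0) (e 1))" "dterm t" "dterm u"
  shows "dfn (\<lambda>e. P (t e) (u e))"
proof (rule dfn_subst[OF assms(2), where P = "\<lambda>e y. P y (u e)"])
  show "dfn (\<lambda>e. P (e 0) (u (\<lambda>n. e (Suc n))))"
  proof (rule dfn_subst[OF dterm_shift[OF assms(3)], where P = "\<lambda>e y. P (e 0) y"])
    \<comment> \<open>This renaming exchanges variables 0 and 1, because the second substitution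
      binds in front of the first.\<close>
    have "inj (case_nat 1 (case_nat 0 (\<lambda>n. Suc (Suc n))))"
      by (intro inj_case_nat) (auto simp: image_iff inj_def split: nat.splits)
    from dfn_rename[OF this assms(1)] show "dfn (\<lambda>e. P (e (Suc 0)) (e 0))" by simp
  qed
qed

lemma dfn_lift3:
  assumes "dfn (\<lambda>e. P (e 0) (e 1) (e 2))" "dterm t" "dterm u" "dterm v"
  shows "dfn (\<lambda>e. P (t e) (u e) (v e))"
proof (rule dfn_subst[OF assms(2), where P = "\<lambda>e y. P y (u e) (v e)"])
  show "dfn (\<lambda>e. P (e 0) (u (\<lambda>n. e (Suc n))) (v (\<lambda>n. e (Suc n))))"
  proof (rule dfn_subst[OF dterm_shift[OF assms(3)], where P = "\<lambda>e y. P (e 0) y (v (\<lambda>n. e (Suc n)))"])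
    show "dfn (\<lambda>e. P (e (Suc 0)) (e 0) (v (\<lambda>n. e (Suc (Suc n)))))"
    proof (rule dfn_subst[OF dterm_shift[OF dterm_shift[OF assms(4)]], where P = "\<lambda>e y. P (e (Suc 0)) (e 0) y"])
      have "inj (case_nat 2 (case_nat 1 (case_nat 0 (\<lambda>n. Suc (Suc (Suc n))))))"
        by (intro inj_case_nat) (auto simp: image_iff inj_def split: nat.splits)
      from dfn_rename[OF this assms(1)] 
      show "dfn (\<lambda>e. P (e (Suc (Suc 0))) (e (Suc 0)) (e 0))" by (simp add: numeral_2_eq_2)
    qed
  qed
qed

lemma dterm_var: "dterm (\<lambda>e. e n)"
  unfolding dterm_def by (rule dfn_eq_var)

lemma dterm_const: "dterm (\<lambda>e. c)"
  unfolding dterm_def by (rule dfn_eq_const)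

lemma dfn_mem: "dterm t \<Longrightarrow> dterm u \<Longrightarrow> dfn (\<lambda>e. t e \<in>\<^sub>M u e)"
  using dfn_lift2[of "(\<in>\<^sub>M)" t u] dfn_mem_var by simp

lemma dfn_elts: "dterm t \<Longrightarrow> dterm u \<Longrightarrow> dfn (\<lambda>e. t e \<in> elts (u e))"
  unfolding elts_def by (simp add: dfn_mem)

lemma dfn_eq: "dterm t \<Longrightarrow> dterm u \<Longrightarrow> dfn (\<lambda>e. t e = u e)"
  using dfn_lift2[of "(=)" t u] dfn_eq_var by simp

lemma dfn_ball:
  assumes "dterm t" "dfn (\<lambda>e. P (\<lambda>n. e (Suc n)) (e 0))"
  shows "dfn (\<lambda>e. \<forall>y\<in>elts (t e). P e y)"
  unfolding Ball_def by (intro dfn_all dfn_imp dfn_elts dterm_var dterm_shift[OF assms(1)] assms(2))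

lemma dfn_bex:
  assumes "dterm t" "dfn (\<lambda>e. P (\<lambda>n. e (Suc n)) (e 0))"
  shows "dfn (\<lambda>e. \<exists>y\<in>elts (t e). P e y)"
  unfolding Bex_def by (intro dfn_ex dfn_conj dfn_elts dterm_var dterm_shift[OF assms(1)] assms(2))

lemma dfn_subset:
  assumes "dterm t" "dterm u"
  shows "dfn (\<lambda>e. elts (t e) \<subseteq> elts (u e))"
  unfolding subset_iff
  by (intro dfn_all dfn_imp dfn_elts dterm_var dterm_shift[OF assms(1)] dterm_shift[OF assms(2)])

lemma dterm_lift1:
  assumes "dterm (\<lambda>e. f (e 0))" "dterm t"
  shows "dterm (\<lambda>e. f (t e))"
  unfolding dterm_def
proof (rule dfn_subst[OF dterm_shift[OF assms(2)], where P = "\<lambda>e y. e 0 = f y"])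
  have "inj (case_nat 1 (case_nat 0 (\<lambda>n. Suc (Suc n))))"
    by (intro inj_case_nat) (auto simp: image_iff inj_def split: nat.splits)
  from dfn_rename[OF this assms(1)[unfolded dterm_def]] show "dfn (\<lambda>e. e (Suc 0) = f (e 0))"
    by simp
qed

lemma dterm_lift2:
  assumes "dterm (\<lambda>e. f (e 0) (e 1))" "dterm t" "dterm u"
  shows "dterm (\<lambda>e. f (t e) (u e))"
  unfolding dterm_def
  using dfn_lift3[of "\<lambda>x y z. x = f y z", OF _ dterm_var[of 0] dterm_shift[OF assms(2)] dterm_shift[OF assms(3)]] assms(1)
  by (simp add: dterm_def numeral_2_eq_2)

lemma dterm_if:
  assumes "dfn P" "dterm t" "dterm u"
  shows "dterm (\<lambda>e. if P e then t e else u e)"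
proof -
  have P: "dfn (\<lambda>e. P (\<lambda>n. e (Suc n)))" using dfn_rename[of Suc P] assms(1) by simp
  have "dfn (\<lambda>e. (P (\<lambda>n. e (Suc n)) \<longrightarrow> e 0 = t (\<lambda>n. e (Suc n))) \<and> (\<not> P (\<lambda>n. e (Suc n)) \<longrightarrow> e 0 = u (\<lambda>n. e (Suc n))))"
    using assms(2,3) unfolding dterm_def by (intro dfn_conj dfn_imp dfn_not P)
  then show ?thesis unfolding dterm_def by (rule dfn_iff_cong) simp
qed

end

named_theorems dfn_intros

context set_structure
begin

text \<open>Inserts a dummy variable just after the bound one, for binders whose unfolding puts
  their body under a further quantifier.\<close>

lemma dfn_skip:
  assumes "dfn (\<lambda>e. P (\<lambda>n. e (Suc n)) (e 0))"
  shows "dfn (\<lambda>e. P (\<lambda>n. e (Suc (Suc n))) (e 0))"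
proof -
  have "inj (case_nat 0 (\<lambda>n. Suc (Suc n)))" by (intro inj_case_nat) (auto simp: inj_def)
  from dfn_rename[OF this assms] show ?thesis by simp
qed

lemma dterm_skip:
  assumes "dterm (\<lambda>e. F (\<lambda>n. e (Suc n)) (e 0))"
  shows "dterm (\<lambda>e. F (\<lambda>n. e (Suc (Suc n))) (e 0))"
proof -
  have "inj (case_nat 0 (\<lambda>n. Suc (Suc n)))" by (intro inj_case_nat) (auto simp: inj_def)
  from dterm_rename[OF this assms] show ?thesis by simp
qed

text \<open>Unlike \<open>The\<close>, whose value outside the unique-existence case depends on the predicate in an unknown
  way, this is definable.\<close>

definition the1 :: "('v \<Rightarrow> bool) \<Rightarrow> 'v" where
  "the1 P = (if \<exists>!y. P y then THE y. P y else empty)"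

lemma the1_eqI:
  assumes "P y" "\<And>z. P z \<Longrightarrow> z = y"
  shows "the1 P = y"
proof -
  have "\<exists>!y. P y" using assms by blast
  then have "the1 P = (THE y. P y)" by (simp add: the1_def)
  also have "\<dots> = y" using assms by (rule the_equality)
  finally show ?thesis .
qed

lemma the1_prop:
  assumes "\<exists>!y. P y"
  shows "P (the1 P)"
  unfolding the1_def using assms theI'[of P] by simp

lemma dterm_the1:
  assumes "dfn (\<lambda>e. P (\<lambda>n. e (Suc n)) (e 0))"
  shows "dterm (\<lambda>e. the1 (P e))"
proof -
  note 1 = dfn_skip[of P, OF assms]
  note 2 = dfn_skip[of "\<lambda>e. P (\<lambda>n. e (Suc n))", OF 1]
  have u: "x = the1 Q \<longleftrightarrow> (Q x \<and> (\<forall>z. Q z \<longrightarrow> z = x)) \<or> (\<not> (\<exists>y. Q y \<and> (\<forall>z. Q z \<longrightarrow> z = y)) \<and> x = empty)" for Q x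
  proof (cases "\<exists>!y. Q y")
    case True
    then show ?thesis using the1_prop[of Q] by blast
  next
    case False
    then have "the1 Q = empty" by (simp add: the1_def)
    then show ?thesis using False unfolding Ex1_def by auto
  qed
  show ?thesis
    unfolding dterm_def u
    by (intro dfn_disj dfn_conj dfn_all dfn_ex dfn_imp dfn_not dfn_eq dterm_var dterm_const assms 1 2)
qed

lemma dfn_ex1:
  assumes "dfn (\<lambda>e. P (\<lambda>n. e (Suc n)) (e 0))"
  shows "dfn (\<lambda>e. \<exists>!y. P e y)"
  unfolding Ex1_def
  by (intro dfn_conj dfn_all dfn_ex dfn_imp dfn_eq dterm_var assms dfn_skip[of P, OF assms])

lemmas [dfn_intros] = dfn_const_fm dfn_not dfn_conj dfn_disj dfn_imp dfn_iff dfn_all dfn_ex dfn_ex1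
  dterm_var dterm_const dfn_elts dfn_eq dfn_ball dfn_bex dfn_subset dterm_if dterm_the1

end

section \<open>Comprehension and replacement for definable predicates\<close>

locale zf = set_structure mem for mem :: "'v \<Rightarrow> 'v \<Rightarrow> bool" (infix "\<in>\<^sub>M" 50) +
  assumes ZF: "ZF"
begin

lemma set_ext: "elts x = elts y \<Longrightarrow> x = y"
  using ZF unfolding ZF_def extensionality_def by blast

lemma set_eq_iff: "x = y \<longleftrightarrow> elts x = elts y"
  using set_ext by blast

lemma foundation_min:
  assumes "a \<in> elts x"
  obtains y where "y \<in> elts x" "\<And>z. z \<in> elts y \<Longrightarrow> z \<notin> elts x"
  using ZF assms unfolding ZF_def foundation_def by (metis disjoint_iff emptyE)

definition is_set :: "'v set \<Rightarrow> bool" where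
  "is_set X \<longleftrightarrow> (\<exists>z. elts z = X)"

lemma is_set_elts: "is_set (elts x)" unfolding is_set_def by blast

lemma elts_the_set: "is_set X \<Longrightarrow> elts (the_set X) = X"
  unfolding is_set_def the_set_def by (metis (mono_tags, lifting) set_ext theI)

lemma the_set_elts: "the_set (elts x) = x"
  by (rule set_ext) (simp add: elts_the_set is_set_elts)

lemma elts_the1:
  assumes "is_set {y. P y}"
  shows "elts (the1 (\<lambda>z. \<forall>y. y \<in> elts z \<longleftrightarrow> P y)) = {y. P y}"
proof -
  obtain z where z: "elts z = {y. P y}" using assms unfolding is_set_def by blast
  have "the1 (\<lambda>z. \<forall>y. y \<in> elts z \<longleftrightarrow> P y) = z"
    by (rule the1_eqI) (auto simp: z intro: set_ext)
  then show ?thesis using z by simp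
qed

lemma is_set_sep:
  assumes "dfn (\<lambda>e. P (e 0))"
  shows "is_set {y. y \<in> elts x \<and> P y}"
proof -
  obtain \<phi> c where \<phi>: "\<And>e. P (e 0) \<longleftrightarrow> sat mem UNIV (mix e c) \<phi>" using assms unfolding dfn_def by blast
  have "mix ((\<lambda>_. x)(0 := y)) c = (mix (\<lambda>_. x) c)(0 := y)" for y
    by (rule ext) (auto simp: mix_def)
  then have "P y \<longleftrightarrow> sat mem UNIV ((mix (\<lambda>_. x) c)(0 := y)) \<phi>" for y
    using \<phi>[of "(\<lambda>_. x)(0 := y)"] by simp
  moreover have "\<exists>z. elts z = {y \<in> elts x. sat mem UNIV ((mix (\<lambda>_. x) c)(0 := y)) \<phi>}"
    using ZF unfolding ZF_def separation_def by blast
  ultimately show ?thesis unfolding is_set_def by simp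
qed

lemma is_set_sub:
  assumes "dfn (\<lambda>e. P (e 0))" "\<And>y. P y \<Longrightarrow> y \<in> elts x"
  shows "is_set {y. P y}"
proof -
  have "{y. P y} = {y. y \<in> elts x \<and> P y}" using assms(2) by blast
  then show ?thesis using is_set_sep[OF assms(1)] by simp
qed

lemma is_set_replacement:
  assumes "dfn (\<lambda>e. P (e 0) (e 1))" "\<And>y w w'. y \<in> elts x \<Longrightarrow> P y w \<Longrightarrow> P y w' \<Longrightarrow> w = w'"
  shows "is_set {w. \<exists>y\<in>elts x. P y w}"
proof -
  obtain \<phi> c where \<phi>: "\<And>e. P (e 0) (e 1) \<longleftrightarrow> sat mem UNIV (mix e c) \<phi>" using assms unfolding dfn_def by blast
  \<comment> \<open>\<open>mix\<close> places the second argument of P at variable 2, while the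
    Replacement axiom expects it at variable 1.\<close>
  let ?r = "\<lambda>n::nat. if n = 1 then 2 else if n = 2 then 1 else n"
  have r: "inj ?r" by (rule inj_on_inverseI[where g = ?r]) auto
  define e where "e = (\<lambda>n. mix (\<lambda>_. x) c (?r n))"
  have mix: "mix (\<lambda>n. if n = 0 then y else if n = 1 then w else x) c = (\<lambda>n. (e(0 := y, 1 := w)) (?r n))" for y w
    by (rule ext) (auto simp: mix_def e_def elim!: evenE)
  have eq: "P y w \<longleftrightarrow> sat mem UNIV (e(0 := y, 1 := w)) (rename_fm ?r \<phi>)" for y w
    using \<phi>[of "\<lambda>n. if n = 0 then y else if n = 1 then w else x"] unfolding sat_rename_fm[OF r] mix by simp
  have "\<exists>z. elts z = {w. \<exists>y\<in>elts x. sat mem UNIV (e(0 := y, 1 := w)) (rename_fm ?r \<phi>)}"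
    using ZF assms(2) unfolding ZF_def replacement_def eq by meson
  then show ?thesis unfolding is_set_def eq .
qed

lemma is_set_image:
  assumes "dterm (\<lambda>e. F (e 0))"
  shows "is_set {w. \<exists>y\<in>elts x. w = F y}"
proof (rule is_set_replacement)
  have "inj (case_nat 1 (case_nat 0 (\<lambda>n. Suc (Suc n))))"
    by (intro inj_case_nat) (auto simp: image_iff inj_def split: nat.splits)
  from dfn_rename[OF this assms(1)[unfolded dterm_def]] show "dfn (\<lambda>e. e 1 = F (e 0))" by simp
qed auto

subsection \<open>Basic operations\<close>

definition sep :: "'v \<Rightarrow> ('v \<Rightarrow> bool) \<Rightarrow> 'v" where
  "sep x P = the1 (\<lambda>z. \<forall>y. y \<in> elts z \<longleftrightarrow> y \<in> elts x \<and> P y)"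

lemma elts_sep: "dfn (\<lambda>e. P (e 0)) \<Longrightarrow> elts (sep x P) = {y \<in> elts x. P y}"
  unfolding sep_def by (rule elts_the1) (rule is_set_sep)

lemma dterm_sep [dfn_intros]:
  assumes "dterm t" "dfn (\<lambda>e. P (\<lambda>n. e (Suc n)) (e 0))"
  shows "dterm (\<lambda>e. sep (t e) (P e))"
  unfolding sep_def
  by (intro dfn_intros dterm_shift[OF dterm_shift[OF assms(1)]] dfn_skip[of P, OF assms(2)])

definition upair :: "'v \<Rightarrow> 'v \<Rightarrow> 'v" where
  "upair x y = the1 (\<lambda>z. \<forall>w. w \<in> elts z \<longleftrightarrow> w = x \<or> w = y)"

lemma is_set_upair: "is_set {x, y}"
  using ZF unfolding ZF_def pairing_def is_set_def by blast

lemma elts_upair [simp]: "elts (upair x y) = {x, y}"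
proof -
  have "{w. w = x \<or> w = y} = {x, y}" by auto
  then show ?thesis unfolding upair_def using elts_the1[of "\<lambda>w. w = x \<or> w = y"] is_set_upair by simp
qed

lemma dterm_upair_var: "dterm (\<lambda>e. upair (e i) (e j))"
  unfolding upair_def by (intro dfn_intros)

lemma dterm_upair [dfn_intros]: "dterm t \<Longrightarrow> dterm u \<Longrightarrow> dterm (\<lambda>e. upair (t e) (u e))"
  by (rule dterm_lift2[OF dterm_upair_var[of 0 1]])

lemma pair_eq_upair: "pair x y = upair (upair x x) (upair x y)"
proof -
  have "the_set {x, y} = upair x y" for x y by (metis elts_upair the_set_elts)
  then show ?thesis unfolding pair_def by (metis insert_absorb2)
qed

lemma dterm_pair [dfn_intros]: "dterm t \<Longrightarrow> dterm u \<Longrightarrow> dterm (\<lambda>e. pair (t e) (u e))"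
  unfolding pair_eq_upair by (intro dfn_intros)

lemma pair_eq_iff [simp]: "pair x y = pair x' y' \<longleftrightarrow> x = x' \<and> y = y'"
  unfolding pair_eq_upair set_eq_iff[of "upair _ _"] elts_upair
  by (metis doubleton_eq_iff elts_upair)

lemma elts_empty [simp]: "elts empty = {}"
proof -
  have "is_set {y. y \<in> elts undefined \<and> False}" by (rule is_set_sep) (intro dfn_intros)
  then show ?thesis unfolding empty_def by (simp add: elts_the_set)
qed

lemma eq_empty_iff: "x = empty \<longleftrightarrow> elts x = {}"
  by (simp add: set_eq_iff)

definition Unn :: "'v \<Rightarrow> 'v" where
  "Unn x = the1 (\<lambda>z. \<forall>y. y \<in> elts z \<longleftrightarrow> (\<exists>w\<in>elts x. y \<in> elts w))"

lemma elts_Unn [simp]: "elts (Unn x) = (\<Union>w\<in>elts x. elts w)"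
proof -
  have "\<exists>z. elts z = (\<Union>w\<in>elts x. elts w)" using ZF unfolding ZF_def union_axiom_def by blast
  moreover have "(\<Union>w\<in>elts x. elts w) = {y. \<exists>w\<in>elts x. y \<in> elts w}" by auto
  ultimately show ?thesis unfolding Unn_def using elts_the1[of "\<lambda>y. \<exists>w\<in>elts x. y \<in> elts w"]
    by (simp add: is_set_def)
qed

lemma dterm_Unn [dfn_intros]: "dterm t \<Longrightarrow> dterm (\<lambda>e. Unn (t e))"
  by (rule dterm_lift1[where f = Unn]) (unfold Unn_def, intro dfn_intros)

definition union :: "'v \<Rightarrow> 'v \<Rightarrow> 'v" where "union x y = Unn (upair x y)"

lemma elts_union [simp]: "elts (union x y) = elts x \<union> elts y"
  unfolding union_def by simp

lemma dterm_union [dfn_intros]: "dterm t \<Longrightarrow> dterm u \<Longrightarrow> dterm (\<lambda>e. union (t e) (u e))"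
  unfolding union_def by (intro dfn_intros)

definition inter :: "'v \<Rightarrow> 'v \<Rightarrow> 'v" where "inter x y = sep x (\<lambda>z. z \<in> elts y)"

lemma elts_inter [simp]: "elts (inter x y) = elts x \<inter> elts y"
  unfolding inter_def by (subst elts_sep) (intro dfn_intros, auto)

lemma dterm_inter [dfn_intros]: "dterm t \<Longrightarrow> dterm u \<Longrightarrow> dterm (\<lambda>e. inter (t e) (u e))"
  by (rule dterm_lift2[where f = inter]) (unfold inter_def, intro dfn_intros)

definition diff :: "'v \<Rightarrow> 'v \<Rightarrow> 'v" where "diff x y = sep x (\<lambda>z. z \<notin> elts y)"

lemma elts_diff [simp]: "elts (diff x y) = elts x - elts y"
  unfolding diff_def by (subst elts_sep) (intro dfn_intros, auto)

lemma dterm_diff [dfn_intros]: "dterm t \<Longrightarrow> dterm u \<Longrightarrow> dterm (\<lambda>e. diff (t e) (u e))"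
  by (rule dterm_lift2[where f = diff]) (unfold diff_def, intro dfn_intros)

definition Pw :: "'v \<Rightarrow> 'v" where
  "Pw x = the1 (\<lambda>z. \<forall>y. y \<in> elts z \<longleftrightarrow> elts y \<subseteq> elts x)"

lemma elts_Pw [simp]: "elts (Pw x) = {y. elts y \<subseteq> elts x}"
  unfolding Pw_def by (rule elts_the1) (use ZF in \<open>auto simp: ZF_def power_set_axiom_def is_set_def\<close>)

lemma elts_succ [simp]: "elts (succ x) = insert x (elts x)"
proof -
  have "elts (union x (upair x x)) = insert x (elts x)" by simp
  then show ?thesis unfolding succ_def by (metis the_set_elts)
qed

lemma succ_eq: "succ x = union x (upair x x)"
  by (rule set_ext) simp

lemma dterm_succ [dfn_intros]: "dterm t \<Longrightarrow> dterm (\<lambda>e. succ (t e))"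
  unfolding succ_eq by (intro dfn_intros)

definition prod :: "'v \<Rightarrow> 'v \<Rightarrow> 'v" where
  "prod a b = sep (Pw (Pw (union a b))) (\<lambda>p. \<exists>x\<in>elts a. \<exists>y\<in>elts b. p = pair x y)"

lemma elts_prod: "elts (prod a b) = {pair x y | x y. x \<in> elts a \<and> y \<in> elts b}"
  unfolding prod_def
  by (subst elts_sep, intro dfn_intros) (auto simp: pair_eq_upair)

lemma pair_in_prod [simp]: "pair x y \<in> elts (prod a b) \<longleftrightarrow> x \<in> elts a \<and> y \<in> elts b"
  by (auto simp: elts_prod)

text \<open>\<open>app\<close> rests on \<open>THE\<close>, whose value off the domain need not be
  definable; \<open>ap\<close> agrees with it on functions and is a term of the definability
  calculus everywhere.\<close>

definition ap :: "'v \<Rightarrow> 'v \<Rightarrow> 'v" where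
  "ap f x = the1 (\<lambda>y. pair x y \<in> elts f)"

lemma dterm_ap [dfn_intros]: "dterm t \<Longrightarrow> dterm u \<Longrightarrow> dterm (\<lambda>e. ap (t e) (u e))"
  by (rule dterm_lift2[where f = ap]) (unfold ap_def, intro dfn_intros)

lemma app_eq_ap: "\<exists>!y. pair x y \<in> elts f \<Longrightarrow> app f x = ap f x"
  unfolding app_def ap_def the1_def by simp

lemma func_app: "func f X Y \<Longrightarrow> x \<in> X \<Longrightarrow> app f x = ap f x"
  by (auto simp: func_def intro!: app_eq_ap)

lemma func_pair_iff: "func f X Y \<Longrightarrow> x \<in> X \<Longrightarrow> pair x y \<in> elts f \<longleftrightarrow> y = ap f x"
  unfolding func_def ap_def using the1_prop[of "\<lambda>y. pair x y \<in> elts f"] by blast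

lemma func_ap_in: "func f X Y \<Longrightarrow> x \<in> X \<Longrightarrow> ap f x \<in> Y"
  using func_pair_iff[of f X Y x "ap f x"] unfolding func_def by (metis pair_eq_iff)

lemma func_ext:
  assumes "func f X Y" "func g X Z" "\<And>x. x \<in> X \<Longrightarrow> ap f x = ap g x"
  shows "f = g"
proof (rule set_ext)
  have "p \<in> elts f \<longleftrightarrow> (\<exists>x\<in>X. p = pair x (ap f x))" for p
    using assms(1) func_pair_iff[OF assms(1)] unfolding func_def by metis
  moreover have "p \<in> elts g \<longleftrightarrow> (\<exists>x\<in>X. p = pair x (ap g x))" for p
    using assms(2) func_pair_iff[OF assms(2)] unfolding func_def by metis
  ultimately show "elts f = elts g" using assms(3) by auto
qed

text \<open>The graph exists by Replacement, so no codomain has to be named when a function is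
  introduced.\<close>

definition lam :: "'v \<Rightarrow> ('v \<Rightarrow> 'v) \<Rightarrow> 'v" where
  "lam a F = the1 (\<lambda>f. \<forall>p. p \<in> elts f \<longleftrightarrow> (\<exists>x\<in>elts a. p = pair x (F x)))"

lemma dterm_lam [dfn_intros]:
  assumes "dterm t" "dterm (\<lambda>e. F (\<lambda>n. e (Suc n)) (e 0))"
  shows "dterm (\<lambda>e. lam (t e) (F e))"
  unfolding lam_def
  by (intro dfn_intros dterm_shift[OF dterm_shift[OF assms(1)]]
      dterm_skip[of "\<lambda>e. F (\<lambda>n. e (Suc n))", OF dterm_skip[of F, OF assms(2)]])

lemma elts_lam:
  assumes "dterm (\<lambda>e. F (e 0))"
  shows "elts (lam a F) = {p. \<exists>x\<in>elts a. p = pair x (F x)}"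
  unfolding lam_def by (rule elts_the1, rule is_set_image) (intro dfn_intros assms)

lemma func_lam:
  assumes "dterm (\<lambda>e. F (e 0))" "\<And>x. x \<in> elts a \<Longrightarrow> F x \<in> Y"
  shows "func (lam a F) (elts a) Y"
  unfolding func_def elts_lam[OF assms(1)] using assms(2) by auto

lemma ap_lam:
  assumes "dterm (\<lambda>e. F (e 0))" "x \<in> elts a"
  shows "ap (lam a F) x = F x"
  unfolding ap_def elts_lam[OF assms(1)] by (rule the1_eqI) (use assms(2) in auto)

lemma in_irrefl: "x \<notin> elts x"
proof
  assume "x \<in> elts x"
  then show False using foundation_min[of x "upair x x"] by auto
qed

lemma in_asym: "x \<in> elts y \<Longrightarrow> y \<notin> elts x"
proof
  assume "x \<in> elts y" "y \<in> elts x"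
  then show False using foundation_min[of x "upair x y"] by auto
qed

lemma succ_inject: "succ x = succ y \<Longrightarrow> x = y"
  unfolding set_eq_iff[of "succ x"] elts_succ by (metis in_asym insert_iff)

lemma succ_neq_empty [simp]: "succ x \<noteq> empty" "empty \<noteq> succ x"
  by (auto simp: set_eq_iff)

subsection \<open>Ordinals\<close>

lemma dfn_transitive [dfn_intros]: "dterm t \<Longrightarrow> dfn (\<lambda>e. transitive (t e))"
  by (rule dfn_lift1[where P = transitive]) (unfold transitive_def, intro dfn_intros)

lemma dfn_Ord [dfn_intros]: "dterm t \<Longrightarrow> dfn (\<lambda>e. Ord (t e))"
  by (rule dfn_lift1[where P = Ord]) (unfold Ord_def, intro dfn_intros)

lemma Ord_in: "Ord a \<Longrightarrow> b \<in> elts a \<Longrightarrow> Ord b"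
  unfolding Ord_def transitive_def by blast

lemma Ord_trans: "Ord a \<Longrightarrow> b \<in> elts a \<Longrightarrow> c \<in> elts b \<Longrightarrow> c \<in> elts a"
  unfolding Ord_def transitive_def by blast

text \<open>Two nested minimal choices: a0 is minimal in \<open>succ a\<close> among the sets
  incomparable with some ordinal, and b0 is minimal in \<open>succ b'\<close> among those
  incomparable with a0. The elements of each are then comparable with the other, which forces a0 and
  b0 to have the same elements.\<close>

lemma Ord_linear:
  assumes "Ord a" "Ord b"
  shows "a \<in> elts b \<or> a = b \<or> b \<in> elts a"
proof (rule ccontr)
  define inc where "inc x y \<longleftrightarrow> x \<notin> elts y \<and> x \<noteq> y \<and> y \<notin> elts x" for x y
  assume "\<not> ?thesis"
  then have ab: "inc a b" by (auto simp: inc_def)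
  define A where "A = sep (succ a) (\<lambda>x. \<exists>y. Ord y \<and> inc x y)"
  have A: "elts A = {x \<in> elts (succ a). \<exists>y. Ord y \<and> inc x y}"
    unfolding A_def inc_def by (rule elts_sep) (intro dfn_intros)
  have "a \<in> elts A" using A ab assms by auto
  then obtain a0 where a0: "a0 \<in> elts A" "\<And>z. z \<in> elts a0 \<Longrightarrow> z \<notin> elts A"
    by (erule foundation_min)
  have "a0 \<in> elts (succ a)" using a0(1) A by blast
  then have oa0: "Ord a0" and sub: "elts a0 \<subseteq> elts (succ a)"
    using assms(1) Ord_in Ord_trans unfolding elts_succ by blast+
  obtain b' where b': "Ord b'" "inc a0 b'" using a0 A by auto
  define B where "B = sep (succ b') (\<lambda>y. inc a0 y)"
  have B: "elts B = {y \<in> elts (succ b'). inc a0 y}"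
    unfolding B_def inc_def by (rule elts_sep) (intro dfn_intros)
  have "b' \<in> elts B" using B b' by auto
  then obtain b0 where b0: "b0 \<in> elts B" "\<And>z. z \<in> elts b0 \<Longrightarrow> z \<notin> elts B"
    by (erule foundation_min)
  have "b0 \<in> elts (succ b')" using b0(1) B by blast
  then have ob0: "Ord b0" and subb: "elts b0 \<subseteq> elts (succ b')"
    using b'(1) Ord_in Ord_trans unfolding elts_succ by blast+
  have i0: "inc a0 b0" using b0 B by auto
  have "\<not> inc x b0" if "x \<in> elts a0" for x
    using a0(2)[OF that] A sub that ob0 by blast
  moreover have "\<not> inc a0 y" if "y \<in> elts b0" for y
    using b0(2)[OF that] B subb that by blast
  ultimately have "elts a0 = elts b0"
    using i0 oa0 ob0 unfolding inc_def by (blast dest: Ord_trans)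
  then show False using i0 unfolding inc_def by (auto dest: set_ext)
qed

lemma Ord_subset_iff: "Ord a \<Longrightarrow> Ord b \<Longrightarrow> elts a \<subseteq> elts b \<longleftrightarrow> a \<in> elts b \<or> a = b"
  using Ord_linear[of a b] Ord_trans[of b] in_irrefl by blast

lemma Ord_least:
  assumes "dfn (\<lambda>e. P (e 0))" "Ord b" "a \<in> elts b" "P a"
  obtains c where "c \<in> elts b" "P c" "\<And>z. z \<in> elts c \<Longrightarrow> \<not> P z" "\<And>z. z \<in> elts b \<Longrightarrow> P z \<Longrightarrow> elts c \<subseteq> elts z"
proof -
  have e: "elts (sep b P) = {x \<in> elts b. P x}" by (rule elts_sep) fact
  then have "a \<in> elts (sep b P)" using assms by simp
  then obtain c where c: "c \<in> elts (sep b P)" "\<And>z. z \<in> elts c \<Longrightarrow> z \<notin> elts (sep b P)"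
    by (erule foundation_min)
  show thesis
  proof (rule that[of c])
    show "c \<in> elts b" "P c" using c e by auto
    show "\<not> P z" if "z \<in> elts c" for z using c e that assms(2) Ord_trans by auto
    then show "elts c \<subseteq> elts z" if "z \<in> elts b" "P z" for z
      using that \<open>c \<in> elts b\<close> Ord_linear[of c z] Ord_in[OF assms(2)] Ord_trans[of z]
      by (metis order_refl subsetI)
  qed
qed

subsection \<open>Natural numbers\<close>

definition om :: 'v where "om = the_set Nat"

lemma elts_om [simp]: "elts om = Nat"
proof -
  have s: "z = succ y" if "elts z = insert y (elts y)" for y z using that by (simp add: set_eq_iff)
  obtain x where x: "empty \<in> elts x" "\<And>y. y \<in> elts x \<Longrightarrow> succ y \<in> elts x"
  proof -
    obtain x where "\<exists>z\<in>elts x. elts z = {}" "\<forall>y\<in>elts x. \<exists>z\<in>elts x. elts z = insert y (elts y)"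
      using ZF unfolding ZF_def infinity_def by blast
    then show thesis using that[of x] s eq_empty_iff by metis
  qed
  have "is_set Nat" unfolding Nat_def
    by (rule is_set_sub[of _ x], intro dfn_intros) (use x in auto)
  then show ?thesis unfolding om_def by (rule elts_the_set)
qed

lemma dfn_Nat [dfn_intros]: "dterm t \<Longrightarrow> dfn (\<lambda>e. t e \<in> Nat)"
  unfolding elts_om[symmetric] by (intro dfn_intros)

lemma dfn_ball_Nat [dfn_intros]: "dfn (\<lambda>e. P (\<lambda>n. e (Suc n)) (e 0)) \<Longrightarrow> dfn (\<lambda>e. \<forall>y\<in>Nat. P e y)"
  unfolding elts_om[symmetric] by (intro dfn_intros)

lemma dfn_bex_Nat [dfn_intros]: "dfn (\<lambda>e. P (\<lambda>n. e (Suc n)) (e 0)) \<Longrightarrow> dfn (\<lambda>e. \<exists>y\<in>Nat. P e y)"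
  unfolding elts_om[symmetric] by (intro dfn_intros)

lemma empty_Nat [simp]: "empty \<in> Nat" unfolding Nat_def by blast

lemma succ_Nat [simp]: "n \<in> Nat \<Longrightarrow> succ n \<in> Nat" unfolding Nat_def by blast

lemma nat_induct_dfn:
  assumes "n \<in> Nat" "dfn (\<lambda>e. P (e 0))" "P empty" "\<And>n. n \<in> Nat \<Longrightarrow> P n \<Longrightarrow> P (succ n)"
  shows "P n"
proof -
  have e: "elts (sep om P) = {x \<in> Nat. P x}" using elts_sep[OF assms(2)] by simp
  have "empty \<in> elts (sep om P) \<and> (\<forall>y\<in>elts (sep om P). succ y \<in> elts (sep om P))"
    using assms(3,4) by (simp add: e)
  then have "n \<in> elts (sep om P)" using assms(1) unfolding Nat_def by blast
  then show ?thesis using e by simp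
qed

lemma nat_cases:
  assumes "n \<in> Nat"
  obtains "n = empty" | m where "m \<in> Nat" "n = succ m"
proof -
  have "n = empty \<or> (\<exists>m\<in>Nat. n = succ m)"
    by (rule nat_induct_dfn[OF assms]) (intro dfn_intros, auto)
  then show thesis using that by blast
qed

lemma Ord_Nat: "n \<in> Nat \<Longrightarrow> Ord n"
  by (erule nat_induct_dfn[of n Ord]) (intro dfn_intros, auto simp: Ord_def transitive_def)

lemma Nat_trans: "n \<in> Nat \<Longrightarrow> m \<in> elts n \<Longrightarrow> m \<in> Nat"
proof -
  assume n: "n \<in> Nat" and m: "m \<in> elts n"
  have "elts n \<subseteq> elts om" by (rule nat_induct_dfn[OF n]) (intro dfn_intros, auto)
  then show ?thesis using m by auto
qed

lemma Ord_om: "Ord om"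
  unfolding Ord_def transitive_def elts_om using Nat_trans Ord_Nat unfolding Ord_def transitive_def by blast

lemma nat_linear: "m \<in> Nat \<Longrightarrow> n \<in> Nat \<Longrightarrow> m \<in> elts n \<or> m = n \<or> n \<in> elts m"
  by (simp add: Ord_linear Ord_Nat)

lemma nat_subset_linear: "m \<in> Nat \<Longrightarrow> n \<in> Nat \<Longrightarrow> elts m \<subseteq> elts n \<or> elts n \<subseteq> elts m"
  using nat_linear Ord_subset_iff Ord_Nat by blast

lemma nat_mem_trans: "n \<in> Nat \<Longrightarrow> m \<in> elts n \<Longrightarrow> k \<in> elts m \<Longrightarrow> k \<in> elts n"
  using Ord_trans Ord_Nat by blast

lemma nat_mem_subset: "n \<in> Nat \<Longrightarrow> m \<in> elts n \<Longrightarrow> elts m \<subseteq> elts n"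
  using nat_mem_trans by blast

lemma nat_subset_iff: "m \<in> Nat \<Longrightarrow> n \<in> Nat \<Longrightarrow> elts m \<subseteq> elts n \<longleftrightarrow> m \<in> elts n \<or> m = n"
  by (simp add: Ord_subset_iff Ord_Nat)

lemma succ_subset_iff: "m \<in> Nat \<Longrightarrow> n \<in> Nat \<Longrightarrow> elts (succ m) \<subseteq> elts n \<longleftrightarrow> m \<in> elts n"
  using nat_mem_trans by auto

lemma nat_max:
  assumes "m \<in> Nat" "n \<in> Nat"
  shows "union m n \<in> Nat"
proof -
  have "union m n = m \<or> union m n = n"
    using nat_subset_linear[OF assms] by (auto simp: set_eq_iff)
  then show ?thesis using assms by auto
qed

lemma nat_least:
  assumes "dfn (\<lambda>e. P (e 0))" "a \<in> Nat" "P a"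
  obtains c where "c \<in> Nat" "P c" "\<And>z. z \<in> Nat \<Longrightarrow> P z \<Longrightarrow> elts c \<subseteq> elts z"
proof -
  have "a \<in> elts om" using assms(2) by simp
  from assms(1) Ord_om this assms(3) show thesis
    by (rule Ord_least) (rule that, simp_all)
qed

subsection \<open>Recursion\<close>

text \<open>The intersection of all sets closed under the recursion clauses is the graph. This
  describes a recursive function by one first-order formula, without finite approximations.\<close>

definition recN :: "'v \<Rightarrow> ('v \<Rightarrow> 'v \<Rightarrow> 'v) \<Rightarrow> 'v \<Rightarrow> 'v" where
  "recN a G n = the1 (\<lambda>y. \<forall>Z. pair empty a \<in> elts Z \<and> (\<forall>m\<in>Nat. \<forall>u. pair m u \<in> elts Z \<longrightarrow> pair (succ m) (G m u) \<in> elts Z)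
     \<longrightarrow> pair n y \<in> elts Z)"

lemma dterm_recN [dfn_intros]:
  assumes "dterm a" "dterm (\<lambda>e. G (\<lambda>n. e (Suc (Suc n))) (e 1) (e 0))" "dterm n"
  shows "dterm (\<lambda>e. recN (a e) (G e) (n e))"
proof -
  have i: "inj (case_nat 0 (case_nat 1 (\<lambda>n. Suc (Suc (Suc (Suc n))))))"
    by (intro inj_case_nat) (auto simp: image_iff inj_def split: nat.splits)
  have G: "dterm (\<lambda>e. G (\<lambda>n. e (Suc (Suc (Suc (Suc n))))) (e (Suc 0)) (e 0))"
    using dterm_rename[OF i assms(2)] by simp
  show ?thesis unfolding recN_def
    by (intro dfn_intros G dterm_shift[OF dterm_shift[OF assms(1)]] dterm_shift[OF dterm_shift[OF assms(3)]])
qed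

text \<open>The bound Y provides one closed set, \<open>prod om Y\<close>, so the intersection F of
  the closed sets is a set. F is single-valued by minimality: a pair not demanded by the clauses
  could be deleted, and the rest would still be closed.\<close>

lemma recN_props:
  assumes G: "dterm (\<lambda>e. G (e 1) (e 0))" and a: "a \<in> elts Y"
    and GY: "\<And>m u. m \<in> Nat \<Longrightarrow> u \<in> elts Y \<Longrightarrow> G m u \<in> elts Y"
  shows "recN a G empty = a \<and> (\<forall>n\<in>Nat. recN a G n \<in> elts Y \<and> recN a G (succ n) = G n (recN a G n))"
proof -
  define cl where "cl Z \<longleftrightarrow> pair empty a \<in> elts Z \<and> (\<forall>m\<in>Nat. \<forall>u. pair m u \<in> elts Z \<longrightarrow> pair (succ m) (G m u) \<in> elts Z)" for Z
  have G': "dterm t \<Longrightarrow> dterm u \<Longrightarrow> dterm (\<lambda>e. G (t e) (u e))" for t u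
  proof (rule dterm_lift2[where f = G])
    have "inj (case_nat 1 (case_nat 0 (\<lambda>n. Suc (Suc n))))"
      by (intro inj_case_nat) (auto simp: image_iff inj_def split: nat.splits)
    from dterm_rename[OF this G] show "dterm (\<lambda>e. G (e 0) (e 1))" by simp
  qed
  have cld: "dterm t \<Longrightarrow> dfn (\<lambda>e. cl (t e))" for t
    by (rule dfn_lift1[where P = cl]) (unfold cl_def, intro dfn_intros G')
  define F where "F = sep (prod om Y) (\<lambda>p. \<forall>Z. cl Z \<longrightarrow> p \<in> elts Z)"
  have F: "elts F = {p \<in> elts (prod om Y). \<forall>Z. cl Z \<longrightarrow> p \<in> elts Z}"
    unfolding F_def by (rule elts_sep) (intro dfn_intros cld)
  have clp: "cl (prod om Y)" unfolding cl_def using a GY by auto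
  have clF: "cl F" unfolding cl_def F using a GY by (auto simp: cl_def)
  have Fmin: "elts F \<subseteq> elts Z" if "cl Z" for Z using that by (auto simp: F)
  have F0: "pair empty y \<in> elts F \<longleftrightarrow> y = a" for y
  proof
    assume y: "pair empty y \<in> elts F"
    show "y = a"
    proof (rule ccontr)
      assume "y \<noteq> a"
      then have "cl (diff F (upair (pair empty y) (pair empty y)))"
        using clF unfolding cl_def by auto
      from Fmin[OF this] y show False by auto
    qed
  qed (use clF in \<open>auto simp: cl_def\<close>)
  have FS: "(\<exists>u. pair n u \<in> elts F \<and> y = G n u)" if "pair (succ n) y \<in> elts F" "n \<in> Nat" for n y
  proof (rule ccontr)
    assume n: "\<not> ?thesis"
    then have "cl (diff F (upair (pair (succ n) y) (pair (succ n) y)))"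
      using clF unfolding cl_def by (auto dest: succ_inject)
    from Fmin[OF this] that show False by auto
  qed
  have ex: "\<exists>!y. pair n y \<in> elts F" if "n \<in> Nat" for n
  proof (rule nat_induct_dfn[OF that])
    show "dfn (\<lambda>e. \<exists>!y. pair (e 0) y \<in> elts F)" by (intro dfn_intros)
    show "\<exists>!y. pair empty y \<in> elts F" by (simp add: F0)
    fix n assume n: "n \<in> Nat" "\<exists>!y. pair n y \<in> elts F"
    then obtain y where y: "pair n y \<in> elts F" "\<And>z. pair n z \<in> elts F \<Longrightarrow> z = y" by blast
    show "\<exists>!y. pair (succ n) y \<in> elts F"
    proof (rule ex1I[of _ "G n y"])
      show "pair (succ n) (G n y) \<in> elts F" using clF n y unfolding cl_def by blast
      show "z = G n y" if "pair (succ n) z \<in> elts F" for z using FS[OF that n(1)] y by blast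
    qed
  qed
  have rec: "recN a G n = ap F n" if n: "n \<in> Nat" for n
  proof -
    have eq: "(\<forall>Z. cl Z \<longrightarrow> pair n y \<in> elts Z) \<longleftrightarrow> pair n y \<in> elts F" for y using clF Fmin by blast
    show ?thesis unfolding recN_def ap_def cl_def[symmetric] eq ..
  qed
  have apF: "pair n (ap F n) \<in> elts F" if "n \<in> Nat" for n
    using the1_prop[OF ex[OF that]] unfolding ap_def .
  have "ap F empty = a" using apF[of empty] F0 by simp
  moreover have "ap F n \<in> elts Y" if "n \<in> Nat" for n using apF[OF that] by (auto simp: F)
  moreover have "ap F (succ n) = G n (ap F n)" if "n \<in> Nat" for n
    using FS[OF apF[of "succ n"]] ex[OF that] apF[OF that] that by auto
  ultimately show ?thesis by (simp add: rec)
qed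

lemma
  assumes "dterm (\<lambda>e. G (e 1) (e 0))" "a \<in> elts Y" "\<And>m u. m \<in> Nat \<Longrightarrow> u \<in> elts Y \<Longrightarrow> G m u \<in> elts Y"
  shows recN_empty: "recN a G empty = a"
    and recN_succ: "n \<in> Nat \<Longrightarrow> recN a G (succ n) = G n (recN a G n)"
    and recN_in: "n \<in> Nat \<Longrightarrow> recN a G n \<in> elts Y"
  using recN_props[OF assms] by auto

subsection \<open>Coding\<close>

definition dbl :: "'v \<Rightarrow> 'v" where "dbl n = recN empty (\<lambda>m u. succ (succ u)) n"

lemma dterm_dbl [dfn_intros]: "dterm t \<Longrightarrow> dterm (\<lambda>e. dbl (t e))"
  unfolding dbl_def by (intro dfn_intros)

lemma dbl_rec: "dbl empty = empty" "n \<in> Nat \<Longrightarrow> dbl (succ n) = succ (succ (dbl n))" "n \<in> Nat \<Longrightarrow> dbl n \<in> Nat"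
proof -
  have d: "dterm (\<lambda>e. succ (succ (e 0)))" by (intro dfn_intros)
  note * = recN_empty[of "\<lambda>m u. succ (succ u)" empty om] recN_succ[of "\<lambda>m u. succ (succ u)" empty om]
    recN_in[of "\<lambda>m u. succ (succ u)" empty om]
  show "dbl empty = empty" "n \<in> Nat \<Longrightarrow> dbl (succ n) = succ (succ (dbl n))" "n \<in> Nat \<Longrightarrow> dbl n \<in> Nat"
    unfolding dbl_def using * d by simp_all
qed

lemma dbl_inj: "n \<in> Nat \<Longrightarrow> m \<in> Nat \<Longrightarrow> dbl n = dbl m \<Longrightarrow> n = m"
proof -
  assume n: "n \<in> Nat"
  have "\<forall>m\<in>Nat. dbl n = dbl m \<longrightarrow> n = m"
  proof (rule nat_induct_dfn[OF n])
    show "dfn (\<lambda>e. \<forall>m\<in>Nat. dbl (e 0) = dbl m \<longrightarrow> e 0 = m)" by (intro dfn_intros)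
    show "\<forall>m\<in>Nat. dbl empty = dbl m \<longrightarrow> empty = m"
      by (metis dbl_rec(1,2) nat_cases succ_neq_empty(2))
    fix k assume k: "k \<in> Nat" "\<forall>m\<in>Nat. dbl k = dbl m \<longrightarrow> k = m"
    show "\<forall>m\<in>Nat. dbl (succ k) = dbl m \<longrightarrow> succ k = m"
      by (metis dbl_rec(1,2) k nat_cases succ_inject succ_neq_empty(2))
  qed
  then show "m \<in> Nat \<Longrightarrow> dbl n = dbl m \<Longrightarrow> n = m" by blast
qed

lemma succ_dbl_neq_dbl: "n \<in> Nat \<Longrightarrow> m \<in> Nat \<Longrightarrow> succ (dbl n) \<noteq> dbl m"
proof -
  assume n: "n \<in> Nat"
  have "\<forall>m\<in>Nat. succ (dbl n) \<noteq> dbl m"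
  proof (rule nat_induct_dfn[OF n])
    show "dfn (\<lambda>e. \<forall>m\<in>Nat. succ (dbl (e 0)) \<noteq> dbl m)" by (intro dfn_intros)
    show "\<forall>m\<in>Nat. succ (dbl empty) \<noteq> dbl m"
      by (metis dbl_rec(1,2) nat_cases succ_inject succ_neq_empty(2))
    fix k assume k: "k \<in> Nat" "\<forall>m\<in>Nat. succ (dbl k) \<noteq> dbl m"
    show "\<forall>m\<in>Nat. succ (dbl (succ k)) \<noteq> dbl m"
      by (metis dbl_rec(1,2) k nat_cases succ_inject succ_neq_empty(2))
  qed
  then show "m \<in> Nat \<Longrightarrow> succ (dbl n) \<noteq> dbl m" by blast
qed

text \<open>The number 2^m (2n + 1), obtained by doubling an odd number m times.\<close>

definition npair :: "'v \<Rightarrow> 'v \<Rightarrow> 'v" where "npair m n = recN (succ (dbl n)) (\<lambda>k u. dbl u) m"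

lemma dterm_npair [dfn_intros]: "dterm t \<Longrightarrow> dterm u \<Longrightarrow> dterm (\<lambda>e. npair (t e) (u e))"
  unfolding npair_def by (intro dfn_intros)

lemma npair_rec:
  assumes "n \<in> Nat"
  shows "npair empty n = succ (dbl n)" "m \<in> Nat \<Longrightarrow> npair (succ m) n = dbl (npair m n)"
    "m \<in> Nat \<Longrightarrow> npair m n \<in> Nat"
proof -
  have d: "dterm (\<lambda>e. dbl (e 0))" by (intro dfn_intros)
  note * = recN_empty[of "\<lambda>m u. dbl u" "succ (dbl n)" om] recN_succ[of "\<lambda>m u. dbl u" "succ (dbl n)" om]
    recN_in[of "\<lambda>m u. dbl u" "succ (dbl n)" om]
  show "npair empty n = succ (dbl n)" "m \<in> Nat \<Longrightarrow> npair (succ m) n = dbl (npair m n)"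
    "m \<in> Nat \<Longrightarrow> npair m n \<in> Nat"
    unfolding npair_def using * d dbl_rec assms by simp_all
qed

lemma npair_inj:
  assumes "m \<in> Nat" "n \<in> Nat" "m' \<in> Nat" "n' \<in> Nat" "npair m n = npair m' n'"
  shows "m = m' \<and> n = n'"
proof -
  have "\<forall>n\<in>Nat. \<forall>m'\<in>Nat. \<forall>n'\<in>Nat. npair m n = npair m' n' \<longrightarrow> m = m' \<and> n = n'"
  proof (rule nat_induct_dfn[OF assms(1)])
    show "dfn (\<lambda>e. \<forall>n\<in>Nat. \<forall>m'\<in>Nat. \<forall>n'\<in>Nat. npair (e 0) n = npair m' n' \<longrightarrow> e 0 = m' \<and> n = n')"
      by (intro dfn_intros)
    show "\<forall>n\<in>Nat. \<forall>m'\<in>Nat. \<forall>n'\<in>Nat. npair empty n = npair m' n' \<longrightarrow> empty = m' \<and> n = n'"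
    proof (intro ballI impI)
      fix n m' n' assume *: "n \<in> Nat" "m' \<in> Nat" "n' \<in> Nat" "npair empty n = npair m' n'"
      show "empty = m' \<and> n = n'"
        using *(2)
      proof (cases rule: nat_cases)
        case 1
        then show ?thesis using * dbl_inj by (auto simp: npair_rec dest: succ_inject)
      next
        case (2 k)
        then show ?thesis using * succ_dbl_neq_dbl by (auto simp: npair_rec)
      qed
    qed
    fix k assume k: "k \<in> Nat" and IH: "\<forall>n\<in>Nat. \<forall>m'\<in>Nat. \<forall>n'\<in>Nat. npair k n = npair m' n' \<longrightarrow> k = m' \<and> n = n'"
    show "\<forall>n\<in>Nat. \<forall>m'\<in>Nat. \<forall>n'\<in>Nat. npair (succ k) n = npair m' n' \<longrightarrow> succ k = m' \<and> n = n'"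
    proof (intro ballI impI)
      fix n m' n' assume *: "n \<in> Nat" "m' \<in> Nat" "n' \<in> Nat" "npair (succ k) n = npair m' n'"
      show "succ k = m' \<and> n = n'"
        using *(2)
      proof (cases rule: nat_cases)
        case 1
        then have "dbl (npair k n) = succ (dbl n')" using * k by (simp add: npair_rec)
        then show ?thesis using succ_dbl_neq_dbl[of n' "npair k n"] * k by (simp add: npair_rec)
      next
        case (2 l)
        then have "dbl (npair k n) = dbl (npair l n')" using * k by (simp add: npair_rec)
        then have "npair k n = npair l n'" using dbl_inj * k 2 by (simp add: npair_rec)
        then show ?thesis using IH * 2 by blast
      qed
    qed
  qed
  then show ?thesis using assms by blast
qed

text \<open>Left-nested pairs. Decoding is established for a known length, hence
  \<open>ccode\<close> and \<open>scode\<close> store the length in an outer pair.\<close>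

definition seqcode :: "('v \<Rightarrow> 'v) \<Rightarrow> 'v \<Rightarrow> 'v" where
  "seqcode F n = recN empty (\<lambda>m u. npair u (F m)) n"

lemma dterm_seqcode [dfn_intros]:
  assumes "dterm (\<lambda>e. F (\<lambda>n. e (Suc n)) (e 0))" "dterm t"
  shows "dterm (\<lambda>e. seqcode (F e) (t e))"
proof -
  have F: "dterm (\<lambda>e. F (\<lambda>n. e (Suc (Suc n))) (e 1))" using dterm_shift[OF assms(1)] by simp
  show ?thesis unfolding seqcode_def by (intro dfn_intros assms(2) F)
qed

lemma seqcode_rec:
  assumes "dterm (\<lambda>e. F (e 0))" "\<And>n. n \<in> Nat \<Longrightarrow> F n \<in> Nat"
  shows "seqcode F empty = empty" "n \<in> Nat \<Longrightarrow> seqcode F (succ n) = npair (seqcode F n) (F n)"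
    "n \<in> Nat \<Longrightarrow> seqcode F n \<in> Nat"
proof -
  have F: "dterm (\<lambda>e. F (e 1))" using dterm_shift[OF assms(1)] by simp
  have d: "dterm (\<lambda>e. npair (e 0) (F (e 1)))" by (intro dfn_intros F)
  note * = recN_empty[of "\<lambda>m u. npair u (F m)" empty om] recN_succ[of "\<lambda>m u. npair u (F m)" empty om]
    recN_in[of "\<lambda>m u. npair u (F m)" empty om]
  show "seqcode F empty = empty" "n \<in> Nat \<Longrightarrow> seqcode F (succ n) = npair (seqcode F n) (F n)"
    "n \<in> Nat \<Longrightarrow> seqcode F n \<in> Nat"
    unfolding seqcode_def using * d npair_rec(3) assms(2) by simp_all
qed

lemma seqcode_inj:
  assumes F: "dterm (\<lambda>e. F (e 0))" "\<And>n. n \<in> Nat \<Longrightarrow> F n \<in> Nat"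
    and G: "dterm (\<lambda>e. G (e 0))" "\<And>n. n \<in> Nat \<Longrightarrow> G n \<in> Nat"
    and n: "n \<in> Nat" and eq: "seqcode F n = seqcode G n" and m: "m \<in> elts n"
  shows "F m = G m"
proof -
  have F': "dterm t \<Longrightarrow> dterm (\<lambda>e. F (t e))" and G': "dterm t \<Longrightarrow> dterm (\<lambda>e. G (t e))" for t
    using dterm_lift1[of F] dterm_lift1[of G] F(1) G(1) by blast+
  have "seqcode F n = seqcode G n \<longrightarrow> (\<forall>m\<in>elts n. F m = G m)"
  proof (rule nat_induct_dfn[OF n])
    show "dfn (\<lambda>e. seqcode F (e 0) = seqcode G (e 0) \<longrightarrow> (\<forall>m\<in>elts (e 0). F m = G m))"
      by (intro dfn_intros F' G')
  next
    fix n assume *: "n \<in> Nat" "seqcode F n = seqcode G n \<longrightarrow> (\<forall>m\<in>elts n. F m = G m)"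
    show "seqcode F (succ n) = seqcode G (succ n) \<longrightarrow> (\<forall>m\<in>elts (succ n). F m = G m)"
    proof
      assume "seqcode F (succ n) = seqcode G (succ n)"
      then have "npair (seqcode F n) (F n) = npair (seqcode G n) (G n)"
        using seqcode_rec(2)[OF F] seqcode_rec(2)[OF G] *(1) by simp
      then have "seqcode F n = seqcode G n \<and> F n = G n"
        by (rule npair_inj[OF seqcode_rec(3)[OF F(1)] F(2)[OF *(1)] seqcode_rec(3)[OF G(1)] G(2)[OF *(1)], rotated -1])
          (use F(2) G(2) *(1) in blast)+
      then show "\<forall>m\<in>elts (succ n). F m = G m" using *(2) by simp
    qed
  qed simp
  then show ?thesis using eq m by blast
qed

text \<open>The elements of C carry natural-number codes, so among the admissible successors the one
  of least code is definable, and the sequence becomes an ordinary recursion.\<close>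

lemma dependent_choice:
  assumes code: "dterm (\<lambda>e. code (e 0))" "\<And>c. c \<in> elts C \<Longrightarrow> code c \<in> Nat" "inj_on code (elts C)"
    and R: "dfn (\<lambda>e. R (e 0) (e 1) (e 2))"
    and c0: "c0 \<in> elts C"
    and tot: "\<And>n c. n \<in> Nat \<Longrightarrow> c \<in> elts C \<Longrightarrow> \<exists>c'\<in>elts C. R n c c'"
  obtains f where "func f Nat (elts C)" "ap f empty = c0" "\<And>n. n \<in> Nat \<Longrightarrow> R n (ap f n) (ap f (succ n))"
proof -
  have code': "dterm t \<Longrightarrow> dterm (\<lambda>e. code (t e))" for t using dterm_lift1[of code] code(1) by blast
  have R': "dterm t \<Longrightarrow> dterm u \<Longrightarrow> dterm v \<Longrightarrow> dfn (\<lambda>e. R (t e) (u e) (v e))" for t u v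
    using dfn_lift3[of R] R by blast
  define G where "G n c = the1 (\<lambda>c'. c' \<in> elts C \<and> R n c c' \<and> (\<forall>c''\<in>elts C. R n c c'' \<longrightarrow> elts (code c') \<subseteq> elts (code c'')))" for n c
  have Gd: "dterm (\<lambda>e. G (e 1) (e 0))" unfolding G_def by (intro dfn_intros R' code')
  have G: "G n c \<in> elts C \<and> R n c (G n c)" if n: "n \<in> Nat" "c \<in> elts C" for n c
  proof -
    have d: "dfn (\<lambda>e. \<exists>c'\<in>elts C. R n c c' \<and> code c' = e 0)" by (intro dfn_intros R' code')
    obtain c1 where c1: "c1 \<in> elts C" "R n c c1" using tot[OF n] by blast
    obtain k where k: "k \<in> Nat" "\<exists>c'\<in>elts C. R n c c' \<and> code c' = k"
      "\<And>z. z \<in> Nat \<Longrightarrow> \<exists>c'\<in>elts C. R n c c' \<and> code c' = z \<Longrightarrow> elts k \<subseteq> elts z"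
      by (rule nat_least[OF d, of "code c1"]) (use c1 code(2) in auto)
    then obtain c2 where c2: "c2 \<in> elts C" "R n c c2" "code c2 = k" by blast
    have "G n c = c2" unfolding G_def
    proof (rule the1_eqI)
      show "c2 \<in> elts C \<and> R n c c2 \<and> (\<forall>c''\<in>elts C. R n c c'' \<longrightarrow> elts (code c2) \<subseteq> elts (code c''))"
        using c2 k(3) code(2) by blast
      fix z assume z: "z \<in> elts C \<and> R n c z \<and> (\<forall>c''\<in>elts C. R n c c'' \<longrightarrow> elts (code z) \<subseteq> elts (code c''))"
      then have "elts (code z) \<subseteq> elts k" "elts k \<subseteq> elts (code z)" using c2 k(3) code(2) by blast+
      then have "code z = code c2" using c2(3) set_ext by blast
      then show "z = c2" using code(3) z c2(1) by (meson inj_onD)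
    qed
    then show ?thesis using c2 by blast
  qed
  have r: "recN c0 G empty = c0" "\<And>n. n \<in> Nat \<Longrightarrow> recN c0 G (succ n) = G n (recN c0 G n)"
    "\<And>n. n \<in> Nat \<Longrightarrow> recN c0 G n \<in> elts C"
    using recN_empty[OF Gd c0] recN_succ[OF Gd c0] recN_in[OF Gd c0] G by blast+
  have rd: "dterm (\<lambda>e. recN c0 G (e 0))" by (intro dfn_intros) (use Gd in simp)
  show thesis
  proof (rule that[of "lam om (recN c0 G)"])
    show "func (lam om (recN c0 G)) Nat (elts C)" using func_lam[OF rd, of om] r(3) by simp
    show "ap (lam om (recN c0 G)) empty = c0" using ap_lam[OF rd, of empty om] r(1) by simp
    show "R n (ap (lam om (recN c0 G)) n) (ap (lam om (recN c0 G)) (succ n))" if n: "n \<in> Nat" for n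
      using ap_lam[OF rd, of _ om] n r G by simp
  qed
qed

subsection \<open>The reals and restrictions\<close>

lemma dfn_func_elts [dfn_intros]:
  "dterm t \<Longrightarrow> dterm u \<Longrightarrow> dterm v \<Longrightarrow> dfn (\<lambda>e. func (t e) (elts (u e)) (elts (v e)))"
  by (rule dfn_lift3[where P = "\<lambda>x y z. func x (elts y) (elts z)"]) (unfold func_def, intro dfn_intros)

definition Re :: 'v where "Re = the_set Reals"

lemma Reals_iff: "f \<in> Reals \<longleftrightarrow> func f (elts om) (elts om)"
  unfolding Reals_def Fun_def by simp

lemma elts_Re [simp]: "elts Re = Reals"
proof -
  have "is_set {f. func f (elts om) (elts om)}"
  proof (rule is_set_sub[of _ "Pw (prod om om)"])
    show "dfn (\<lambda>e. func (e 0) (elts om) (elts om))" by (intro dfn_intros)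
    show "f \<in> elts (Pw (prod om om))" if "func f (elts om) (elts om)" for f
      using that unfolding func_def by (auto simp: elts_prod)
  qed
  moreover have "Reals = {f. func f (elts om) (elts om)}" using Reals_iff by auto
  ultimately show ?thesis unfolding Re_def by (simp add: elts_the_set)
qed

lemma restrict_eq_sep: "restrict f a = sep f (\<lambda>p. \<exists>x\<in>elts a. \<exists>y. p = pair x y)"
proof -
  have "elts (sep f (\<lambda>p. \<exists>x\<in>elts a. \<exists>y. p = pair x y)) = {p \<in> elts f. \<exists>x\<in>elts a. \<exists>y. p = pair x y}"
    by (rule elts_sep) (intro dfn_intros)
  then show ?thesis unfolding restrict_def by (metis the_set_elts)
qed

lemma elts_restrict: "elts (restrict f a) = {p \<in> elts f. \<exists>x\<in>elts a. \<exists>y. p = pair x y}"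
  unfolding restrict_eq_sep by (rule elts_sep) (intro dfn_intros)

lemma dterm_restrict [dfn_intros]: "dterm t \<Longrightarrow> dterm u \<Longrightarrow> dterm (\<lambda>e. restrict (t e) (u e))"
  by (rule dterm_lift2[where f = restrict]) (unfold restrict_eq_sep, intro dfn_intros)

lemma ap_restrict: "x \<in> elts a \<Longrightarrow> ap (restrict f a) x = ap f x"
  unfolding ap_def elts_restrict by simp

lemma func_restrict:
  assumes "func f X Y" "elts a \<subseteq> X"
  shows "func (restrict f a) (elts a) Y"
  unfolding func_def
proof (intro conjI ballI)
  fix p assume "p \<in> elts (restrict f a)"
  then show "\<exists>x\<in>elts a. \<exists>y\<in>Y. p = pair x y"
    using assms(1) unfolding elts_restrict func_def by fastforce
next
  fix x assume x: "x \<in> elts a"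
  then have "\<exists>!y. pair x y \<in> elts f" using assms unfolding func_def by blast
  then show "\<exists>!y. pair x y \<in> elts (restrict f a)" using x by (simp add: elts_restrict)
qed

subsection \<open>Determinacy of games on the natural numbers\<close>

text \<open>The right-hand side is in the form that the definability rules handle.\<close>

lemma surjects_iff: "surjects Reals (elts b) \<longleftrightarrow> (\<exists>f. func f (elts Re) (elts b) \<and> (\<forall>y\<in>elts b. \<exists>x\<in>elts Re. y = ap f x))"
proof -
  have "app f ` Reals = elts b \<longleftrightarrow> (\<forall>y\<in>elts b. \<exists>x\<in>elts Re. y = ap f x)" if f: "func f Reals (elts b)" for f
  proof -
    have "app f ` Reals = ap f ` Reals" using func_app[OF f] by (rule image_cong[OF refl])
    then show ?thesis using func_ap_in[OF f] by auto
  qed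
  then show ?thesis unfolding surjects_def surj_fun_def by auto
qed

lemma Ord_empty_in: "Ord a \<Longrightarrow> a \<noteq> empty \<Longrightarrow> empty \<in> elts a"
  using Ord_linear[of empty a] Ord_Nat[of empty] by auto

text \<open>A Hartogs argument for surjections: a map f from the reals onto a pulls membership on a
  back to a relation r on the reals, and r determines a. If every nonzero ordinal were an image,
  Replacement on the set of these relations would collect all ordinals into a set, which would then
  be an ordinal and an element of itself.\<close>

lemma exists_not_surjects: "\<exists>b. Ord b \<and> b \<noteq> empty \<and> \<not> surjects Reals (elts b)"
proof (rule ccontr)
  assume no: "\<not> ?thesis"
  define W where "W f r a \<longleftrightarrow> func f (elts Re) (elts a) \<and> (\<forall>y\<in>elts a. \<exists>x\<in>elts Re. y = ap f x) \<and>
     (\<forall>x\<in>elts Re. \<forall>y\<in>elts Re. pair x y \<in> elts r \<longleftrightarrow> ap f x \<in> elts (ap f y))" for f r a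
  define P where "P r a \<longleftrightarrow> Ord a \<and> (\<exists>f. W f r a)" for r a
  have Wran: "elts a = ap f ` elts Re" if "W f r a" for f r a
    using that func_ap_in unfolding W_def by (auto simp: image_iff)
  have uniq: "a = b" if ab: "P r a" "P r b" for r a b
  proof -
    obtain f g where f: "W f r a" and g: "W g r b" using ab unfolding P_def by blast
    have oa: "Ord a" and ob: "Ord b" using ab unfolding P_def by blast+
    have rf: "pair x y \<in> elts r \<longleftrightarrow> ap f x \<in> elts (ap f y)" if "x \<in> elts Re" "y \<in> elts Re" for x y
      using f that unfolding W_def by blast
    have rg: "pair x y \<in> elts r \<longleftrightarrow> ap g x \<in> elts (ap g y)" if "x \<in> elts Re" "y \<in> elts Re" for x y
      using g that unfolding W_def by blast
    \<comment> \<open>Two maps that induce the same r agree: take a point of disagreement with least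
      value of f. Below that value the maps agree, and r carries the elements of one value to those
      of the other.\<close>
    have eq: "ap f x = ap g x" if x: "x \<in> elts Re" for x
    proof (rule ccontr)
      assume ne: "ap f x \<noteq> ap g x"
      have d: "dfn (\<lambda>e. \<exists>x\<in>elts Re. ap f x = e 0 \<and> ap f x \<noteq> ap g x)" by (intro dfn_intros)
      have "ap f x \<in> elts a" using Wran[OF f] x by blast
      moreover have "\<exists>y\<in>elts Re. ap f y = ap f x \<and> ap f y \<noteq> ap g y" using x ne by blast
      ultimately obtain c where c: "\<exists>x\<in>elts Re. ap f x = c \<and> ap f x \<noteq> ap g x"
        "\<And>z. z \<in> elts c \<Longrightarrow> \<not> (\<exists>x\<in>elts Re. ap f x = z \<and> ap f x \<noteq> ap g x)"
        by (rule Ord_least[OF d oa]) blast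
      then obtain x0 where x0: "x0 \<in> elts Re" "ap f x0 = c" "ap f x0 \<noteq> ap g x0" by blast
      have min: "ap f y = ap g y" if "y \<in> elts Re" "ap f y \<in> elts (ap f x0)" for y
        using c(2) that x0(2) by blast
      have "z \<in> elts (ap g x0)" if z: "z \<in> elts (ap f x0)" for z
      proof -
        have "z \<in> elts a" using Ord_trans[OF oa _ z] Wran[OF f] x0(1) by blast
        then obtain y where y: "y \<in> elts Re" "z = ap f y" using Wran[OF f] by blast
        then show ?thesis using z min[of y] rf[of y x0] rg[of y x0] x0(1) by simp
      qed
      moreover have "z \<in> elts (ap f x0)" if z: "z \<in> elts (ap g x0)" for z
      proof -
        have "z \<in> elts b" using Ord_trans[OF ob _ z] Wran[OF g] x0(1) by blast
        then obtain y where y: "y \<in> elts Re" "z = ap g y" using Wran[OF g] by blast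
        then have "ap f y \<in> elts (ap f x0)" using z rf[of y x0] rg[of y x0] x0(1) by simp
        then show ?thesis using min[OF y(1)] y(2) by simp
      qed
      ultimately have "ap f x0 = ap g x0" by (intro set_ext) blast
      then show False using x0(3) by blast
    qed
    then have "ap f ` elts Re = ap g ` elts Re" by (rule image_cong[OF refl])
    then show "a = b" using Wran[OF f] Wran[OF g] set_ext by simp
  qed
  have Pd: "dfn (\<lambda>e. P (e 0) (e 1))" unfolding P_def W_def by (intro dfn_intros)
  have "is_set {a. \<exists>r\<in>elts (Pw (prod Re Re)). P r a}"
    by (rule is_set_replacement[OF Pd]) (rule uniq)
  then obtain Z where Z: "elts Z = {a. \<exists>r\<in>elts (Pw (prod Re Re)). P r a}" unfolding is_set_def by blast
  have inZ: "a \<in> elts Z" if a: "Ord a" "a \<noteq> empty" for a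
  proof -
    obtain f where f: "func f (elts Re) (elts a)" "\<forall>y\<in>elts a. \<exists>x\<in>elts Re. y = ap f x"
      using no a surjects_iff by blast
    define r where "r = sep (prod Re Re) (\<lambda>p. \<exists>x y. p = pair x y \<and> ap f x \<in> elts (ap f y))"
    have r: "elts r = {p \<in> elts (prod Re Re). \<exists>x y. p = pair x y \<and> ap f x \<in> elts (ap f y)}"
      unfolding r_def by (rule elts_sep) (intro dfn_intros)
    have "W f r a" unfolding W_def r using f by auto
    moreover have "r \<in> elts (Pw (prod Re Re))" using r by auto
    ultimately show ?thesis unfolding Z P_def using a by blast
  qed
  \<comment> \<open>Z is known to contain the nonzero ordinals, so 0 is put in by hand.\<close>
  define Q where "Q = sep (union Z (upair empty empty)) Ord"
  have Q: "elts Q = {a. Ord a}"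
  proof -
    have "elts Q = {a \<in> elts (union Z (upair empty empty)). Ord a}"
      unfolding Q_def by (rule elts_sep) (intro dfn_intros)
    then show ?thesis using inZ by auto
  qed
  then have "Ord Q" unfolding Ord_def[of Q] transitive_def[of Q] using Ord_in Ord_def by blast
  then have "Q \<in> elts Q" using Q by blast
  then show False using in_irrefl by blast
qed

lemma ex_Theta: "\<exists>\<theta>. is_Theta \<theta> \<and> om \<in> elts \<theta>"
proof -
  define P where "P b \<longleftrightarrow> b \<noteq> empty \<and> \<not> surjects Reals (elts b)" for b
  have d: "dfn (\<lambda>e. P (e 0))" unfolding P_def surjects_iff by (intro dfn_intros)
  obtain b where b: "Ord b" "P b" using exists_not_surjects unfolding P_def by blast
  have "Ord (succ b)" using b(1) unfolding Ord_def transitive_def by auto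
  from d this _ b(2) obtain \<theta> where \<theta>: "\<theta> \<in> elts (succ b)" "P \<theta>" "\<And>z. z \<in> elts \<theta> \<Longrightarrow> \<not> P z"
    by (rule Ord_least) auto
  have o: "Ord \<theta>" using Ord_in[OF \<open>Ord (succ b)\<close> \<theta>(1)] .
  have "is_Theta \<theta>" unfolding is_Theta_def using o \<theta>(2,3) unfolding P_def by blast
  moreover have "om \<in> elts \<theta>"
  proof (rule ccontr)
    assume "om \<notin> elts \<theta>"
    then have "elts \<theta> \<subseteq> elts om" using Ord_linear[OF o Ord_om] Ord_subset_iff[OF o Ord_om] by blast
    then have sub: "\<And>y. y \<in> elts \<theta> \<Longrightarrow> y \<in> Nat" by auto
    have e: "empty \<in> elts \<theta>" using Ord_empty_in o \<theta>(2) unfolding P_def by blast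
    \<comment> \<open>If \<theta> were at most \<omega>, evaluation of a real at 0, with default 0
      for values outside \<theta>, would map the reals onto \<theta>; constant functions serve as
      preimages.\<close>
    define F where "F x = (if ap x empty \<in> elts \<theta> then ap x empty else empty)" for x
    have Fd: "dterm (\<lambda>e. F (e 0))" unfolding F_def by (intro dfn_intros)
    have f: "func (lam Re F) (elts Re) (elts \<theta>)" by (rule func_lam[OF Fd]) (use e in \<open>simp add: F_def\<close>)
    moreover have "\<exists>x\<in>elts Re. y = ap (lam Re F) x" if y: "y \<in> elts \<theta>" for y
    proof (rule bexI)
      have d: "dterm (\<lambda>e. y)" by (intro dfn_intros)
      have "func (lam om (\<lambda>_. y)) (elts om) (elts om)" using func_lam[OF d, of om "elts om"] sub[OF y] by simp
      then show *: "lam om (\<lambda>_. y) \<in> elts Re" using Reals_iff by simp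
      have "ap (lam om (\<lambda>_. y)) empty = y" using ap_lam[OF d, of empty om] by simp
      then show "y = ap (lam Re F) (lam om (\<lambda>_. y))" using ap_lam[OF Fd *] y F_def[of "lam om (\<lambda>_. y)"] by simp
    qed
    ultimately have "surjects Reals (elts \<theta>)" unfolding surjects_iff by blast
    then show False using \<theta>(2) unfolding P_def by blast
  qed
  ultimately show ?thesis by blast
qed

text \<open>Integer games are the case \<mu> = \<omega> with the identity as continuous map, which
  is legitimate because \<omega> lies below \<Theta>.\<close>

lemma game_determined:
  assumes AD: ordinal_determinacy and B: "elts B \<subseteq> Reals"
  shows "determined om (elts B)"
proof -
  obtain \<theta> where \<theta>: "is_Theta \<theta>" "om \<in> elts \<theta>" using ex_Theta by blast
  define \<pi> where "\<pi> = lam Re (\<lambda>x. x)"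
  have d: "dterm (\<lambda>e. e 0)" by (intro dfn_intros)
  have R: "Fun Nat (elts om) = Reals" unfolding Reals_def by simp
  have f: "func \<pi> Reals Reals" using func_lam[OF d, of Re Reals] unfolding \<pi>_def by simp
  have a: "app \<pi> x = x" if "x \<in> Reals" for x
    using func_app[OF f that] ap_lam[OF d, of x Re] that unfolding \<pi>_def by simp
  have "continuous om \<pi>" unfolding continuous_def R using f a by auto
  moreover have "om \<noteq> empty" using elts_om empty_Nat elts_empty by (metis emptyE)
  ultimately have "determined om {f \<in> Fun Nat (elts om). app \<pi> f \<in> elts B}"
    using AD \<theta> B unfolding ordinal_determinacy_def by blast
  moreover have "{f \<in> Fun Nat (elts om). app \<pi> f \<in> elts B} = elts B" unfolding R using a B by auto
  ultimately show ?thesis by simp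
qed

lemma dfn_Even [dfn_intros]: "dterm t \<Longrightarrow> dfn (\<lambda>e. t e \<in> Even)"
  by (rule dfn_lift1[where P = "\<lambda>x. x \<in> Even"]) (unfold Even_def mem_Collect_eq, intro dfn_intros)

lemma empty_Even: "empty \<in> Even" unfolding Even_def by blast

lemma Even_SS: "n \<in> Even \<Longrightarrow> succ (succ n) \<in> Even" unfolding Even_def by blast

lemma Even_induct:
  assumes "n \<in> Even" "dfn (\<lambda>e. P (e 0))" "P empty" "\<And>n. n \<in> Nat \<Longrightarrow> P n \<Longrightarrow> P (succ (succ n))"
  shows "P n"
proof -
  have e: "elts (sep om P) = {x \<in> Nat. P x}" using elts_sep[OF assms(2)] by simp
  have "empty \<in> elts (sep om P) \<and> (\<forall>y\<in>elts (sep om P). succ (succ y) \<in> elts (sep om P))"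
    using assms(3,4) by (simp add: e)
  then have "n \<in> elts (sep om P)" using assms(1) unfolding Even_def by blast
  then show ?thesis using e by simp
qed

lemma succ_Even_iff:
  assumes "n \<in> Nat"
  shows "succ n \<in> Even \<longleftrightarrow> n \<notin> Even"
proof -
  \<comment> \<open>Inversion for \<open>Even\<close>; membership is added to the induction
    predicate because the claim about the predecessor asserts it.\<close>
  have inv: "x = empty \<or> (\<exists>y\<in>Nat. y \<in> Even \<and> x = succ (succ y))" if "x \<in> Even" for x
  proof -
    have "x \<in> Even \<and> (x = empty \<or> (\<exists>y\<in>Nat. y \<in> Even \<and> x = succ (succ y)))"
    proof (rule Even_induct[OF that])
      show "dfn (\<lambda>e. e 0 \<in> Even \<and> (e 0 = empty \<or> (\<exists>y\<in>Nat. y \<in> Even \<and> e 0 = succ (succ y))))"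
        by (intro dfn_intros)
    qed (use Even_SS empty_Even in blast)+
    then show ?thesis by blast
  qed
  have "succ n \<in> Even \<longleftrightarrow> n \<notin> Even"
  proof (rule nat_induct_dfn[OF assms])
    show "dfn (\<lambda>e. succ (e 0) \<in> Even \<longleftrightarrow> e 0 \<notin> Even)" by (intro dfn_intros)
    show "succ empty \<in> Even \<longleftrightarrow> empty \<notin> Even"
      using inv[of "succ empty"] empty_Even succ_inject succ_neq_empty by blast
    fix n assume n: "n \<in> Nat" "succ n \<in> Even \<longleftrightarrow> n \<notin> Even"
    have "succ (succ n) \<in> Even \<longleftrightarrow> n \<in> Even"
      using inv[of "succ (succ n)"] Even_SS succ_inject succ_neq_empty by blast
    then show "succ (succ n) \<in> Even \<longleftrightarrow> succ n \<notin> Even" using n by blast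
  qed
  then show ?thesis .
qed

subsection \<open>Conditions\<close>

definition fs :: "'v \<Rightarrow> 'v" where "fs p = the1 (\<lambda>x. \<exists>y. p = pair x y)"
definition sn :: "'v \<Rightarrow> 'v" where "sn p = the1 (\<lambda>y. \<exists>x. p = pair x y)"

lemma fs_pair [simp]: "fs (pair x y) = x"
  unfolding fs_def by (rule the1_eqI) auto

lemma sn_pair [simp]: "sn (pair x y) = y"
  unfolding sn_def by (rule the1_eqI) auto

lemma dterm_fs [dfn_intros]: "dterm t \<Longrightarrow> dterm (\<lambda>e. fs (t e))"
  by (rule dterm_lift1[where f = fs]) (unfold fs_def, intro dfn_intros)

lemma dterm_sn [dfn_intros]: "dterm t \<Longrightarrow> dterm (\<lambda>e. sn (t e))"
  by (rule dterm_lift1[where f = sn]) (unfold sn_def, intro dfn_intros)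

lemma dfn_subset_Nat [dfn_intros]: "dterm t \<Longrightarrow> dfn (\<lambda>e. elts (t e) \<subseteq> Nat)"
  unfolding elts_om[symmetric] by (intro dfn_intros)

text \<open>A condition \<open>(k, a, b)\<close> with \<open>a, b \<subseteq> k \<in> \<omega>\<close> stands for the basic open set of the pairs \<open>(x, y)\<close> of
  subsets of \<open>\<omega>\<close> with \<open>x \<inter> k = a\<close> and \<open>y \<inter> k = b\<close>. Larger conditions are stronger.\<close>

definition trip :: "'v \<Rightarrow> 'v \<Rightarrow> 'v \<Rightarrow> 'v" where "trip k a b = pair k (pair a b)"
definition K :: "'v \<Rightarrow> 'v" where "K c = fs c"
definition L :: "'v \<Rightarrow> 'v" where "L c = fs (sn c)"
definition R :: "'v \<Rightarrow> 'v" where "R c = sn (sn c)"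

lemma trip_sel [simp]: "K (trip k a b) = k" "L (trip k a b) = a" "R (trip k a b) = b"
  unfolding trip_def K_def L_def R_def by simp_all

lemma trip_eq_iff [simp]: "trip k a b = trip k' a' b' \<longleftrightarrow> k = k' \<and> a = a' \<and> b = b'"
  unfolding trip_def by simp

lemma dterm_trip [dfn_intros]: "dterm t \<Longrightarrow> dterm u \<Longrightarrow> dterm v \<Longrightarrow> dterm (\<lambda>e. trip (t e) (u e) (v e))"
  unfolding trip_def by (intro dfn_intros)

lemma dterm_K [dfn_intros]: "dterm t \<Longrightarrow> dterm (\<lambda>e. K (t e))"
  unfolding K_def by (intro dfn_intros)
lemma dterm_L [dfn_intros]: "dterm t \<Longrightarrow> dterm (\<lambda>e. L (t e))"
  unfolding L_def by (intro dfn_intros)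
lemma dterm_R [dfn_intros]: "dterm t \<Longrightarrow> dterm (\<lambda>e. R (t e))"
  unfolding R_def by (intro dfn_intros)

definition CS :: 'v where
  "CS = sep (prod om (prod (Pw om) (Pw om))) (\<lambda>c. elts (L c) \<subseteq> elts (K c) \<and> elts (R c) \<subseteq> elts (K c))"

lemma trip_CS [simp]: "trip k a b \<in> elts CS \<longleftrightarrow> k \<in> Nat \<and> elts a \<subseteq> elts k \<and> elts b \<subseteq> elts k"
proof -
  have "elts CS = {c \<in> elts (prod om (prod (Pw om) (Pw om))). elts (L c) \<subseteq> elts (K c) \<and> elts (R c) \<subseteq> elts (K c)}"
    unfolding CS_def by (rule elts_sep) (intro dfn_intros)
  moreover have "trip k a b \<in> elts (prod om (prod (Pw om) (Pw om))) \<longleftrightarrow> k \<in> Nat \<and> elts a \<subseteq> Nat \<and> elts b \<subseteq> Nat"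
    unfolding trip_def by simp
  moreover have "elts k \<subseteq> Nat" if "k \<in> Nat" using Nat_trans that by blast
  ultimately show ?thesis by auto
qed

lemma CS_eq:
  assumes "c \<in> elts CS"
  shows "c = trip (K c) (L c) (R c)"
proof -
  have "elts CS = {c \<in> elts (prod om (prod (Pw om) (Pw om))). elts (L c) \<subseteq> elts (K c) \<and> elts (R c) \<subseteq> elts (K c)}"
    unfolding CS_def by (rule elts_sep) (intro dfn_intros)
  then obtain k a b where "c = pair k (pair a b)" using assms by (auto simp: elts_prod)
  then show ?thesis by (simp add: trip_def K_def L_def R_def)
qed

lemma CS_sel:
  assumes "c \<in> elts CS"
  shows "K c \<in> Nat" "elts (L c) \<subseteq> elts (K c)" "elts (R c) \<subseteq> elts (K c)"
  using assms CS_eq[OF assms] trip_CS[of "K c" "L c" "R c"] by auto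

lemma CS_eqI: "c \<in> elts CS \<Longrightarrow> c' \<in> elts CS \<Longrightarrow> elts (K c) = elts (K c') \<Longrightarrow> elts (L c) = elts (L c') \<Longrightarrow>
   elts (R c) = elts (R c') \<Longrightarrow> c = c'"
  using CS_eq[of c] CS_eq[of c'] set_ext by metis

definition le :: "'v \<Rightarrow> 'v \<Rightarrow> bool" where
  "le c c' \<longleftrightarrow> elts (K c) \<subseteq> elts (K c') \<and> L c = inter (L c') (K c) \<and> R c = inter (R c') (K c)"

lemma le_iff: "le c c' \<longleftrightarrow> elts (K c) \<subseteq> elts (K c') \<and> elts (L c) = elts (L c') \<inter> elts (K c) \<and>
    elts (R c) = elts (R c') \<inter> elts (K c)"
  unfolding le_def set_eq_iff[of "L c"] set_eq_iff[of "R c"] by simp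

lemma dfn_le [dfn_intros]: "dterm t \<Longrightarrow> dterm u \<Longrightarrow> dfn (\<lambda>e. le (t e) (u e))"
  unfolding le_def by (intro dfn_intros)

lemma le_refl: "c \<in> elts CS \<Longrightarrow> le c c"
  unfolding le_iff using CS_sel by blast

lemma le_trans: "le a b \<Longrightarrow> le b c \<Longrightarrow> le a c"
  unfolding le_iff by blast

definition rst :: "'v \<Rightarrow> 'v \<Rightarrow> 'v \<Rightarrow> 'v" where "rst x y k = trip k (inter x k) (inter y k)"

lemma dterm_rst [dfn_intros]: "dterm t \<Longrightarrow> dterm u \<Longrightarrow> dterm v \<Longrightarrow> dterm (\<lambda>e. rst (t e) (u e) (v e))"
  unfolding rst_def by (intro dfn_intros)

lemma rst_sel [simp]: "K (rst x y k) = k" "L (rst x y k) = inter x k" "R (rst x y k) = inter y k"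
  unfolding rst_def by simp_all

lemma rst_CS [simp]: "rst x y k \<in> elts CS \<longleftrightarrow> k \<in> Nat"
  unfolding rst_def by simp

definition on :: "'v \<Rightarrow> 'v \<Rightarrow> 'v \<Rightarrow> bool" where
  "on c x y \<longleftrightarrow> L c = inter x (K c) \<and> R c = inter y (K c)"

lemma on_iff: "on c x y \<longleftrightarrow> elts (L c) = elts x \<inter> elts (K c) \<and> elts (R c) = elts y \<inter> elts (K c)"
  unfolding on_def set_eq_iff[of "L c"] set_eq_iff[of "R c"] by simp

lemma dfn_on [dfn_intros]: "dterm t \<Longrightarrow> dterm u \<Longrightarrow> dterm v \<Longrightarrow> dfn (\<lambda>e. on (t e) (u e) (v e))"
  unfolding on_def by (intro dfn_intros)

lemma on_eq_rst: "c \<in> elts CS \<Longrightarrow> on c x y \<Longrightarrow> c = rst x y (K c)"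
  unfolding on_def rst_def using CS_eq[of c] by metis

lemma on_rst: "on (rst x y k) x y" unfolding on_def by simp

lemma on_le: "le c c' \<Longrightarrow> on c' x y \<Longrightarrow> on c x y"
  unfolding le_iff on_iff by blast

lemma le_on: "on c x y \<Longrightarrow> on c' x y \<Longrightarrow> elts (K c) \<subseteq> elts (K c') \<Longrightarrow> le c c'"
  unfolding le_iff on_iff by blast

definition bt :: "'v \<Rightarrow> 'v \<Rightarrow> 'v" where "bt a m = (if m \<in> elts a then succ empty else empty)"

lemma dterm_bt [dfn_intros]: "dterm t \<Longrightarrow> dterm u \<Longrightarrow> dterm (\<lambda>e. bt (t e) (u e))"
  unfolding bt_def by (intro dfn_intros)

lemma bt_Nat [simp]: "bt a m \<in> Nat" unfolding bt_def by simp

lemma bt_eq_iff: "bt a m = bt b m \<longleftrightarrow> (m \<in> elts a \<longleftrightarrow> m \<in> elts b)"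
  unfolding bt_def by simp

text \<open>The codes serve three purposes: as moves in a game on \<omega>, as indices of dense
  sets, and as the ordering by which \<open>dependent_choice\<close> selects conditions.\<close>

definition ccode :: "'v \<Rightarrow> 'v" where
  "ccode c = npair (K c) (npair (seqcode (bt (L c)) (K c)) (seqcode (bt (R c)) (K c)))"

lemma dterm_ccode [dfn_intros]: "dterm t \<Longrightarrow> dterm (\<lambda>e. ccode (t e))"
  by (rule dterm_lift1[where f = ccode]) (unfold ccode_def, intro dfn_intros)

lemma seqcode_bt:
  shows "n \<in> Nat \<Longrightarrow> seqcode (bt a) n \<in> Nat"
    and "n \<in> Nat \<Longrightarrow> seqcode (bt a) n = seqcode (bt b) n \<Longrightarrow> elts a \<inter> elts n = elts b \<inter> elts n"
proof -
  have d: "dterm (\<lambda>e. bt a (e 0))" for a by (intro dfn_intros)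
  show "n \<in> Nat \<Longrightarrow> seqcode (bt a) n \<in> Nat" using seqcode_rec(3)[OF d] by simp
  assume n: "n \<in> Nat" "seqcode (bt a) n = seqcode (bt b) n"
  have "bt a m = bt b m" if "m \<in> elts n" for m by (rule seqcode_inj[OF d _ d _ n that]) simp_all
  then show "elts a \<inter> elts n = elts b \<inter> elts n" unfolding bt_eq_iff by blast
qed

lemma ccode_Nat: "c \<in> elts CS \<Longrightarrow> ccode c \<in> Nat"
  unfolding ccode_def using CS_sel(1) seqcode_bt(1) npair_rec(3) by simp

lemma ccode_inj: "inj_on ccode (elts CS)"
proof (rule inj_onI)
  fix c c' assume c: "c \<in> elts CS" "c' \<in> elts CS" "ccode c = ccode c'"
  note k = CS_sel[OF c(1)] and k' = CS_sel[OF c(2)]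
  note N = seqcode_bt(1)[OF k(1)] and N' = seqcode_bt(1)[OF k'(1)]
  from npair_inj[OF k(1) npair_rec(3)[OF N N] k'(1) npair_rec(3)[OF N' N'] c(3)[unfolded ccode_def]]
  have K: "K c = K c'" and e: "npair (seqcode (bt (L c)) (K c)) (seqcode (bt (R c)) (K c)) =
    npair (seqcode (bt (L c')) (K c')) (seqcode (bt (R c')) (K c'))" by auto
  from npair_inj[OF N N N' N' e]
  have "seqcode (bt (L c)) (K c) = seqcode (bt (L c')) (K c)" "seqcode (bt (R c)) (K c) = seqcode (bt (R c')) (K c)"
    using K by auto
  then have "elts (L c) \<inter> elts (K c) = elts (L c') \<inter> elts (K c)" "elts (R c) \<inter> elts (K c) = elts (R c') \<inter> elts (K c)"
    using seqcode_bt(2)[OF k(1)] by blast+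
  then show "c = c'" using K k k' by (intro CS_eqI c) auto
qed

subsection \<open>Limits of chains\<close>

definition UL :: "('v \<Rightarrow> 'v) \<Rightarrow> 'v" where "UL F = sep om (\<lambda>m. \<exists>n\<in>Nat. m \<in> elts (L (F n)))"
definition UR :: "('v \<Rightarrow> 'v) \<Rightarrow> 'v" where "UR F = sep om (\<lambda>m. \<exists>n\<in>Nat. m \<in> elts (R (F n)))"

lemma dterm_UL [dfn_intros]:
  assumes "dterm (\<lambda>e. F (\<lambda>n. e (Suc n)) (e 0))"
  shows "dterm (\<lambda>e. UL (F e))"
  unfolding UL_def by (intro dfn_intros dterm_skip[of F, OF assms])

lemma dterm_UR [dfn_intros]:
  assumes "dterm (\<lambda>e. F (\<lambda>n. e (Suc n)) (e 0))"
  shows "dterm (\<lambda>e. UR (F e))"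
  unfolding UR_def by (intro dfn_intros dterm_skip[of F, OF assms])

lemma elts_UL:
  assumes "dterm (\<lambda>e. F (e 0))"
  shows "elts (UL F) = {m \<in> Nat. \<exists>n\<in>Nat. m \<in> elts (L (F n))}"
  unfolding UL_def elts_om[symmetric]
  by (rule elts_sep) (intro dfn_intros assms)

lemma elts_UR:
  assumes "dterm (\<lambda>e. F (e 0))"
  shows "elts (UR F) = {m \<in> Nat. \<exists>n\<in>Nat. m \<in> elts (R (F n))}"
  unfolding UR_def elts_om[symmetric]
  by (rule elts_sep) (intro dfn_intros assms)

lemma nat_chain:
  assumes F: "dterm (\<lambda>e. F (e 0))" and Q: "dfn (\<lambda>e. Q (e 0) (e 1))"
    and refl: "\<And>n. n \<in> Nat \<Longrightarrow> Q (F n) (F n)" and trans: "\<And>a b c. Q a b \<Longrightarrow> Q b c \<Longrightarrow> Q a c"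
    and step: "\<And>n. n \<in> Nat \<Longrightarrow> Q (F n) (F (succ n))"
    and n: "n \<in> Nat" and m: "m \<in> Nat" and sub: "elts n \<subseteq> elts m"
  shows "Q (F n) (F m)"
proof -
  have F': "dterm t \<Longrightarrow> dterm (\<lambda>e. F (t e))" for t using dterm_lift1[of F] F(1) by blast
  have Q': "dterm t \<Longrightarrow> dterm u \<Longrightarrow> dfn (\<lambda>e. Q (t e) (u e))" for t u using dfn_lift2[of Q] Q by blast
  have "elts n \<subseteq> elts m \<longrightarrow> Q (F n) (F m)"
  proof (rule nat_induct_dfn[OF m])
    show "dfn (\<lambda>e. elts n \<subseteq> elts (e 0) \<longrightarrow> Q (F n) (F (e 0)))" by (intro dfn_intros F' Q')
    show "elts n \<subseteq> elts empty \<longrightarrow> Q (F n) (F empty)"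
      using refl[OF n] eq_empty_iff[of n] by auto
    fix k assume k: "k \<in> Nat" "elts n \<subseteq> elts k \<longrightarrow> Q (F n) (F k)"
    show "elts n \<subseteq> elts (succ k) \<longrightarrow> Q (F n) (F (succ k))"
    proof
      assume "elts n \<subseteq> elts (succ k)"
      then have "n = succ k \<or> n \<in> elts (succ k)" using nat_subset_iff[OF n succ_Nat[OF k(1)]] by blast
      then have "n = succ k \<or> elts n \<subseteq> elts k" using nat_mem_subset[OF k(1)] by auto
      then show "Q (F n) (F (succ k))" using k(2) step[OF k(1)] trans refl[OF n] by blast
    qed
  qed
  then show ?thesis using sub by blast
qed

lemma chain_le:
  assumes F: "dterm (\<lambda>e. F (e 0))" "\<And>n. n \<in> Nat \<Longrightarrow> F n \<in> elts CS" "\<And>n. n \<in> Nat \<Longrightarrow> le (F n) (F (succ n))"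
    and n: "n \<in> Nat" and m: "m \<in> Nat" and sub: "elts n \<subseteq> elts m"
  shows "le (F n) (F m)"
proof (rule nat_chain[where Q = le, OF F(1) _ _ _ F(3) n m sub])
  show "dfn (\<lambda>e. le (e 0) (e 1))" by (intro dfn_intros)
  show "le (F n) (F n)" if "n \<in> Nat" for n by (rule le_refl[OF F(2)[OF that]])
qed (rule le_trans)

text \<open>Any two members of the chain are comparable, so a bit set at some stage below the length
  of another member is already present in that member.\<close>

lemma chain_limit:
  assumes F: "dterm (\<lambda>e. F (e 0))" "\<And>n. n \<in> Nat \<Longrightarrow> F n \<in> elts CS" "\<And>n. n \<in> Nat \<Longrightarrow> le (F n) (F (succ n))"
    and n: "n \<in> Nat"
  shows "on (F n) (UL F) (UR F)"
proof -
  have sub: "elts (L (F m)) \<subseteq> Nat" "elts (R (F m)) \<subseteq> Nat" if m: "m \<in> Nat" for m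
    using CS_sel[OF F(2)[OF m]] Nat_trans by blast+
  have lin: "le (F n) (F m) \<or> le (F m) (F n)" if m: "m \<in> Nat" for m
    using chain_le[OF F n m] chain_le[OF F m n] nat_subset_linear[OF n m] by blast
  have "i \<in> elts (L (F n))" if i: "m \<in> Nat" "i \<in> elts (L (F m))" "i \<in> elts (K (F n))" for i m
    using lin[OF i(1)] i(2,3) unfolding le_iff by blast
  moreover have "i \<in> elts (R (F n))" if i: "m \<in> Nat" "i \<in> elts (R (F m))" "i \<in> elts (K (F n))" for i m
    using lin[OF i(1)] i(2,3) unfolding le_iff by blast
  ultimately show ?thesis
    unfolding on_iff elts_UL[OF F(1)] elts_UR[OF F(1)] using sub[OF n] CS_sel[OF F(2)[OF n]] n by blast
qed

subsection \<open>Comeager sets\<close>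

text \<open>A set D of pairs codes the sequence of its sections, so a countable intersection of open
  sets has a single witness in the structure.\<close>

definition dense_fam :: "'v \<Rightarrow> 'v \<Rightarrow> bool" where
  "dense_fam D p \<longleftrightarrow> (\<forall>n\<in>Nat. \<forall>c\<in>elts CS. le p c \<longrightarrow> (\<exists>c'\<in>elts CS. le c c' \<and> pair n c' \<in> elts D))"

definition open_fam :: "'v \<Rightarrow> bool" where
  "open_fam D \<longleftrightarrow> (\<forall>n\<in>Nat. \<forall>c\<in>elts CS. \<forall>c'\<in>elts CS. le c c' \<longrightarrow> pair n c \<in> elts D \<longrightarrow> pair n c' \<in> elts D)"

definition generic :: "'v \<Rightarrow> 'v \<Rightarrow> 'v \<Rightarrow> bool" where
  "generic D x y \<longleftrightarrow> (\<forall>n\<in>Nat. \<exists>k\<in>Nat. pair n (rst x y k) \<in> elts D)"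

lemma dfn_dense_fam [dfn_intros]: "dterm t \<Longrightarrow> dterm u \<Longrightarrow> dfn (\<lambda>e. dense_fam (t e) (u e))"
  by (rule dfn_lift2[where P = dense_fam]) (unfold dense_fam_def, intro dfn_intros)

lemma dfn_open_fam [dfn_intros]: "dterm t \<Longrightarrow> dfn (\<lambda>e. open_fam (t e))"
  by (rule dfn_lift1[where P = open_fam]) (unfold open_fam_def, intro dfn_intros)

lemma dfn_generic [dfn_intros]: "dterm t \<Longrightarrow> dterm u \<Longrightarrow> dterm v \<Longrightarrow> dfn (\<lambda>e. generic (t e) (u e) (v e))"
  by (rule dfn_lift3[where P = generic]) (unfold generic_def, intro dfn_intros)

text \<open>\<open>A\<close> is comeager in the basic open set given by \<open>p\<close>. Subsets \<open>B\<close> of \<open>P(\<omega>)\<close> are treated as relations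
  that ignore their first argument.\<close>

definition comeager :: "('v \<Rightarrow> 'v \<Rightarrow> bool) \<Rightarrow> 'v \<Rightarrow> bool" where
  "comeager A p \<longleftrightarrow> p \<in> elts CS \<and> (\<exists>D. open_fam D \<and> dense_fam D p \<and>
     (\<forall>x y. elts x \<subseteq> Nat \<and> elts y \<subseteq> Nat \<and> on p x y \<and> generic D x y \<longrightarrow> A x y))"

text \<open>Lets comeagerness occur inside definable predicates, as the minimality argument of
  \<open>wellordered_union_not_comeager\<close> requires.\<close>

lemma dfn_comeager [dfn_intros]:
  assumes "dfn (\<lambda>e. A (\<lambda>n. e (Suc (Suc n))) (e 1) (e 0))" "dterm t"
  shows "dfn (\<lambda>e. comeager (A e) (t e))"
proof -
  have i: "inj (case_nat 0 (case_nat 1 (\<lambda>n. Suc (Suc (Suc n)))))"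
    by (intro inj_case_nat) (auto simp: image_iff inj_def split: nat.splits)
  have A: "dfn (\<lambda>e. A (\<lambda>n. e (Suc (Suc (Suc n)))) (e (Suc 0)) (e 0))"
    using dfn_rename[OF i assms(1)] by simp
  show ?thesis unfolding comeager_def
    by (intro dfn_intros A assms(2) dterm_shift[OF assms(2)] dterm_shift[OF dterm_shift[OF dterm_shift[OF assms(2)]]])
qed

lemma comeager_mono: "comeager A p \<Longrightarrow> (\<And>x y. A x y \<Longrightarrow> B x y) \<Longrightarrow> comeager B p"
  unfolding comeager_def by blast

lemma comeagerE:
  assumes "comeager A p"
  obtains D where "p \<in> elts CS" "open_fam D" "dense_fam D p"
    "\<And>x y. elts x \<subseteq> Nat \<Longrightarrow> elts y \<subseteq> Nat \<Longrightarrow> on p x y \<Longrightarrow> generic D x y \<Longrightarrow> A x y"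
  using assms unfolding comeager_def by blast

definition mkfam :: "('v \<Rightarrow> 'v \<Rightarrow> bool) \<Rightarrow> 'v" where
  "mkfam P = sep (prod om CS) (\<lambda>p. P (fs p) (sn p))"

lemma pair_in_mkfam:
  assumes "dfn (\<lambda>e. P (e 0) (e 1))"
  shows "pair n c \<in> elts (mkfam P) \<longleftrightarrow> n \<in> Nat \<and> c \<in> elts CS \<and> P n c"
proof -
  have "dfn (\<lambda>e. P (fs (e 0)) (sn (e 0)))"
    by (rule dfn_lift2[where P = P, OF assms]) (intro dfn_intros)+
  then have "elts (mkfam P) = {p \<in> elts (prod om CS). P (fs p) (sn p)}"
    unfolding mkfam_def by (rule elts_sep)
  then show ?thesis by auto
qed

lemma comeagerI:
  assumes P: "dfn (\<lambda>e. P (e 0) (e 1))" and p: "p \<in> elts CS"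
    and o: "\<And>n c c'. n \<in> Nat \<Longrightarrow> c \<in> elts CS \<Longrightarrow> c' \<in> elts CS \<Longrightarrow> le c c' \<Longrightarrow> P n c \<Longrightarrow> P n c'"
    and d: "\<And>n c. n \<in> Nat \<Longrightarrow> c \<in> elts CS \<Longrightarrow> le p c \<Longrightarrow> \<exists>c'\<in>elts CS. le c c' \<and> P n c'"
    and A: "\<And>x y. elts x \<subseteq> Nat \<Longrightarrow> elts y \<subseteq> Nat \<Longrightarrow> on p x y \<Longrightarrow> (\<And>n. n \<in> Nat \<Longrightarrow> \<exists>k\<in>Nat. P n (rst x y k)) \<Longrightarrow> A x y"
  shows "comeager A p"
  unfolding comeager_def
proof (intro conjI exI[of _ "mkfam P"] allI impI)
  note m = pair_in_mkfam[OF P]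
  show "p \<in> elts CS" by (rule p)
  show "open_fam (mkfam P)" unfolding open_fam_def m using o by blast
  show "dense_fam (mkfam P) p" unfolding dense_fam_def m using d by blast
  show "A x y" if "elts x \<subseteq> Nat \<and> elts y \<subseteq> Nat \<and> on p x y \<and> generic (mkfam P) x y" for x y
    using that A[of x y] unfolding generic_def m by blast
qed

lemma comeager_le:
  assumes "comeager A p" "le p q" "q \<in> elts CS"
  shows "comeager A q"
proof -
  obtain D where D: "p \<in> elts CS" "open_fam D" "dense_fam D p"
    "\<And>x y. elts x \<subseteq> Nat \<Longrightarrow> elts y \<subseteq> Nat \<Longrightarrow> on p x y \<Longrightarrow> generic D x y \<Longrightarrow> A x y"
    using assms(1) by (rule comeagerE) blast
  have "dense_fam D q" using D(3) le_trans[OF assms(2)] unfolding dense_fam_def by blast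
  moreover have "A x y" if "elts x \<subseteq> Nat" "elts y \<subseteq> Nat" "on q x y" "generic D x y" for x y
    using D(4) that on_le[OF assms(2)] by blast
  ultimately show ?thesis unfolding comeager_def using assms(3) D(2) by blast
qed

lemma comeager_conj:
  assumes "comeager A p" "comeager B p"
  shows "comeager (\<lambda>x y. A x y \<and> B x y) p"
proof -
  obtain D where D: "p \<in> elts CS" "open_fam D" "dense_fam D p"
    "\<And>x y. elts x \<subseteq> Nat \<Longrightarrow> elts y \<subseteq> Nat \<Longrightarrow> on p x y \<Longrightarrow> generic D x y \<Longrightarrow> A x y"
    using assms(1) by (rule comeagerE) blast
  obtain D' where D': "open_fam D'" "dense_fam D' p"
    "\<And>x y. elts x \<subseteq> Nat \<Longrightarrow> elts y \<subseteq> Nat \<Longrightarrow> on p x y \<Longrightarrow> generic D' x y \<Longrightarrow> B x y"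
    using assms(2) by (rule comeagerE) blast
  show ?thesis
  proof (rule comeagerI[where P = "\<lambda>n c. pair n c \<in> elts D \<and> pair n c \<in> elts D'"])
    show "dfn (\<lambda>e. pair (e 0) (e 1) \<in> elts D \<and> pair (e 0) (e 1) \<in> elts D')" by (intro dfn_intros)
    show "p \<in> elts CS" by fact
    show "pair n c' \<in> elts D \<and> pair n c' \<in> elts D'"
      if "n \<in> Nat" "c \<in> elts CS" "c' \<in> elts CS" "le c c'" "pair n c \<in> elts D \<and> pair n c \<in> elts D'" for n c c'
      using that D(2) D'(1) unfolding open_fam_def by blast
    show "\<exists>c'\<in>elts CS. le c c' \<and> pair n c' \<in> elts D \<and> pair n c' \<in> elts D'"
      if n: "n \<in> Nat" "c \<in> elts CS" "le p c" for n c
    proof -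
      obtain c1 where c1: "c1 \<in> elts CS" "le c c1" "pair n c1 \<in> elts D"
        using D(3) n unfolding dense_fam_def by blast
      obtain c2 where c2: "c2 \<in> elts CS" "le c1 c2" "pair n c2 \<in> elts D'"
        using D'(2) n(1) c1 le_trans[OF n(3) c1(2)] unfolding dense_fam_def by blast
      have "pair n c2 \<in> elts D" using D(2) n(1) c1 c2 unfolding open_fam_def by blast
      then show ?thesis using c1 c2 le_trans by blast
    qed
    show "A x y \<and> B x y" if xy: "elts x \<subseteq> Nat" "elts y \<subseteq> Nat" "on p x y"
      and g: "\<And>n. n \<in> Nat \<Longrightarrow> \<exists>k\<in>Nat. pair n (rst x y k) \<in> elts D \<and> pair n (rst x y k) \<in> elts D'" for x y
    proof -
      have "generic D x y" "generic D' x y" unfolding generic_def using g by blast+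
      then show ?thesis using D(4) D'(3) xy by blast
    qed
  qed
qed

text \<open>The Baire category theorem, with the successive conditions selected by their
  codes.\<close>

lemma generic_exists:
  assumes "p \<in> elts CS" "dense_fam D p"
  obtains x y where "elts x \<subseteq> Nat" "elts y \<subseteq> Nat" "on p x y" "generic D x y"
proof -
  \<comment> \<open>Vacuous off the extensions of p, so that every condition has a successor as
    \<open>dependent_choice\<close> demands; the run that starts at p stays among the extensions of
    p.\<close>
  define Q where "Q n c c' \<longleftrightarrow> (le p c \<longrightarrow> le c c' \<and> pair n c' \<in> elts D)" for n c c'
  have Qd: "dfn (\<lambda>e. Q (e 0) (e 1) (e 2))" unfolding Q_def by (intro dfn_intros)
  have cd: "dterm (\<lambda>e. ccode (e 0))" by (intro dfn_intros)
  have tot: "\<exists>c'\<in>elts CS. Q n c c'" if "n \<in> Nat" "c \<in> elts CS" for n c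
    using assms(2) that unfolding Q_def dense_fam_def by blast
  obtain f where f: "func f Nat (elts CS)" "ap f empty = p" "\<And>n. n \<in> Nat \<Longrightarrow> Q n (ap f n) (ap f (succ n))"
    using dependent_choice[where R = Q, OF cd ccode_Nat ccode_inj Qd assms(1) tot] by blast
  have fC: "ap f n \<in> elts CS" if "n \<in> Nat" for n using func_ap_in[OF f(1) that] .
  have fp: "le p (ap f n)" if n: "n \<in> Nat" for n
  proof (rule nat_induct_dfn[OF n])
    show "dfn (\<lambda>e. le p (ap f (e 0)))" by (intro dfn_intros)
    show "le p (ap f empty)" using f(2) le_refl assms(1) by simp
    show "le p (ap f (succ m))" if m: "m \<in> Nat" "le p (ap f m)" for m
      using f(3)[OF m(1)] m(2) le_trans unfolding Q_def by blast
  qed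
  have step: "le (ap f n) (ap f (succ n))" "pair n (ap f (succ n)) \<in> elts D" if "n \<in> Nat" for n
    using f(3)[OF that] fp[OF that] unfolding Q_def by blast+
  have fd: "dterm (\<lambda>e. ap f (e 0))" by (intro dfn_intros)
  define x where "x = UL (ap f)"
  define y where "y = UR (ap f)"
  have lim: "on (ap f n) x y" if "n \<in> Nat" for n
    unfolding x_def y_def by (rule chain_limit[OF fd fC step(1) that])
  show thesis
  proof (rule that[of x y])
    show "elts x \<subseteq> Nat" "elts y \<subseteq> Nat" unfolding x_def y_def elts_UL[OF fd] elts_UR[OF fd] by blast+
    show "on p x y" using lim[of empty] f(2) by simp
    show "generic D x y" unfolding generic_def
    proof
      fix n assume n: "n \<in> Nat"
      have "ap f (succ n) = rst x y (K (ap f (succ n)))" using on_eq_rst lim fC n by simp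
      then show "\<exists>k\<in>Nat. pair n (rst x y k) \<in> elts D" using step(2)[OF n] CS_sel(1)[OF fC] n
        by (metis succ_Nat)
    qed
  qed
qed

lemma comeager_exists:
  assumes "comeager A p"
  obtains x y where "elts x \<subseteq> Nat" "elts y \<subseteq> Nat" "on p x y" "A x y"
proof -
  obtain D where D: "p \<in> elts CS" "dense_fam D p"
    "\<And>x y. elts x \<subseteq> Nat \<Longrightarrow> elts y \<subseteq> Nat \<Longrightarrow> on p x y \<Longrightarrow> generic D x y \<Longrightarrow> A x y"
    using assms(1) by (rule comeagerE) blast
  obtain x y where "elts x \<subseteq> Nat" "elts y \<subseteq> Nat" "on p x y" "generic D x y"
    using D(1,2) by (rule generic_exists) blast
  then show thesis using that D(3) by blast
qed

definition swp :: "'v \<Rightarrow> 'v" where "swp c = trip (K c) (R c) (L c)"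

lemma dterm_swp [dfn_intros]: "dterm t \<Longrightarrow> dterm (\<lambda>e. swp (t e))"
  unfolding swp_def by (intro dfn_intros)

lemma swp_simps: "K (swp c) = K c" "L (swp c) = R c" "R (swp c) = L c"
  unfolding swp_def by simp_all

lemma swp_CS: "c \<in> elts CS \<Longrightarrow> swp c \<in> elts CS"
  unfolding swp_def using CS_sel by simp

lemma swp_swp: "c \<in> elts CS \<Longrightarrow> swp (swp c) = c"
  unfolding swp_def using CS_eq by simp

lemma le_swp: "le (swp c) (swp c') \<longleftrightarrow> le c c'"
  unfolding le_def swp_simps by blast

lemma on_swp: "on (swp c) x y \<longleftrightarrow> on c y x"
  unfolding on_def swp_simps by blast

lemma swp_rst: "swp (rst x y k) = rst y x k"
  unfolding swp_def rst_def by simp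

lemma comeager_swp:
  assumes "comeager A p"
  shows "comeager (\<lambda>x y. A y x) (swp p)"
proof -
  obtain D where D: "p \<in> elts CS" "open_fam D" "dense_fam D p"
    "\<And>x y. elts x \<subseteq> Nat \<Longrightarrow> elts y \<subseteq> Nat \<Longrightarrow> on p x y \<Longrightarrow> generic D x y \<Longrightarrow> A x y"
    using assms(1) by (rule comeagerE) blast
  show ?thesis
  proof (rule comeagerI[where P = "\<lambda>n c. pair n (swp c) \<in> elts D"])
    show "dfn (\<lambda>e. pair (e 0) (swp (e 1)) \<in> elts D)" by (intro dfn_intros)
    show "swp p \<in> elts CS" using swp_CS D(1) .
    show "pair n (swp c') \<in> elts D" if "n \<in> Nat" "c \<in> elts CS" "c' \<in> elts CS" "le c c'" "pair n (swp c) \<in> elts D" for n c c'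
      using that D(2) swp_CS le_swp unfolding open_fam_def by blast
    show "\<exists>c'\<in>elts CS. le c c' \<and> pair n (swp c') \<in> elts D" if nc: "n \<in> Nat" "c \<in> elts CS" "le (swp p) c" for n c
    proof -
      have "le p (swp c)" using nc(3) le_swp[of p "swp c"] swp_swp[OF nc(2)] by simp
      then obtain c' where c': "c' \<in> elts CS" "le (swp c) c'" "pair n c' \<in> elts D"
        using D(3) nc(1) swp_CS[OF nc(2)] unfolding dense_fam_def by blast
      then have "le c (swp c')" using le_swp[of "swp c" c'] swp_swp[OF nc(2)] by simp
      then show ?thesis using c' swp_CS[OF c'(1)] swp_swp[OF c'(1)] by metis
    qed
    show "A y x" if "elts x \<subseteq> Nat" "elts y \<subseteq> Nat" "on (swp p) x y" "\<And>n. n \<in> Nat \<Longrightarrow> \<exists>k\<in>Nat. pair n (swp (rst x y k)) \<in> elts D" for x y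
      using D(4)[of y x] that unfolding generic_def swp_rst on_swp by blast
  qed
qed

text \<open>Kuratowski--Ulam: \<open>x\<close> is taken generic for the countably many dense sets that make the section
  of the given family at \<open>x\<close> dense.\<close>

lemma comeager_section:
  assumes A: "comeager A p"
  obtains x where "elts x \<subseteq> Nat" "comeager (\<lambda>_ y. A x y) (trip (K p) (R p) (R p))"
proof -
  obtain D where D: "p \<in> elts CS" "open_fam D" "dense_fam D p"
    "\<And>x y. elts x \<subseteq> Nat \<Longrightarrow> elts y \<subseteq> Nat \<Longrightarrow> on p x y \<Longrightarrow> generic D x y \<Longrightarrow> A x y"
    using A by (rule comeagerE) blast
  \<comment> \<open>The left part of c is enough to provide a member u of the i-th dense set whose
    right part extends that of t. The right part of c is not consulted, so this is a demand on x
    alone.\<close>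
  define E where "E i t c \<longleftrightarrow> (\<exists>u\<in>elts CS. pair i u \<in> elts D \<and> elts (K u) \<subseteq> elts (K c) \<and> L u = inter (L c) (K u) \<and>
     elts (K t) \<subseteq> elts (K u) \<and> R t = inter (R u) (K t))" for i t c
  \<comment> \<open>One dense set for each pair (i, t), indexed by its code; indices that code no
    such pair impose nothing.\<close>
  define P where "P j c \<longleftrightarrow> (\<forall>i\<in>Nat. \<forall>t\<in>elts CS. npair i (ccode t) = j \<longrightarrow> le p t \<longrightarrow> E i t c)" for j c
  have Pd: "dfn (\<lambda>e. P (e 0) (e 1))" unfolding P_def E_def by (intro dfn_intros)
  have Edense: "\<exists>c'\<in>elts CS. le c c' \<and> E i t c'"
    if i: "i \<in> Nat" and t: "t \<in> elts CS" "le p t" and c: "c \<in> elts CS" "le p c" for i t c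
  proof -
    \<comment> \<open>The left part of c and the right part of t, padded with zeros to the larger of
      the two lengths.\<close>
    define v where "v = trip (union (K c) (K t)) (L c) (R t)"
    have v: "v \<in> elts CS" "le p v"
      using CS_sel[OF t(1)] CS_sel[OF c(1)] nat_max t(2) c(2) unfolding v_def le_iff by auto
    obtain u where u: "u \<in> elts CS" "le v u" "pair i u \<in> elts D"
      using D(3) i v unfolding dense_fam_def by blast
    define c' where "c' = trip (K u) (L u) (R c)"
    have Ku: "elts (K c) \<subseteq> elts (K u)" "elts (K t) \<subseteq> elts (K u)"
      using u(2) unfolding le_iff v_def by auto
    have c': "c' \<in> elts CS" using CS_sel[OF u(1)] CS_sel[OF c(1)] Ku unfolding c'_def by auto
    have "le c c'" using u(2) Ku CS_sel[OF c(1)] unfolding le_iff v_def c'_def by auto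
    moreover have "E i t c'" unfolding E_def
    proof (rule bexI[OF _ u(1)], intro conjI)
      show "L u = inter (L c') (K u)" using CS_sel[OF u(1)] unfolding c'_def by (auto simp: set_eq_iff[of "L u"])
      show "R t = inter (R u) (K t)" using u(2) Ku CS_sel[OF t(1)] unfolding le_iff v_def
        by (auto simp: set_eq_iff[of "R t"])
    qed (use u Ku in \<open>auto simp: c'_def\<close>)
    ultimately show ?thesis using c' by blast
  qed
  have Pdense: "dense_fam (mkfam P) p" unfolding dense_fam_def pair_in_mkfam[OF Pd]
  proof (intro ballI impI)
    fix n c assume n: "n \<in> Nat" and c: "c \<in> elts CS" "le p c"
    show "\<exists>c'\<in>elts CS. le c c' \<and> n \<in> Nat \<and> c' \<in> elts CS \<and> P n c'"
    proof (cases "\<exists>i\<in>Nat. \<exists>t\<in>elts CS. npair i (ccode t) = n \<and> le p t")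
      case True
      then obtain i t where it: "i \<in> Nat" "t \<in> elts CS" "npair i (ccode t) = n" "le p t" by blast
      obtain c' where c': "c' \<in> elts CS" "le c c'" "E i t c'" using Edense[OF it(1,2,4) c] by blast
      have "P n c'" unfolding P_def
      proof (intro ballI impI)
        fix i' t' assume *: "i' \<in> Nat" "t' \<in> elts CS" "npair i' (ccode t') = n" "le p t'"
        have "i' = i \<and> ccode t' = ccode t"
          using npair_inj[OF *(1) ccode_Nat[OF *(2)] it(1) ccode_Nat[OF it(2)]] *(3) it(3) by simp
        then have "i' = i" "t' = t" using inj_onD[OF ccode_inj _ *(2) it(2)] by auto
        then show "E i' t' c'" using c'(3) by simp
      qed
      then show ?thesis using c' n by blast
    next
      case False
      then have "P n c" unfolding P_def by blast
      then show ?thesis using c n le_refl by blast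
    qed
  qed
  obtain x y where x: "elts x \<subseteq> Nat" and onp: "on p x y" and gen: "generic (mkfam P) x y"
    using D(1) Pdense by (rule generic_exists) blast
  have meet: "\<exists>u\<in>elts CS. pair i u \<in> elts D \<and> elts (L u) = elts x \<inter> elts (K u) \<and>
     elts (K t) \<subseteq> elts (K u) \<and> elts (R t) = elts (R u) \<inter> elts (K t)"
    if i: "i \<in> Nat" and t: "t \<in> elts CS" "le p t" for i t
  proof -
    have "npair i (ccode t) \<in> Nat" using npair_rec(3)[OF ccode_Nat[OF t(1)] i] .
    then obtain k where "P (npair i (ccode t)) (rst x y k)"
      using gen unfolding generic_def pair_in_mkfam[OF Pd] by blast
    then have "E i t (rst x y k)" using i t unfolding P_def by blast
    then obtain u where u: "u \<in> elts CS" "pair i u \<in> elts D" "elts (K u) \<subseteq> elts k" "L u = inter (inter x k) (K u)"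
      "elts (K t) \<subseteq> elts (K u)" "R t = inter (R u) (K t)" unfolding E_def by auto
    have "elts (L u) = elts x \<inter> elts (K u)" using u(3,4) by auto
    moreover have "elts (R t) = elts (R u) \<inter> elts (K t)" using u(6) by simp
    ultimately show ?thesis using u by blast
  qed
  \<comment> \<open>The section at x of the i-th dense set, which looks only at the right part of
    c.\<close>
  define P' where "P' i c \<longleftrightarrow> (\<exists>u\<in>elts CS. pair i u \<in> elts D \<and> elts (K u) \<subseteq> elts (K c) \<and> L u = inter x (K u) \<and>
     R u = inter (R c) (K u))" for i c
  \<comment> \<open>The ignored coordinate repeats the right part, which makes the condition
    invariant under \<open>swp\<close>; \<open>rank_descent\<close> relies on this shape.\<close>
  have "comeager (\<lambda>_ y. A x y) (trip (K p) (R p) (R p))"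
  proof (rule comeagerI[where P = P'])
    show "dfn (\<lambda>e. P' (e 0) (e 1))" unfolding P'_def by (intro dfn_intros)
    show "trip (K p) (R p) (R p) \<in> elts CS" using CS_sel[OF D(1)] by simp
    show "P' n c'" if cc: "n \<in> Nat" "c \<in> elts CS" "c' \<in> elts CS" "le c c'" "P' n c" for n c c'
    proof -
      obtain u where u: "u \<in> elts CS" "pair n u \<in> elts D" "elts (K u) \<subseteq> elts (K c)" "L u = inter x (K u)"
        "R u = inter (R c) (K u)" using cc(5) unfolding P'_def by blast
      have "R u = inter (R c') (K u)" unfolding u(5) set_eq_iff[of "inter _ _"]
        using cc(4) u(3) unfolding le_iff by auto
      then show ?thesis unfolding P'_def using u cc(4) unfolding le_iff by blast
    qed
    show "\<exists>c'\<in>elts CS. le c c' \<and> P' n c'" if nc: "n \<in> Nat" "c \<in> elts CS" "le (trip (K p) (R p) (R p)) c" for n c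
    proof -
      note sel = CS_sel[OF nc(2)]
      \<comment> \<open>The left part of p is borrowed to turn the right part of c into an extension
        of p, so that \<open>meet\<close> applies.\<close>
      define t where "t = trip (K c) (L p) (R c)"
      have Kp: "elts (K p) \<subseteq> elts (K c)" using nc(3) unfolding le_iff by simp
      have t: "t \<in> elts CS" "le p t"
        using CS_sel[OF D(1)] sel Kp nc(3) unfolding t_def le_iff by auto
      obtain u where u: "u \<in> elts CS" "pair n u \<in> elts D" "elts (L u) = elts x \<inter> elts (K u)"
        "elts (K t) \<subseteq> elts (K u)" "elts (R t) = elts (R u) \<inter> elts (K t)" using meet[OF nc(1) t] by blast
      have Kc: "elts (K c) \<subseteq> elts (K u)" and Rc: "elts (R c) = elts (R u) \<inter> elts (K c)"
        using u(4,5) unfolding t_def by auto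
      define c' where "c' = trip (K u) (L c) (R u)"
      have "c' \<in> elts CS" using CS_sel[OF u(1)] sel Kc unfolding c'_def by auto
      moreover have "le c c'" using sel Kc Rc unfolding le_iff c'_def by auto
      moreover have "P' n c'" unfolding P'_def
      proof (rule bexI[OF _ u(1)], intro conjI)
        show "L u = inter x (K u)" using u(3) by (simp add: set_eq_iff[of "L u"])
        show "R u = inter (R c') (K u)" using CS_sel[OF u(1)] by (auto simp: set_eq_iff[of "R u"] c'_def)
      qed (use u in \<open>auto simp: c'_def\<close>)
      ultimately show ?thesis by blast
    qed
    show "A x z" if z: "elts z \<subseteq> Nat" "on (trip (K p) (R p) (R p)) w z"
      "\<And>n. n \<in> Nat \<Longrightarrow> \<exists>k\<in>Nat. P' n (rst w z k)" for w z
    proof (rule D(4)[OF x z(1)])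
      have "R p = inter z (K p)" using z(2) unfolding on_def trip_sel by blast
      then show "on p x z" using onp unfolding on_def by blast
      show "generic D x z" unfolding generic_def
      proof
        fix n assume "n \<in> Nat"
        then obtain k u where u: "u \<in> elts CS" "pair n u \<in> elts D" "elts (K u) \<subseteq> elts k" "L u = inter x (K u)"
          "R u = inter (inter z k) (K u)" using z(3) unfolding P'_def by fastforce
        have "R u = inter z (K u)" unfolding u(5) set_eq_iff[of "inter _ _"] using u(3) by auto
        then have "u = rst x z (K u)" using on_eq_rst[OF u(1)] u(4) unfolding on_def by blast
        then show "\<exists>k\<in>Nat. pair n (rst x z k) \<in> elts D" using u(2) CS_sel(1)[OF u(1)] by metis
      qed
    qed
  qed
  then show thesis using that x by blast
qed

text \<open>Each point is nowhere dense, and \<iota> arranges the dense open sets that avoid the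
  points of S into one family. So the complement of S is comeager too, and the two comeager sets
  would have a common point.\<close>

lemma not_comeager_countable:
  assumes S: "dfn (\<lambda>e. S (e 0))" and \<iota>: "dterm (\<lambda>e. \<iota> (e 0))"
    and \<iota>_Nat: "\<And>y. elts y \<subseteq> Nat \<Longrightarrow> S y \<Longrightarrow> \<iota> y \<in> Nat"
    and inj: "\<And>y z. elts y \<subseteq> Nat \<Longrightarrow> elts z \<subseteq> Nat \<Longrightarrow> S y \<Longrightarrow> S z \<Longrightarrow> \<iota> y = \<iota> z \<Longrightarrow> y = z"
  shows "\<not> comeager (\<lambda>_ y. S y) p"
proof
  assume com: "comeager (\<lambda>_ y. S y) p"
  have p: "p \<in> elts CS" using com unfolding comeager_def by blast
  have S': "dterm t \<Longrightarrow> dfn (\<lambda>e. S (t e))" for t using dfn_lift1[of S] S by blast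
  have \<iota>': "dterm t \<Longrightarrow> dterm (\<lambda>e. \<iota> (t e))" for t using dterm_lift1[of \<iota>] \<iota> by blast
  define P where "P n c \<longleftrightarrow> (\<forall>y. elts y \<subseteq> Nat \<longrightarrow> S y \<longrightarrow> \<iota> y = n \<longrightarrow> R c \<noteq> inter y (K c))" for n c
  have "comeager (\<lambda>_ y. \<not> S y) p"
  proof (rule comeagerI[where P = P])
    show "dfn (\<lambda>e. P (e 0) (e 1))" unfolding P_def by (intro dfn_intros S' \<iota>')
    show "p \<in> elts CS" by fact
    show "P n c'" if "n \<in> Nat" "c \<in> elts CS" "c' \<in> elts CS" "le c c'" "P n c" for n c c'
      unfolding P_def
    proof (intro allI impI notI)
      fix y assume y: "elts y \<subseteq> Nat" "S y" "\<iota> y = n" "R c' = inter y (K c')"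
      then have "R c = inter y (K c)" using that(4) unfolding le_iff set_eq_iff[of "R c"] by auto
      then show False using that(5) y unfolding P_def by blast
    qed
    show "\<exists>c'\<in>elts CS. le c c' \<and> P n c'" if nc: "n \<in> Nat" "c \<in> elts CS" "le p c" for n c
    proof (cases "\<exists>y. elts y \<subseteq> Nat \<and> S y \<and> \<iota> y = n")
      case False
      then have "P n c" unfolding P_def by blast
      then show ?thesis using nc le_refl by blast
    next
      case True
      then obtain y where y: "elts y \<subseteq> Nat" "S y" "\<iota> y = n" by blast
      note sel = CS_sel[OF nc(2)]
      \<comment> \<open>One more bit, at position \<open>K c\<close>, opposite to that of y.\<close>
      define r where "r = (if K c \<in> elts y then R c else union (R c) (upair (K c) (K c)))"
      have irr: "K c \<notin> elts (R c)" "K c \<notin> elts (L c)" using sel in_irrefl by blast+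
      define c' where "c' = trip (succ (K c)) (L c) r"
      have "c' \<in> elts CS" using sel unfolding c'_def r_def by auto
      moreover have "le c c'" using sel in_irrefl[of "K c"] irr unfolding le_iff c'_def r_def by auto
      moreover have "r \<noteq> inter y (succ (K c))" using irr unfolding r_def set_eq_iff[of _ "inter _ _"] by auto
      then have "P n c'" unfolding P_def c'_def using inj y by auto
      ultimately show ?thesis by blast
    qed
    show "\<not> S y" if z: "elts y \<subseteq> Nat" "\<And>n. n \<in> Nat \<Longrightarrow> \<exists>k\<in>Nat. P n (rst x y k)" for x y
    proof
      assume "S y"
      then obtain k where "P (\<iota> y) (rst x y k)" using z \<iota>_Nat by blast
      then show False unfolding P_def using z(1) \<open>S y\<close> by auto
    qed
  qed
  from comeager_conj[OF com this] show False by (rule comeager_exists) blast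
qed

subsection \<open>The Banach--Mazur game\<close>

definition top :: 'v where "top = trip empty empty empty"

lemma top_CS: "top \<in> elts CS" unfolding top_def by simp

lemma top_le: "c \<in> elts CS \<Longrightarrow> le top c" unfolding top_def le_iff by simp

text \<open>Moves have to lengthen the condition, so that the conditions of a play shrink to a
  single point.\<close>

definition sle :: "'v \<Rightarrow> 'v \<Rightarrow> bool" where "sle c d \<longleftrightarrow> le c d \<and> K c \<in> elts (K d)"

lemma dfn_sle [dfn_intros]: "dterm t \<Longrightarrow> dterm u \<Longrightarrow> dfn (\<lambda>e. sle (t e) (u e))"
  unfolding sle_def by (intro dfn_intros)

definition grow :: "'v \<Rightarrow> 'v" where "grow c = trip (succ (K c)) (L c) (R c)"

lemma grow: "c \<in> elts CS \<Longrightarrow> grow c \<in> elts CS \<and> sle c (grow c)"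
  using CS_sel[of c] unfolding grow_def sle_def le_iff by auto

lemma dterm_grow [dfn_intros]: "dterm t \<Longrightarrow> dterm (\<lambda>e. grow (t e))"
  unfolding grow_def by (intro dfn_intros)

text \<open>A move that does not code a proper extension of the current condition is read as a default
  extension, so that every sequence of natural numbers is a legal play.\<close>

definition step :: "'v \<Rightarrow> 'v \<Rightarrow> 'v" where
  "step c n = (if \<exists>d\<in>elts CS. sle c d \<and> ccode d = n then the1 (\<lambda>d. d \<in> elts CS \<and> sle c d \<and> ccode d = n) else grow c)"

lemma dterm_step [dfn_intros]: "dterm t \<Longrightarrow> dterm u \<Longrightarrow> dterm (\<lambda>e. step (t e) (u e))"
  by (rule dterm_lift2[where f = step]) (unfold step_def, intro dfn_intros)

lemma step_ccode:
  assumes "d \<in> elts CS" "sle c d"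
  shows "step c (ccode d) = d"
proof -
  have "the1 (\<lambda>d'. d' \<in> elts CS \<and> sle c d' \<and> ccode d' = ccode d) = d"
    by (rule the1_eqI) (use assms inj_onD[OF ccode_inj] in auto)
  then show ?thesis unfolding step_def using assms by auto
qed

lemma step_CS:
  assumes "c \<in> elts CS"
  shows "step c n \<in> elts CS \<and> sle c (step c n)"
proof (cases "\<exists>d\<in>elts CS. sle c d \<and> ccode d = n")
  case True
  then obtain d where "d \<in> elts CS" "sle c d" "ccode d = n" by blast
  then show ?thesis using step_ccode[of d c] by simp
next
  case False
  then have "step c n = grow c" unfolding step_def by (rule if_not_P)
  then show ?thesis using grow[OF assms] by simp
qed

definition cnd :: "'v \<Rightarrow> 'v \<Rightarrow> 'v" where "cnd f n = recN top (\<lambda>m c. step c (ap f m)) n"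

lemma dterm_cnd [dfn_intros]: "dterm t \<Longrightarrow> dterm u \<Longrightarrow> dterm (\<lambda>e. cnd (t e) (u e))"
  by (rule dterm_lift2[where f = cnd]) (unfold cnd_def, intro dfn_intros)

lemma cnd_rec: "cnd f empty = top" "n \<in> Nat \<Longrightarrow> cnd f (succ n) = step (cnd f n) (ap f n)" "n \<in> Nat \<Longrightarrow> cnd f n \<in> elts CS"
proof -
  have d: "dterm (\<lambda>e. step (e 0) (ap f (e 1)))" by (intro dfn_intros)
  note * = recN_empty[of "\<lambda>m c. step c (ap f m)" top CS] recN_succ[of "\<lambda>m c. step c (ap f m)" top CS]
    recN_in[of "\<lambda>m c. step c (ap f m)" top CS]
  show "cnd f empty = top" "n \<in> Nat \<Longrightarrow> cnd f (succ n) = step (cnd f n) (ap f n)" "n \<in> Nat \<Longrightarrow> cnd f n \<in> elts CS"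
    unfolding cnd_def using * d top_CS step_CS by simp_all
qed

lemma cnd_sle: "n \<in> Nat \<Longrightarrow> sle (cnd f n) (cnd f (succ n))"
  using step_CS cnd_rec by simp

lemma cnd_le: "n \<in> Nat \<Longrightarrow> m \<in> Nat \<Longrightarrow> elts n \<subseteq> elts m \<Longrightarrow> le (cnd f n) (cnd f m)"
proof (rule chain_le[where F = "cnd f"])
  show "dterm (\<lambda>e. cnd f (e 0))" by (intro dfn_intros)
  show "n \<in> Nat \<Longrightarrow> cnd f n \<in> elts CS" "n \<in> Nat \<Longrightarrow> le (cnd f n) (cnd f (succ n))" for n
    using cnd_rec(3) cnd_sle unfolding sle_def by blast+
qed

lemma cnd_cong:
  assumes n: "n \<in> Nat" and eq: "\<And>m. m \<in> elts n \<Longrightarrow> ap f m = ap g m"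
  shows "cnd f n = cnd g n"
proof -
  have "(\<forall>m\<in>elts n. ap f m = ap g m) \<longrightarrow> cnd f n = cnd g n"
  proof (rule nat_induct_dfn[OF n])
    show "dfn (\<lambda>e. (\<forall>m\<in>elts (e 0). ap f m = ap g m) \<longrightarrow> cnd f (e 0) = cnd g (e 0))" by (intro dfn_intros)
  qed (auto simp: cnd_rec)
  then show ?thesis using eq by blast
qed

lemma subset_K_cnd:
  assumes "n \<in> Nat"
  shows "elts n \<subseteq> elts (K (cnd f n))"
proof (rule nat_induct_dfn[OF assms])
  show "dfn (\<lambda>e. elts (e 0) \<subseteq> elts (K (cnd f (e 0))))" by (intro dfn_intros)
  fix n assume n: "n \<in> Nat" "elts n \<subseteq> elts (K (cnd f n))"
  have k: "K (cnd f n) \<in> Nat" "K (cnd f (succ n)) \<in> Nat" using CS_sel(1) cnd_rec(3) n(1) succ_Nat by blast+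
  have "n = K (cnd f n) \<or> n \<in> elts (K (cnd f n))" using nat_subset_iff[OF n(1) k(1)] n(2) by blast
  then have "n \<in> elts (K (cnd f (succ n)))"
    using cnd_sle[OF n(1), of f] nat_mem_trans[OF k(2)] unfolding sle_def by auto
  then show "elts (succ n) \<subseteq> elts (K (cnd f (succ n)))" using succ_subset_iff n(1) k(2) by blast
qed simp

lemma cnd_on: "n \<in> Nat \<Longrightarrow> on (cnd f n) (UL (cnd f)) (UR (cnd f))"
proof (rule chain_limit[where F = "cnd f"])
  show "dterm (\<lambda>e. cnd f (e 0))" by (intro dfn_intros)
  show "n \<in> Nat \<Longrightarrow> cnd f n \<in> elts CS" "n \<in> Nat \<Longrightarrow> le (cnd f n) (cnd f (succ n))" for n
    using cnd_rec(3) cnd_sle unfolding sle_def by blast+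
qed

text \<open>After n moves at least n bits of each coordinate are decided, so the boxes of a play
  have only one common point.\<close>

lemma cnd_limit_unique:
  assumes x: "elts x \<subseteq> Nat" "elts y \<subseteq> Nat" and on: "\<And>n. n \<in> Nat \<Longrightarrow> on (cnd f n) x y"
  shows "UL (cnd f) = x" "UR (cnd f) = y"
proof -
  have d: "dterm (\<lambda>e. cnd f (e 0))" by (intro dfn_intros)
  have sub: "elts (UL (cnd f)) \<subseteq> Nat" "elts (UR (cnd f)) \<subseteq> Nat" using elts_UL[OF d] elts_UR[OF d] by auto
  have "(m \<in> elts (UL (cnd f)) \<longleftrightarrow> m \<in> elts x) \<and> (m \<in> elts (UR (cnd f)) \<longleftrightarrow> m \<in> elts y)" if m: "m \<in> Nat" for m
  proof -
    have "m \<in> elts (K (cnd f (succ m)))" using subset_K_cnd[of "succ m" f] m by auto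
    then show ?thesis using on[of "succ m"] cnd_on[of "succ m" f] m unfolding on_iff by auto
  qed
  then show "UL (cnd f) = x" "UR (cnd f) = y" using sub x by (auto intro!: set_ext)
qed

subsection \<open>Winning strategies yield dense families\<close>

definition ext1 :: "'v \<Rightarrow> 'v \<Rightarrow> 'v \<Rightarrow> 'v" where "ext1 h n t = union h (upair (pair n t) (pair n t))"

lemma dterm_ext1 [dfn_intros]: "dterm t \<Longrightarrow> dterm u \<Longrightarrow> dterm v \<Longrightarrow> dterm (\<lambda>e. ext1 (t e) (u e) (v e))"
  unfolding ext1_def by (intro dfn_intros)

lemma ext1:
  assumes h: "func h (elts n) Nat" and n: "n \<in> Nat" and t: "t \<in> Nat"
  shows "func (ext1 h n t) (elts (succ n)) Nat" "ap (ext1 h n t) n = t"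
    "m \<in> elts n \<Longrightarrow> ap (ext1 h n t) m = ap h m"
proof -
  have nn: "pair n y \<notin> elts h" for y using h in_irrefl[of n] unfolding func_def by fastforce
  have e: "pair x y \<in> elts (ext1 h n t) \<longleftrightarrow> (if x = n then y = t else pair x y \<in> elts h)" for x y
    unfolding ext1_def using nn by auto
  show "func (ext1 h n t) (elts (succ n)) Nat" unfolding func_def
  proof (intro conjI ballI)
    fix p assume "p \<in> elts (ext1 h n t)"
    then have "p \<in> elts h \<or> p = pair n t" unfolding ext1_def by auto
    then show "\<exists>x\<in>elts (succ n). \<exists>y\<in>Nat. p = pair x y" using h t unfolding func_def elts_succ by blast
  next
    fix x assume x: "x \<in> elts (succ n)"
    show "\<exists>!y. pair x y \<in> elts (ext1 h n t)"
    proof (cases "x = n")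
      case False
      then have "\<exists>!y. pair x y \<in> elts h" using x h unfolding func_def by simp
      then show ?thesis using False by (simp add: e)
    qed (simp add: e)
  qed
  show "ap (ext1 h n t) n = t" unfolding ap_def by (rule the1_eqI) (simp_all add: e)
  show "ap (ext1 h n t) m = ap h m" if "m \<in> elts n"
    using that in_irrefl[of n] unfolding ap_def e by (metis (no_types, lifting))
qed

definition ST :: 'v where "ST = sep (prod om (Pw (prod om om))) (\<lambda>s. func (sn s) (elts (fs s)) (elts om))"

lemma pair_ST: "pair n h \<in> elts ST \<longleftrightarrow> n \<in> Nat \<and> func h (elts n) Nat"
proof -
  have "elts ST = {s \<in> elts (prod om (Pw (prod om om))). func (sn s) (elts (fs s)) (elts om)}"
    unfolding ST_def by (rule elts_sep) (intro dfn_intros)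
  moreover have "elts h \<subseteq> elts (prod om om)" if nh: "n \<in> Nat" "func h (elts n) Nat"
  proof
    fix p assume "p \<in> elts h"
    then obtain x y where "x \<in> elts n" "y \<in> Nat" "p = pair x y" using nh(2) unfolding func_def by blast
    then show "p \<in> elts (prod om om)" using Nat_trans[OF nh(1)] by simp
  qed
  ultimately show ?thesis by auto
qed

lemma ST_cases:
  assumes "s \<in> elts ST"
  obtains n h where "s = pair n h" "n \<in> Nat" "func h (elts n) Nat"
proof -
  have "elts ST = {s \<in> elts (prod om (Pw (prod om om))). func (sn s) (elts (fs s)) (elts om)}"
    unfolding ST_def by (rule elts_sep) (intro dfn_intros)
  then have "s \<in> elts (prod om (Pw (prod om om)))" using assms by blast
  then obtain n h where "s = pair n h" unfolding elts_prod by blast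
  then show thesis using that assms pair_ST by blast
qed

text \<open>The default 0 beyond the length makes the coded map total on the natural numbers, as the
  lemmas on \<open>seqcode\<close> require.\<close>

definition scode :: "'v \<Rightarrow> 'v" where
  "scode s = npair (fs s) (seqcode (\<lambda>m. if m \<in> elts (fs s) then ap (sn s) m else empty) (fs s))"

lemma dterm_scode: "dterm (\<lambda>e. scode (e 0))"
  unfolding scode_def by (intro dfn_intros)

lemma scode_Nat: "s \<in> elts ST \<Longrightarrow> scode s \<in> Nat"
  and scode_inj: "inj_on scode (elts ST)"
proof -
  define F where "F s m = (if m \<in> elts (fs s) then ap (sn s) m else empty)" for s m
  have Fd: "dterm (\<lambda>e. F s (e 0))" for s unfolding F_def by (intro dfn_intros)
  have FN: "F s m \<in> Nat" if "s \<in> elts ST" for s m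
    using that by (rule ST_cases) (auto simp: F_def dest: func_ap_in)
  have sc: "scode s = npair (fs s) (seqcode (F s) (fs s))" for s unfolding scode_def F_def ..
  have N: "fs s \<in> Nat" "seqcode (F s) (fs s) \<in> Nat" if s: "s \<in> elts ST" for s
  proof -
    show f: "fs s \<in> Nat" using s by (rule ST_cases) simp
    show "seqcode (F s) (fs s) \<in> Nat" using seqcode_rec(3)[OF Fd FN[OF s] f] .
  qed
  show "s \<in> elts ST \<Longrightarrow> scode s \<in> Nat" unfolding sc using N npair_rec(3) by blast
  show "inj_on scode (elts ST)"
  proof (rule inj_onI)
    fix s s' assume s: "s \<in> elts ST" and s': "s' \<in> elts ST" and eq: "scode s = scode s'"
    have "fs s = fs s' \<and> seqcode (F s) (fs s) = seqcode (F s') (fs s')"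
      using npair_inj[OF N[OF s] N[OF s'] eq[unfolded sc]] .
    then have fs: "fs s = fs s'" and seq: "seqcode (F s) (fs s) = seqcode (F s') (fs s)" by auto
    obtain n h where nh: "s = pair n h" "n \<in> Nat" "func h (elts n) Nat" using s by (rule ST_cases)
    obtain h' where h': "s' = pair n h'" "func h' (elts n) Nat" using s' by (rule ST_cases) (use fs nh in auto)
    have "ap h m = ap h' m" if m: "m \<in> elts n" for m
      using seqcode_inj[OF Fd FN[OF s] Fd FN[OF s'] N(1)[OF s] seq, of m] m nh h' by (simp add: F_def)
    then have "h = h'" by (rule func_ext[OF nh(3) h'(2)])
    then show "s = s'" using nh h' by simp
  qed
qed

text \<open>\<open>W\<close> tells the positions where the strategy is to move. A point that meets the dense set of every
  position is the outcome of a play according to the strategy.\<close>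

lemma strategy_comeager:
  assumes \<sigma>: "strategy om \<sigma>"
    and W: "dfn (\<lambda>e. W (e 0))" "\<And>n. n \<in> Nat \<Longrightarrow> W (succ n) \<longleftrightarrow> \<not> W n"
    and win: "\<And>f. f \<in> Reals \<Longrightarrow> (\<And>n. n \<in> Nat \<Longrightarrow> W n \<Longrightarrow> ap f n = ap \<sigma> (restrict f n)) \<Longrightarrow> Z (UL (cnd f)) (UR (cnd f))"
    and n0: "n0 \<in> Nat" "\<not> W n0" and h0: "func h0 (elts n0) Nat"
    and h0\<sigma>: "\<And>k. k \<in> elts n0 \<Longrightarrow> W k \<Longrightarrow> ap h0 k = ap \<sigma> (restrict h0 k)"
  shows "comeager Z (cnd h0 n0)"
proof -
  have W': "dterm t \<Longrightarrow> dfn (\<lambda>e. W (t e))" for t using dfn_lift1[of W] W(1) by blast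
  have \<sigma>N: "ap \<sigma> h \<in> Nat" if "n \<in> Nat" "func h (elts n) Nat" for n h
  proof -
    have "h \<in> (\<Union>n\<in>Nat. Tup om n)" using that unfolding Tup_def Fun_def by auto
    from func_ap_in[OF \<sigma>[unfolded strategy_def] this] show ?thesis by simp
  qed
  \<comment> \<open>Plays are cut into rounds: a correct position s with the opponent to move
    (\<open>inv\<close>), the opponent's move t (\<open>rep\<close>), the answer of \<sigma>
    (\<open>nx\<close>). The condition reached at s is \<open>cs s\<close>.\<close>
  define inv where "inv s \<longleftrightarrow> \<not> W (fs s) \<and> (\<forall>k\<in>elts (fs s). W k \<longrightarrow> ap (sn s) k = ap \<sigma> (restrict (sn s) k))" for s
  define rep where "rep s t = ext1 (sn s) (fs s) t" for s t
  define nx where "nx s t = pair (succ (succ (fs s))) (ext1 (rep s t) (succ (fs s)) (ap \<sigma> (rep s t)))" for s t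
  define cs where "cs s = cnd (sn s) (fs s)" for s
  define agr where "agr s s' \<longleftrightarrow> elts (fs s) \<subseteq> elts (fs s') \<and> (\<forall>i\<in>elts (fs s). ap (sn s') i = ap (sn s) i)" for s s'
  have inv_d: "dterm t \<Longrightarrow> dfn (\<lambda>e. inv (t e))" for t
    by (rule dfn_lift1[where P = inv]) (unfold inv_def, intro dfn_intros W')
  have nx_d: "dterm t \<Longrightarrow> dterm u \<Longrightarrow> dterm (\<lambda>e. nx (t e) (u e))" for t u
    unfolding nx_def rep_def by (intro dfn_intros)
  have cs_d: "dterm t \<Longrightarrow> dterm (\<lambda>e. cs (t e))" for t unfolding cs_def by (intro dfn_intros)
  have rep: "func (rep s t) (elts (succ (fs s))) Nat" "ap (rep s t) (fs s) = t"
    "\<And>m. m \<in> elts (fs s) \<Longrightarrow> ap (rep s t) m = ap (sn s) m" if s: "s \<in> elts ST" "t \<in> Nat" for s t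
    using s(1) by (rule ST_cases, use s(2) ext1 in \<open>simp add: rep_def\<close>)+
  have nxh: "func (sn (nx s t)) (elts (fs (nx s t))) Nat" "ap (sn (nx s t)) (succ (fs s)) = ap \<sigma> (rep s t)"
    "\<And>m. m \<in> elts (succ (fs s)) \<Longrightarrow> ap (sn (nx s t)) m = ap (rep s t) m"
    "fs (nx s t) = succ (succ (fs s))" "fs s \<in> Nat" if s: "s \<in> elts ST" "t \<in> Nat" for s t
  proof -
    show f: "fs s \<in> Nat" using s(1) by (rule ST_cases) simp
    note N = \<sigma>N[OF succ_Nat[OF f] rep(1)[OF s]]
    note * = ext1[OF rep(1)[OF s] succ_Nat[OF f] N]
    show "func (sn (nx s t)) (elts (fs (nx s t))) Nat" "ap (sn (nx s t)) (succ (fs s)) = ap \<sigma> (rep s t)"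
      "fs (nx s t) = succ (succ (fs s))"
      using *(1,2) unfolding nx_def by simp_all
    show "ap (sn (nx s t)) m = ap (rep s t) m" if "m \<in> elts (succ (fs s))" for m
      using *(3)[OF that] unfolding nx_def by simp
  qed
  have nx_ST: "nx s t \<in> elts ST" if s: "s \<in> elts ST" "t \<in> Nat" for s t
    using nxh(1,4,5)[OF s] unfolding nx_def pair_ST by simp
  have agr_nx: "agr s (nx s t)" if s: "s \<in> elts ST" "t \<in> Nat" for s t
    unfolding agr_def using nxh(3,4)[OF s] rep(3)[OF s] by auto
  have fun_s: "func (sn s) (elts (fs s)) Nat" "fs s \<in> Nat" if "s \<in> elts ST" for s
    using that by (rule ST_cases, simp)+
  have restr: "restrict h k = restrict h' k"
    if "func h (elts n) Nat" "func h' (elts n') Nat" "elts k \<subseteq> elts n" "elts k \<subseteq> elts n'"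
      "\<And>i. i \<in> elts k \<Longrightarrow> ap h i = ap h' i" for h h' n n' k
    by (rule func_ext[OF func_restrict[OF that(1,3)] func_restrict[OF that(2,4)]]) (use that(5) in \<open>simp add: ap_restrict\<close>)
  have inv_nx: "inv (nx s t)" if s: "s \<in> elts ST" "t \<in> Nat" and i: "inv s" for s t
  proof -
    note f = nxh(5)[OF s]
    have "ap (sn (nx s t)) k = ap \<sigma> (restrict (sn (nx s t)) k)" if k: "k \<in> elts (fs (nx s t))" "W k" for k
    proof -
      have nW: "\<not> W (fs s)" using i unfolding inv_def by blast
      have "k \<noteq> fs s" using k(2) nW by blast
      then consider "k = succ (fs s)" | "k \<in> elts (fs s)" using k(1) nxh(4)[OF s] by auto
      then show ?thesis
      proof cases
        case 1
        have "restrict (sn (nx s t)) (succ (fs s)) = rep s t"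
          by (rule func_ext[OF func_restrict[OF nxh(1)[OF s]] rep(1)[OF s]])
            (use nxh(4)[OF s] nxh(3)[OF s] in \<open>auto simp: ap_restrict\<close>)
        then show ?thesis using nxh(2)[OF s] 1 by simp
      next
        case 2
        have sub: "elts k \<subseteq> elts (fs s)" using nat_mem_subset[OF f 2] .
        have e: "ap (sn (nx s t)) m = ap (sn s) m" if "m \<in> elts (fs s)" for m
          using agr_nx[OF s] that unfolding agr_def by blast
        have "restrict (sn (nx s t)) k = restrict (sn s) k"
          by (rule restr[OF nxh(1)[OF s] fun_s(1)[OF s(1)] _ sub]) (use sub nxh(4)[OF s] e in auto)
        then show ?thesis using i 2 k(2) e[OF 2] unfolding inv_def by auto
      qed
    qed
    moreover have "\<not> W (fs (nx s t))" using nxh(4)[OF s] W(2) f i unfolding inv_def by simp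
    ultimately show ?thesis unfolding inv_def by blast
  qed
  have cs_CS: "cs s \<in> elts CS" if "s \<in> elts ST" for s unfolding cs_def using cnd_rec(3) fun_s(2)[OF that] .
  have cs_nx: "cs (nx s t) = step (step (cs s) t) (ap \<sigma> (rep s t))" if s: "s \<in> elts ST" "t \<in> Nat" for s t
  proof -
    let ?h = "sn (nx s t)"
    note f = nxh(5)[OF s]
    have "cnd ?h (fs s) = cs s" unfolding cs_def
      by (rule cnd_cong[OF f]) (use agr_nx[OF s] in \<open>auto simp: agr_def\<close>)
    moreover have "ap ?h (fs s) = t" using nxh(3)[OF s, of "fs s"] rep(2)[OF s] by simp
    ultimately show ?thesis unfolding cs_def[of "nx s t"] nxh(4)[OF s] using cnd_rec(2) f nxh(2)[OF s] by simp
  qed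
  \<comment> \<open>The dense set of a position s: either some round from s leads to a condition
    that c extends, or c is incompatible with \<open>cs s\<close>. The second alternative is what
    secures density at conditions that already contradict s.\<close>
  define P where "P j c \<longleftrightarrow> (\<forall>s\<in>elts ST. scode s = j \<longrightarrow> inv s \<longrightarrow>
     (\<exists>t\<in>Nat. le (cs (nx s t)) c) \<or> \<not> (\<exists>c'\<in>elts CS. le c c' \<and> le (cs s) c'))" for j c
  define s0 where "s0 = pair n0 h0"
  have s0: "s0 \<in> elts ST" "inv s0" "cs s0 = cnd h0 n0"
    unfolding s0_def inv_def cs_def pair_ST using n0 h0 h0\<sigma> by simp_all
  have scode_d: "dterm t \<Longrightarrow> dterm (\<lambda>e. scode (t e))" for t using dterm_lift1[of scode] dterm_scode by blast
  have "comeager Z (cs s0)"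
  proof (rule comeagerI[where P = P])
    show "dfn (\<lambda>e. P (e 0) (e 1))" unfolding P_def by (intro dfn_intros inv_d nx_d cs_d scode_d)
    show "cs s0 \<in> elts CS" using cs_CS[OF s0(1)] .
    show "P n c'" if c: "n \<in> Nat" "c \<in> elts CS" "c' \<in> elts CS" "le c c'" "P n c" for n c c'
      using c(5) le_trans[OF _ c(4)] le_trans[OF c(4)] unfolding P_def by blast
    show "\<exists>c'\<in>elts CS. le c c' \<and> P j c'" if c: "j \<in> Nat" "c \<in> elts CS" for j c
    proof (cases "P j c")
      case True
      then show ?thesis using c le_refl by blast
    next
      case False
      then obtain s c' where s: "s \<in> elts ST" "scode s = j" "inv s" and c': "c' \<in> elts CS" "le c c'" "le (cs s) c'"
        unfolding P_def by blast
      \<comment> \<open>The common extension is lengthened to become a legal move after s; the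
        opponent plays its code.\<close>
      define d where "d = grow c'"
      have d: "d \<in> elts CS" "le c' d" "K c' \<in> elts (K d)" using grow[OF c'(1)] unfolding d_def sle_def by blast+
      have "elts (K (cs s)) \<subseteq> elts (K c')" using c'(3) unfolding le_iff by blast
      then have "K (cs s) \<in> elts (K d)"
        using nat_subset_iff[of "K (cs s)" "K c'"] CS_sel(1) cs_CS[OF s(1)] c'(1) d nat_mem_trans by metis
      then have sd: "sle (cs s) d" unfolding sle_def using le_trans[OF c'(3) d(2)] by blast
      note t = ccode_Nat[OF d(1)]
      have "step (cs s) (ccode d) = d" using step_ccode[OF d(1) sd] .
      then have e: "cs (nx s (ccode d)) \<in> elts CS" "le d (cs (nx s (ccode d)))"
        using cs_nx[OF s(1) t] step_CS[OF d(1)] unfolding sle_def by simp_all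
      have "P j (cs (nx s (ccode d)))" unfolding P_def
      proof (intro ballI impI disjI1)
        fix s' assume "s' \<in> elts ST" "scode s' = j"
        then have "s' = s" using inj_onD[OF scode_inj] s(1,2) by blast
        then show "\<exists>t\<in>Nat. le (cs (nx s' t)) (cs (nx s (ccode d)))" using t le_refl[OF e(1)] by blast
      qed
      then show ?thesis using e le_trans[OF c'(2)] le_trans[OF d(2)] by blast
    qed
    show "Z x y" if xy: "elts x \<subseteq> Nat" "elts y \<subseteq> Nat" "on (cs s0) x y" "\<And>n. n \<in> Nat \<Longrightarrow> \<exists>k\<in>Nat. P n (rst x y k)" for x y
    proof -
      define Q where "Q m s s' \<longleftrightarrow> (inv s \<and> on (cs s) x y \<longrightarrow> (\<exists>t\<in>Nat. s' = nx s t \<and> on (cs s') x y))" for m s s' :: 'v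
      have Qd: "dfn (\<lambda>e. Q (e 0) (e 1) (e 2))" unfolding Q_def by (intro dfn_intros inv_d nx_d cs_d)
      have tot: "\<exists>s'\<in>elts ST. Q m s s'" if s: "s \<in> elts ST" for m s
      proof (cases "inv s \<and> on (cs s) x y")
        case True
        obtain k where k: "k \<in> Nat" "P (scode s) (rst x y k)" using xy(4)[OF scode_Nat[OF s]] by blast
        \<comment> \<open>An initial segment of (x, y) long enough to extend both conditions, which
          rules out the incompatibility alternative of \<open>P\<close>.\<close>
        let ?c = "rst x y (union k (K (cs s)))"
        have u: "union k (K (cs s)) \<in> Nat" using nat_max k(1) CS_sel(1)[OF cs_CS[OF s]] by blast
        have "le (rst x y k) ?c" "le (cs s) ?c"
          by (rule le_on[of _ x y], use True on_rst in auto)+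
        moreover have "?c \<in> elts CS" using u by simp
        ultimately obtain t where t: "t \<in> Nat" "le (cs (nx s t)) (rst x y k)"
          using k(2) s True unfolding P_def by blast
        have "on (cs (nx s t)) x y" using on_le[OF t(2) on_rst] .
        then show ?thesis using nx_ST[OF s t(1)] t(1) unfolding Q_def by blast
      next
        case False
        then show ?thesis using s unfolding Q_def by blast
      qed
      obtain S where S: "func S Nat (elts ST)" "ap S empty = s0" "\<And>n. n \<in> Nat \<Longrightarrow> Q n (ap S n) (ap S (succ n))"
        using dependent_choice[where R = Q, OF dterm_scode scode_Nat scode_inj Qd s0(1) tot] by blast
      have ST: "ap S m \<in> elts ST" if "m \<in> Nat" for m using func_ap_in[OF S(1) that] .
      have io: "inv (ap S m) \<and> on (cs (ap S m)) x y" if m: "m \<in> Nat" for m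
      proof (rule nat_induct_dfn[OF m])
        show "dfn (\<lambda>e. inv (ap S (e 0)) \<and> on (cs (ap S (e 0))) x y)" by (intro dfn_intros inv_d cs_d)
        show "inv (ap S empty) \<and> on (cs (ap S empty)) x y" using S(2) s0 xy(3) by simp
        show "inv (ap S (succ m)) \<and> on (cs (ap S (succ m))) x y" if m: "m \<in> Nat" "inv (ap S m) \<and> on (cs (ap S m)) x y" for m
          using S(3)[OF m(1)] m(2) inv_nx[OF ST[OF m(1)]] unfolding Q_def by auto
      qed
      have nxt: "\<exists>t\<in>Nat. ap S (succ m) = nx (ap S m) t" if "m \<in> Nat" for m
        using S(3)[OF that] io[OF that] unfolding Q_def by blast
      have fsS: "fs (ap S (succ m)) = succ (succ (fs (ap S m)))" if m: "m \<in> Nat" for m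
        using nxt[OF m] nxh(4)[OF ST[OF m]] by auto
      have len: "elts m \<subseteq> elts (fs (ap S m))" if m: "m \<in> Nat" for m
      proof (rule nat_induct_dfn[OF m])
        show "dfn (\<lambda>e. elts (e 0) \<subseteq> elts (fs (ap S (e 0))))" by (intro dfn_intros)
        fix m assume m: "m \<in> Nat" "elts m \<subseteq> elts (fs (ap S m))"
        have "m \<in> elts (fs (ap S m)) \<or> m = fs (ap S m)"
          using nat_subset_iff[OF m(1) fun_s(2)[OF ST[OF m(1)]]] m(2) by blast
        then show "elts (succ m) \<subseteq> elts (fs (ap S (succ m)))" using fsS[OF m(1)] m(2) by auto
      qed simp
      have lenS: "m \<in> elts (fs (ap S (succ m)))" if m: "m \<in> Nat" for m using len[of "succ m"] m by auto
      have agr: "agr (ap S m) (ap S m')" if m: "m \<in> Nat" "m' \<in> Nat" "elts m \<subseteq> elts m'" for m m'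
      proof (rule nat_chain[where Q = agr and F = "ap S", OF _ _ _ _ _ m])
        show "dterm (\<lambda>e. ap S (e 0))" by (intro dfn_intros)
        show "dfn (\<lambda>e. agr (e 0) (e 1))" unfolding agr_def by (intro dfn_intros)
        show "agr (ap S n) (ap S n)" for n unfolding agr_def by blast
        show "agr a c" if "agr a b" "agr b c" for a b c using that unfolding agr_def by auto
        show "agr (ap S n) (ap S (succ n))" if "n \<in> Nat" for n using nxt[OF that] agr_nx[OF ST[OF that]] by auto
      qed
      \<comment> \<open>The play is the union of the positions; move i is read off at stage i+1,
        where the position is longer than i.\<close>
      define g where "g = lam om (\<lambda>i. ap (sn (ap S (succ i))) i)"
      have gd: "dterm (\<lambda>e. ap (sn (ap S (succ (e 0)))) (e 0))" by (intro dfn_intros)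
      have gf: "func g Nat Nat"
        using func_lam[OF gd, of om Nat] func_ap_in[OF fun_s(1)[OF ST] lenS] unfolding g_def by simp
      have ag: "ap g i = ap (sn (ap S m)) i" if m: "m \<in> Nat" and i: "i \<in> elts (fs (ap S m))" for m i
      proof -
        have iN: "i \<in> Nat" using Nat_trans[OF fun_s(2)[OF ST[OF m]] i] .
        have "ap g i = ap (sn (ap S (succ i))) i" using ap_lam[OF gd, of i om] iN unfolding g_def by simp
        moreover have "agr (ap S m) (ap S (succ i)) \<or> agr (ap S (succ i)) (ap S m)"
          using agr m succ_Nat[OF iN] nat_subset_linear by blast
        ultimately show ?thesis using i lenS[OF iN] unfolding agr_def by auto
      qed
      have "Z (UL (cnd g)) (UR (cnd g))"
      proof (rule win)
        show "g \<in> Reals" using gf Reals_iff by simp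
        fix n assume n: "n \<in> Nat" "W n"
        let ?s = "ap S (succ n)"
        have s: "?s \<in> elts ST" using ST n(1) by simp
        have i: "n \<in> elts (fs ?s)" using lenS[OF n(1)] .
        have sub: "elts n \<subseteq> elts (fs ?s)" using nat_mem_subset[OF fun_s(2)[OF s] i] .
        have "ap g n = ap (sn ?s) n" using ag[OF succ_Nat[OF n(1)] i] .
        also have "\<dots> = ap \<sigma> (restrict (sn ?s) n)" using io[OF succ_Nat[OF n(1)]] i n(2) unfolding inv_def by blast
        also have "restrict (sn ?s) n = restrict g n"
        proof (rule restr[OF fun_s(1)[OF s] _ sub])
          show "func g (elts om) Nat" "elts n \<subseteq> elts om" using gf Nat_trans[OF n(1)] by auto
          show "ap (sn ?s) i = ap g i" if "i \<in> elts n" for i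
            using ag[OF succ_Nat[OF n(1)], of i] sub that by auto
        qed
        finally show "ap g n = ap \<sigma> (restrict g n)" .
      qed
      moreover have "on (cnd g n) x y" if n: "n \<in> Nat" for n
      proof (rule on_le[OF cnd_le[OF n fun_s(2)[OF ST[OF n]] len[OF n]]])
        have "cnd g (fs (ap S n)) = cs (ap S n)" unfolding cs_def
          by (rule cnd_cong[OF fun_s(2)[OF ST[OF n]]]) (rule ag[OF n])
        then show "on (cnd g (fs (ap S n))) x y" using io[OF n] by simp
      qed
      ultimately show ?thesis using cnd_limit_unique[OF xy(1,2), of g] by simp
    qed
  qed
  then show ?thesis using s0(3) by simp
qed

text \<open>The payoff is that the limit point of the play lies in A. A winning strategy of the
  second player is followed from the empty position and makes the complement comeager everywhere;
  one of the first player makes A comeager in the box of its opening move.\<close>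

lemma baire_dichotomy:
  assumes AD: ordinal_determinacy and A: "dfn (\<lambda>e. A (e 0) (e 1))"
  shows "comeager (\<lambda>x y. \<not> A x y) top \<or> (\<exists>p. comeager A p)"
proof -
  have A': "dterm t \<Longrightarrow> dterm u \<Longrightarrow> dfn (\<lambda>e. A (t e) (u e))" for t u using dfn_lift2[of A] A by blast
  define B where "B = sep Re (\<lambda>f. A (UL (cnd f)) (UR (cnd f)))"
  have B: "elts B = {f \<in> Reals. A (UL (cnd f)) (UR (cnd f))}"
    unfolding B_def elts_Re[symmetric] by (rule elts_sep) (intro dfn_intros A')
  have R: "Fun Nat (elts om) = Reals" unfolding Reals_def by simp
  have conv: "app f n = app \<sigma> (restrict f n) \<longleftrightarrow> ap f n = ap \<sigma> (restrict f n)"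
    if "strategy om \<sigma>" "f \<in> Reals" "n \<in> Nat" for f \<sigma> n
  proof -
    have f: "func f Nat Nat" using that(2) Reals_iff by simp
    have "elts n \<subseteq> Nat" using Nat_trans[OF that(3)] by blast
    from func_restrict[OF f this] have "restrict f n \<in> (\<Union>n\<in>Nat. Tup om n)"
      using that(3) unfolding Tup_def Fun_def by auto
    from func_app[OF that(1)[unfolded strategy_def] this] show ?thesis using func_app[OF f that(3)] by simp
  qed
  have "determined om (elts B)" by (rule game_determined[OF AD]) (use B in blast)
  then consider \<sigma> where "strategy om \<sigma>" "\<forall>f\<in>Reals. (\<forall>n\<in>Nat \<inter> Even. app f n = app \<sigma> (restrict f n)) \<longrightarrow> f \<in> elts B"
    | \<sigma> where "strategy om \<sigma>" "\<forall>f\<in>Reals. (\<forall>n\<in>Nat - Even. app f n = app \<sigma> (restrict f n)) \<longrightarrow> f \<notin> elts B"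
    unfolding determined_def R by blast
  then show ?thesis
  proof cases
    case 1
    have fe: "func empty (elts empty) Nat" unfolding func_def by simp
    have "empty \<in> (\<Union>n\<in>Nat. Tup om n)"
      by (rule UN_I[OF empty_Nat]) (use fe in \<open>simp add: Tup_def Fun_def\<close>)
    from func_ap_in[OF 1(1)[unfolded strategy_def] this] have \<sigma>e: "ap \<sigma> empty \<in> Nat" by simp
    \<comment> \<open>\<open>strategy_comeager\<close> starts with the opponent to move, so the
      opening move of the first player is made in advance.\<close>
    define h0 where "h0 = lam (succ empty) (\<lambda>_. ap \<sigma> empty)"
    have d: "dterm (\<lambda>e. ap \<sigma> empty)" by (intro dfn_intros)
    have h0: "func h0 (elts (succ empty)) Nat" unfolding h0_def by (rule func_lam[OF d]) (rule \<sigma>e)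
    have "comeager A (cnd h0 (succ empty))"
    proof (rule strategy_comeager[OF 1(1), where W = "\<lambda>n. n \<in> Even"])
      show "dfn (\<lambda>e. e 0 \<in> Even)" by (intro dfn_intros)
      show "n \<in> Nat \<Longrightarrow> succ n \<in> Even \<longleftrightarrow> \<not> n \<in> Even" for n by (rule succ_Even_iff)
      show "A (UL (cnd f)) (UR (cnd f))" if "f \<in> Reals" "\<And>n. n \<in> Nat \<Longrightarrow> n \<in> Even \<Longrightarrow> ap f n = ap \<sigma> (restrict f n)" for f
      proof -
        have "f \<in> elts B" using 1(2) that conv[OF 1(1) that(1)] by blast
        then show ?thesis using B by blast
      qed
      show "succ empty \<notin> Even" using succ_Even_iff[of empty] empty_Even by simp
      show "func h0 (elts (succ empty)) Nat" by (rule h0)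
      show "ap h0 k = ap \<sigma> (restrict h0 k)" if "k \<in> elts (succ empty)" for k
      proof -
        have k: "k = empty" using that by simp
        have "restrict h0 empty = empty" by (rule set_ext) (simp add: elts_restrict)
        then show ?thesis unfolding k using ap_lam[OF d, of empty "succ empty"] unfolding h0_def by simp
      qed
    qed simp
    then show ?thesis by blast
  next
    case 2
    have "comeager (\<lambda>x y. \<not> A x y) (cnd empty empty)"
    proof (rule strategy_comeager[OF 2(1), where W = "\<lambda>n. n \<notin> Even"])
      show "dfn (\<lambda>e. e 0 \<notin> Even)" by (intro dfn_intros)
      show "n \<in> Nat \<Longrightarrow> succ n \<notin> Even \<longleftrightarrow> \<not> n \<notin> Even" for n using succ_Even_iff[of n] by blast
      show "\<not> A (UL (cnd f)) (UR (cnd f))" if "f \<in> Reals" "\<And>n. n \<in> Nat \<Longrightarrow> n \<notin> Even \<Longrightarrow> ap f n = ap \<sigma> (restrict f n)" for f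
      proof -
        have "f \<notin> elts B" using 2(2) that conv[OF 2(1) that(1)] by blast
        then show ?thesis using B that(1) by blast
      qed
      show "\<not> empty \<notin> Even" using empty_Even by blast
      show "func empty (elts empty) Nat" unfolding func_def by simp
    qed simp_all
    then show ?thesis using cnd_rec(1) by simp
  qed
qed

subsection \<open>Wellordered unions of countable sets\<close>

text \<open>The ranks of two points of B are ordered one way, the other way, or equal. If none of
  these three relations were comeager in a box, all three complements would be comeager, and a
  generic pair in B would have incomparable ranks. Equality is excluded by \<open>fib\<close>
  through a section. The other two are mirror images, and a section at x consists of points of rank
  below that of x.\<close>

lemma rank_descent:
  assumes AD: ordinal_determinacy
    and B: "dfn (\<lambda>e. B (e 0))" and \<rho>: "dterm (\<lambda>e. \<rho> (e 0))"
    and Ord: "\<And>y. elts y \<subseteq> Nat \<Longrightarrow> B y \<Longrightarrow> Ord (\<rho> y)"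
    and fib: "\<And>\<alpha> p. \<not> comeager (\<lambda>_ y. B y \<and> \<rho> y = \<alpha>) p"
    and com: "comeager (\<lambda>_ y. B y) (trip k b b)"
  obtains x k' b' where "elts x \<subseteq> Nat" "B x" "comeager (\<lambda>_ y. B y \<and> \<rho> y \<in> elts (\<rho> x)) (trip k' b' b')"
proof -
  have B': "dterm t \<Longrightarrow> dfn (\<lambda>e. B (t e))" for t using dfn_lift1[of B] B by blast
  have \<rho>': "dterm t \<Longrightarrow> dterm (\<lambda>e. \<rho> (t e))" for t using dterm_lift1[of \<rho>] \<rho> by blast
  define A1 where "A1 x y \<longleftrightarrow> B x \<and> B y \<and> \<rho> y \<in> elts (\<rho> x)" for x y
  define A3 where "A3 x y \<longleftrightarrow> B x \<and> B y \<and> \<rho> y = \<rho> x" for x y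
  note result = that
  have A1: thesis if c: "comeager A1 p" for p
  proof -
    obtain x where x: "elts x \<subseteq> Nat" "comeager (\<lambda>_ y. A1 x y) (trip (K p) (R p) (R p))"
      using c by (rule comeager_section)
    have "B x" using x(2) by (rule comeager_exists) (simp add: A1_def)
    moreover have "comeager (\<lambda>_ y. B y \<and> \<rho> y \<in> elts (\<rho> x)) (trip (K p) (R p) (R p))"
      by (rule comeager_mono[OF x(2)]) (simp add: A1_def)
    ultimately show thesis using result[OF x(1)] by blast
  qed
  have d1: "dfn (\<lambda>e. A1 (e 0) (e 1))" unfolding A1_def by (intro dfn_intros B' \<rho>')
  have d2: "dfn (\<lambda>e. A1 (e 1) (e 0))" unfolding A1_def by (intro dfn_intros B' \<rho>')
  have d3: "dfn (\<lambda>e. A3 (e 0) (e 1))" unfolding A3_def by (intro dfn_intros B' \<rho>')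
  consider (one) p where "comeager A1 p" | (two) p where "comeager (\<lambda>x y. A1 y x) p" | (three) p where "comeager A3 p"
    | (none) "comeager (\<lambda>x y. \<not> A1 x y) top" "comeager (\<lambda>x y. \<not> A1 y x) top" "comeager (\<lambda>x y. \<not> A3 x y) top"
    using baire_dichotomy[OF AD d1] baire_dichotomy[OF AD d2] baire_dichotomy[OF AD d3] by blast
  then show thesis
  proof cases
    case one
    then show thesis by (rule A1)
  next
    case two
    from comeager_swp[OF two] show thesis by (rule A1)
  next
    case three
    then obtain x where x: "comeager (\<lambda>_ y. A3 x y) (trip (K p) (R p) (R p))" by (rule comeager_section)
    have "comeager (\<lambda>_ y. B y \<and> \<rho> y = \<rho> x) (trip (K p) (R p) (R p))"
      by (rule comeager_mono[OF x]) (simp add: A3_def)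
    then show thesis using fib by blast
  next
    case none
    let ?q = "trip k b b"
    have q: "?q \<in> elts CS" using com unfolding comeager_def by blast
    note le = comeager_le[OF _ top_le[OF q] q]
    \<comment> \<open>Thanks to the diagonal shape of the condition, B holds comeagerly of both
      coordinates in the same box.\<close>
    have "swp ?q = ?q" unfolding swp_def by simp
    then have "comeager (\<lambda>x y. B x) ?q" using comeager_swp[OF com] by simp
    from comeager_conj[OF comeager_conj[OF comeager_conj[OF le[OF none(1)] le[OF none(2)]] le[OF none(3)]] comeager_conj[OF com this]]
    obtain x y where xy: "elts x \<subseteq> Nat" "elts y \<subseteq> Nat"
      "((\<not> A1 x y \<and> \<not> A1 y x) \<and> \<not> A3 x y) \<and> B y \<and> B x" by (rule comeager_exists) blast
    then have "Ord (\<rho> x)" "Ord (\<rho> y)" using Ord by blast+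
    from Ord_linear[OF this] xy(3) show thesis unfolding A1_def A3_def by auto
  qed
qed

text \<open>For the least \<alpha> such that the points of rank below \<alpha> are comeager in some
  box, \<open>rank_descent\<close> applied to these points yields a smaller such ordinal.\<close>

lemma wellordered_union_not_comeager:
  assumes AD: ordinal_determinacy
    and B: "dfn (\<lambda>e. B (e 0))" and \<rho>: "dterm (\<lambda>e. \<rho> (e 0))" and \<kappa>: "Ord \<kappa>"
    and \<rho>\<kappa>: "\<And>y. elts y \<subseteq> Nat \<Longrightarrow> B y \<Longrightarrow> \<rho> y \<in> elts \<kappa>"
    and fib: "\<And>\<alpha> p. \<not> comeager (\<lambda>_ y. B y \<and> \<rho> y = \<alpha>) p"
  shows "\<not> comeager (\<lambda>_ y. B y) (trip k b b)"
proof
  assume com: "comeager (\<lambda>_ y. B y) (trip k b b)"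
  have B': "dterm t \<Longrightarrow> dfn (\<lambda>e. B (t e))" for t using dfn_lift1[of B] B by blast
  have \<rho>': "dterm t \<Longrightarrow> dterm (\<lambda>e. \<rho> (t e))" for t using dterm_lift1[of \<rho>] \<rho> by blast
  have Ord: "Ord (\<rho> y)" if "elts y \<subseteq> Nat" "B y" for y using Ord_in[OF \<kappa> \<rho>\<kappa>[OF that]] .
  define G where "G \<alpha> \<longleftrightarrow> (\<exists>k b. comeager (\<lambda>_ y. B y \<and> \<rho> y \<in> elts \<alpha>) (trip k b b))" for \<alpha>
  have Gd: "dfn (\<lambda>e. G (e 0))" unfolding G_def by (intro dfn_intros B' \<rho>')
  \<comment> \<open>A first descent finds one such ordinal inside \<kappa>, from which the least one
    is taken.\<close>
  obtain x where x: "\<rho> x \<in> elts \<kappa>" "G (\<rho> x)"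
    by (rule rank_descent[OF AD B \<rho> Ord fib com]) (use \<rho>\<kappa> G_def in blast)+
  obtain \<alpha> where \<alpha>: "\<alpha> \<in> elts \<kappa>" "G \<alpha>" "\<And>z. z \<in> elts \<alpha> \<Longrightarrow> \<not> G z"
    using Gd \<kappa> x by (rule Ord_least) blast
  obtain k' b' where com': "comeager (\<lambda>_ y. B y \<and> \<rho> y \<in> elts \<alpha>) (trip k' b' b')"
    using \<alpha>(2) unfolding G_def by blast
  have Bd: "dfn (\<lambda>e. B (e 0) \<and> \<rho> (e 0) \<in> elts \<alpha>)" by (intro dfn_intros B' \<rho>')
  have fib': "\<not> comeager (\<lambda>_ y. (B y \<and> \<rho> y \<in> elts \<alpha>) \<and> \<rho> y = \<beta>) p" for \<beta> p
    using fib[of \<beta> p] comeager_mono[of "\<lambda>_ y. (B y \<and> \<rho> y \<in> elts \<alpha>) \<and> \<rho> y = \<beta>" p "\<lambda>_ y. B y \<and> \<rho> y = \<beta>"] by blast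
  obtain z k'' b'' where z: "B z \<and> \<rho> z \<in> elts \<alpha>"
    "comeager (\<lambda>_ y. (B y \<and> \<rho> y \<in> elts \<alpha>) \<and> \<rho> y \<in> elts (\<rho> z)) (trip k'' b'' b'')"
    by (rule rank_descent[OF AD Bd \<rho> _ fib' com']) (use Ord in blast)+
  have "comeager (\<lambda>_ y. B y \<and> \<rho> y \<in> elts (\<rho> z)) (trip k'' b'' b'')"
    by (rule comeager_mono[OF z(2)]) blast
  then have "G (\<rho> z)" unfolding G_def by blast
  then show False using \<alpha>(3) z(1) by blast
qed

subsection \<open>A perfect set of mutually generic reals\<close>

text \<open>The pairs in H code a family of sets of conditions indexed by sets u, later the subsets
  of a natural number m of the structure. As m may be nonstandard, a list in the metatheory could
  not replace the family.\<close>

definition fine :: "'v \<Rightarrow> 'v \<Rightarrow> 'v \<Rightarrow> bool" where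
  "fine H u c0 \<longleftrightarrow> (\<forall>c\<in>elts CS. \<forall>c'\<in>elts CS. le c c' \<longrightarrow> pair u c \<in> elts H \<longrightarrow> pair u c' \<in> elts H) \<and>
     (\<forall>c\<in>elts CS. le c0 c \<longrightarrow> (\<exists>c'\<in>elts CS. le c c' \<and> pair u c' \<in> elts H))"

lemma dfn_fine [dfn_intros]: "dterm t \<Longrightarrow> dterm u \<Longrightarrow> dterm v \<Longrightarrow> dfn (\<lambda>e. fine (t e) (u e) (v e))"
  by (rule dfn_lift3[where P = fine]) (unfold fine_def, intro dfn_intros)

text \<open>Induction on m by halving: a subset of m+1 is a subset of m or arises from one by adding
  m. The induction hypothesis serves the first half with H and the second with a reindexed family
  H', which is why it quantifies over all families; openness keeps the first half served.\<close>

lemma finite_fusion: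
  assumes m: "m \<in> Nat" and H: "\<And>u. elts u \<subseteq> elts m \<Longrightarrow> fine H u c0" and c: "c \<in> elts CS" "le c0 c"
  shows "\<exists>c'\<in>elts CS. le c c' \<and> (\<forall>u. elts u \<subseteq> elts m \<longrightarrow> pair u c' \<in> elts H)"
proof -
  have "\<forall>H. (\<forall>u. elts u \<subseteq> elts m \<longrightarrow> fine H u c0) \<longrightarrow> (\<forall>c\<in>elts CS. le c0 c \<longrightarrow>
     (\<exists>c'\<in>elts CS. le c c' \<and> (\<forall>u. elts u \<subseteq> elts m \<longrightarrow> pair u c' \<in> elts H)))" (is "?P m")
  proof (rule nat_induct_dfn[OF m, where P = ?P])
    show "dfn (\<lambda>e. ?P (e 0))" by (intro dfn_intros)
    show "?P empty"
    proof (intro allI impI ballI)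
      fix H c assume *: "\<forall>u. elts u \<subseteq> elts empty \<longrightarrow> fine H u c0" "c \<in> elts CS" "le c0 c"
      then have "fine H empty c0" by simp
      then obtain c' where "c' \<in> elts CS" "le c c'" "pair empty c' \<in> elts H" using * unfolding fine_def by blast
      moreover have "u = empty" if "elts u \<subseteq> elts empty" for u using that by (simp add: eq_empty_iff)
      ultimately show "\<exists>c'\<in>elts CS. le c c' \<and> (\<forall>u. elts u \<subseteq> elts empty \<longrightarrow> pair u c' \<in> elts H)" by blast
    qed
    fix m assume m: "m \<in> Nat" and IH: "?P m"
    show "?P (succ m)"
    proof (intro allI impI ballI)
      fix H c assume H: "\<forall>u. elts u \<subseteq> elts (succ m) \<longrightarrow> fine H u c0" and c: "c \<in> elts CS" "le c0 c"
      have "\<forall>u. elts u \<subseteq> elts m \<longrightarrow> fine H u c0" using H by auto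
      then obtain c1 where c1: "c1 \<in> elts CS" "le c c1" "\<And>u. elts u \<subseteq> elts m \<Longrightarrow> pair u c1 \<in> elts H"
        using IH c by blast
      define ad where "ad u = union u (upair m m)" for u
      have ad_d: "dterm t \<Longrightarrow> dterm (\<lambda>e. ad (t e))" for t unfolding ad_def by (intro dfn_intros)
      have ad: "elts (ad u) \<subseteq> elts (succ m)" if "elts u \<subseteq> elts m" for u using that unfolding ad_def by auto
      define H' where "H' = sep (prod (Pw m) CS) (\<lambda>p. pair (ad (fs p)) (sn p) \<in> elts H)"
      have "elts H' = {p \<in> elts (prod (Pw m) CS). pair (ad (fs p)) (sn p) \<in> elts H}"
        unfolding H'_def by (rule elts_sep) (intro dfn_intros ad_d)
      then have H'_iff: "pair u d \<in> elts H' \<longleftrightarrow> elts u \<subseteq> elts m \<and> d \<in> elts CS \<and> pair (ad u) d \<in> elts H" for u d by auto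
      have "fine H' u c0" if u: "elts u \<subseteq> elts m" for u
      proof -
        have "fine H (ad u) c0" using H ad[OF u] by blast
        then show ?thesis using u unfolding fine_def H'_iff by blast
      qed
      then obtain c2 where c2: "c2 \<in> elts CS" "le c1 c2" "\<And>u. elts u \<subseteq> elts m \<Longrightarrow> pair u c2 \<in> elts H'"
        using IH c1(1) le_trans[OF c(2) c1(2)] by blast
      have "pair u c2 \<in> elts H" if u: "elts u \<subseteq> elts (succ m)" for u
      proof (cases "m \<in> elts u")
        case True
        define w where "w = diff u (upair m m)"
        have w: "elts w \<subseteq> elts m" using u unfolding w_def by auto
        have "ad w = u" using True unfolding ad_def w_def by (auto simp: set_eq_iff)
        then show ?thesis using c2(3)[OF w] unfolding H'_iff by simp
      next
        case False
        then have u': "elts u \<subseteq> elts m" using u by auto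
        have "fine H u c0" using H u by blast
        then show ?thesis using c1(1) c1(3)[OF u'] c2(1,2) unfolding fine_def by blast
      qed
      then show "\<exists>c'\<in>elts CS. le c c' \<and> (\<forall>u. elts u \<subseteq> elts (succ m) \<longrightarrow> pair u c' \<in> elts H)"
        using c2(1) le_trans[OF c1(2) c2(2)] by blast
    qed
  qed
  then show ?thesis using H c by blast
qed

text \<open>The blocks beyond k are shared by all branches of the perfect tree, the histories below
  k are not; this attaches the blocks of c to arbitrary histories u and v.\<close>

definition ov :: "'v \<Rightarrow> 'v \<Rightarrow> 'v \<Rightarrow> 'v \<Rightarrow> 'v" where
  "ov c k u v = trip (K c) (union u (diff (L c) k)) (union v (diff (R c) k))"

lemma dterm_ov [dfn_intros]:
  "dterm s \<Longrightarrow> dterm t \<Longrightarrow> dterm u \<Longrightarrow> dterm v \<Longrightarrow> dterm (\<lambda>e. ov (s e) (t e) (u e) (v e))"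
  unfolding ov_def by (intro dfn_intros)

text \<open>A single extension has to serve all histories u, v below \<open>K c\<close>. For one
  pair of histories (\<open>dn\<close>), they are written in, the result is extended into the dense
  set, and the old bits are put back. \<open>finite_fusion\<close> then runs over u for fixed v, and
  once more over v.\<close>

lemma fusion_step:
  assumes D: "open_fam D" "dense_fam D top" and i: "i \<in> Nat" and c: "c \<in> elts CS"
  shows "\<exists>c'\<in>elts CS. sle c c' \<and> (\<forall>u v. elts u \<subseteq> elts (K c) \<longrightarrow> elts v \<subseteq> elts (K c) \<longrightarrow> pair i (ov c' (K c) u v) \<in> elts D)"
proof -
  define k where "k = K c"
  have k: "k \<in> Nat" and Lc: "elts (L c) \<subseteq> elts k" and Rc: "elts (R c) \<subseteq> elts k"
    using CS_sel[OF c] unfolding k_def by blast+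
  have ov_CS: "ov d k u v \<in> elts CS" if "d \<in> elts CS" "elts k \<subseteq> elts (K d)" "elts u \<subseteq> elts k" "elts v \<subseteq> elts k" for d u v
    using CS_sel[OF that(1)] that unfolding ov_def by auto
  have le_k: "elts k \<subseteq> elts (K d)" if "le c d" for d using that unfolding le_iff k_def by blast
  have op: "pair i (ov d' k u v) \<in> elts D"
    if "pair i (ov d k u v) \<in> elts D" "d \<in> elts CS" "d' \<in> elts CS" "le c d" "le d d'" "elts u \<subseteq> elts k" "elts v \<subseteq> elts k" for d d' u v
  proof -
    have "le (ov d k u v) (ov d' k u v)" using that(5-7) le_k[OF that(4)] unfolding le_iff ov_def by auto
    moreover have "ov d k u v \<in> elts CS" "ov d' k u v \<in> elts CS"
      using ov_CS that le_k le_trans[OF that(4,5)] by blast+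
    ultimately show ?thesis using D(1) i that(1) unfolding open_fam_def by blast
  qed
  have dn: "\<exists>d'\<in>elts CS. le d d' \<and> pair i (ov d' k u v) \<in> elts D"
    if d: "d \<in> elts CS" "le c d" and uv: "elts u \<subseteq> elts k" "elts v \<subseteq> elts k" for d u v
  proof -
    have e: "ov d k u v \<in> elts CS" using ov_CS d le_k uv by blast
    then obtain f where f: "f \<in> elts CS" "le (ov d k u v) f" "pair i f \<in> elts D"
      using D(2) i top_le[OF e] unfolding dense_fam_def by blast
    have Kf: "elts (K d) \<subseteq> elts (K f)" and Lf: "elts u \<union> (elts (L d) - elts k) = elts (L f) \<inter> elts (K d)"
      and Rf: "elts v \<union> (elts (R d) - elts k) = elts (R f) \<inter> elts (K d)"
      using f(2) unfolding le_iff ov_def by simp_all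
    have kd: "elts k \<subseteq> elts (K d)" using le_k[OF d(2)] .
    \<comment> \<open>With the bits of c below k restored this extends d, and overwriting them by u
      and v gives f again.\<close>
    define d' where "d' = ov f k (L c) (R c)"
    have d': "d' \<in> elts CS" unfolding d'_def using ov_CS[OF f(1)] kd Kf Lc Rc by blast
    have cd: "elts (L c) = elts (L d) \<inter> elts k" "elts (R c) = elts (R d) \<inter> elts k"
      using d(2) unfolding le_iff k_def by blast+
    have aux: "X = (Z \<union> (Y - elts k)) \<inter> elts (K d)"
      if "w \<union> (X - elts k) = Y \<inter> elts (K d)" "w \<subseteq> elts k" "Z = X \<inter> elts k" "X \<subseteq> elts (K d)" for X Y Z w
      using that kd unfolding Set.set_eq_iff by blast
    have "le d d'" unfolding le_iff d'_def ov_def trip_sel elts_union elts_diff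
      using Kf aux[OF Lf uv(1) cd(1) CS_sel(2)[OF d(1)]] aux[OF Rf uv(2) cd(2) CS_sel(3)[OF d(1)]] by (intro conjI)
    moreover have "ov d' k u v = f"
    proof (rule CS_eqI)
      show "ov d' k u v \<in> elts CS" using ov_CS[OF d' _ uv] kd Kf unfolding d'_def ov_def by auto
      show "f \<in> elts CS" by fact
      show "elts (K (ov d' k u v)) = elts (K f)" unfolding d'_def ov_def by simp
      show "elts (L (ov d' k u v)) = elts (L f)" using Lf Lc kd uv unfolding d'_def ov_def by auto
      show "elts (R (ov d' k u v)) = elts (R f)" using Rf Rc kd uv unfolding d'_def ov_def by auto
    qed
    ultimately show ?thesis using d' f(3) by auto
  qed
  have one: "\<exists>d'\<in>elts CS. le d d' \<and> (\<forall>u. elts u \<subseteq> elts k \<longrightarrow> pair i (ov d' k u v) \<in> elts D)"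
    if d: "d \<in> elts CS" "le c d" and v: "elts v \<subseteq> elts k" for d v
  proof -
    define H where "H = sep (prod (Pw k) CS) (\<lambda>p. le c (sn p) \<and> pair i (ov (sn p) k (fs p) v) \<in> elts D)"
    have "elts H = {p \<in> elts (prod (Pw k) CS). le c (sn p) \<and> pair i (ov (sn p) k (fs p) v) \<in> elts D}"
      unfolding H_def by (rule elts_sep) (intro dfn_intros)
    then have H: "pair u d \<in> elts H \<longleftrightarrow> elts u \<subseteq> elts k \<and> d \<in> elts CS \<and> le c d \<and> pair i (ov d k u v) \<in> elts D" for u d
      by auto
    have "fine H u c" if u: "elts u \<subseteq> elts k" for u
      unfolding fine_def H
    proof (intro conjI ballI impI)
      show "\<exists>c'\<in>elts CS. le d c' \<and> elts u \<subseteq> elts k \<and> c' \<in> elts CS \<and> le c c' \<and> pair i (ov c' k u v) \<in> elts D"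
        if "d \<in> elts CS" "le c d" for d using dn[OF that u v] le_trans[OF that(2)] u by blast
    qed (use u v op le_trans in blast)+
    from finite_fusion[OF k this d] show ?thesis unfolding H by blast
  qed
  define H where "H = sep (prod (Pw k) CS) (\<lambda>p. le c (sn p) \<and> (\<forall>u. elts u \<subseteq> elts k \<longrightarrow> pair i (ov (sn p) k u (fs p)) \<in> elts D))"
  have "elts H = {p \<in> elts (prod (Pw k) CS). le c (sn p) \<and> (\<forall>u. elts u \<subseteq> elts k \<longrightarrow> pair i (ov (sn p) k u (fs p)) \<in> elts D)}"
    unfolding H_def by (rule elts_sep) (intro dfn_intros)
  then have H: "pair v d \<in> elts H \<longleftrightarrow> elts v \<subseteq> elts k \<and> d \<in> elts CS \<and> le c d \<and> (\<forall>u. elts u \<subseteq> elts k \<longrightarrow> pair i (ov d k u v) \<in> elts D)" for v d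
    by auto
  have fine: "fine H v c" if v: "elts v \<subseteq> elts k" for v
    unfolding fine_def H
  proof (intro conjI ballI impI)
    show "\<exists>c'\<in>elts CS. le d c' \<and> elts v \<subseteq> elts k \<and> c' \<in> elts CS \<and> le c c' \<and> (\<forall>u. elts u \<subseteq> elts k \<longrightarrow> pair i (ov c' k u v) \<in> elts D)"
      if "d \<in> elts CS" "le c d" for d using one[OF that v] le_trans[OF that(2)] v by blast
  qed (use v op le_trans in blast)+
  have g: "grow c \<in> elts CS" "sle c (grow c)" using grow[OF c] by blast+
  then have "le c (grow c)" unfolding sle_def by blast
  from finite_fusion[OF k fine g(1) this] obtain c' where c': "c' \<in> elts CS" "le (grow c) c'"
    "\<And>v. elts v \<subseteq> elts k \<Longrightarrow> pair v c' \<in> elts H" by blast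
  have "sle c c'" using g(2) c'(2) le_trans unfolding sle_def le_iff by blast
  then show ?thesis using c'(1,3) unfolding H k_def by blast
qed

text \<open>Stage \<open>n\<close> of the fusion, where \<open>n\<close> codes \<open>(i, m, j)\<close>, puts into the \<open>i\<close>-th dense set all pairs whose
  second component uses the block from the right side and whose first one uses the block from the left
  side. The real \<open>a\<close> uses the right block if and only if \<open>a(m) = j\<close>, hence two reals \<open>a\<close>, \<open>b\<close> that differ at \<open>m\<close> are
  treated at the stages given by \<open>(i, m, b(m))\<close>.\<close>

lemma perfect_generic:
  assumes D: "open_fam D" "dense_fam D top"
  obtains G where "dterm (\<lambda>e. G (e 0))" "\<And>a. elts (G a) \<subseteq> Nat"
    "\<And>a b. a \<in> Reals \<Longrightarrow> b \<in> Reals \<Longrightarrow> a \<noteq> b \<Longrightarrow> generic D (G a) (G b)"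
proof -
  define Q where "Q n c c' \<longleftrightarrow> sle c c' \<and> (\<forall>i\<in>Nat. \<forall>m\<in>Nat. \<forall>j\<in>Nat. n = npair i (npair m j) \<longrightarrow>
     (\<forall>u v. elts u \<subseteq> elts (K c) \<longrightarrow> elts v \<subseteq> elts (K c) \<longrightarrow> pair i (ov c' (K c) u v) \<in> elts D))" for n c c'
  have Qd: "dfn (\<lambda>e. Q (e 0) (e 1) (e 2))" unfolding Q_def by (intro dfn_intros)
  have cd: "dterm (\<lambda>e. ccode (e 0))" by (intro dfn_intros)
  have np: "npair m j \<in> Nat" if "m \<in> Nat" "j \<in> Nat" for m j using npair_rec(3) that by blast
  have tot: "\<exists>c'\<in>elts CS. Q n c c'" if c: "c \<in> elts CS" for n c
  proof (cases "\<exists>i\<in>Nat. \<exists>m\<in>Nat. \<exists>j\<in>Nat. n = npair i (npair m j)")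
    case True
    then obtain i m j where *: "i \<in> Nat" "m \<in> Nat" "j \<in> Nat" "n = npair i (npair m j)" by blast
    have "i' = i" if "i' \<in> Nat" "m' \<in> Nat" "j' \<in> Nat" "n = npair i' (npair m' j')" for i' m' j'
      using npair_inj[OF that(1) np[OF that(2,3)] *(1) np[OF *(2,3)]] that(4) *(4) by simp
    note uniq = this
    obtain c' where c': "c' \<in> elts CS" "sle c c'"
      "\<And>u v. elts u \<subseteq> elts (K c) \<Longrightarrow> elts v \<subseteq> elts (K c) \<Longrightarrow> pair i (ov c' (K c) u v) \<in> elts D"
      using fusion_step[OF D *(1) c] by blast
    have "Q n c c'" unfolding Q_def using c'(2,3) uniq by (intro conjI ballI impI allI) simp_all
    then show ?thesis using c'(1) by blast
  next
    case False
    then show ?thesis using grow[OF c] unfolding Q_def by blast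
  qed
  obtain f where f: "func f Nat (elts CS)" "ap f empty = top" "\<And>n. n \<in> Nat \<Longrightarrow> Q n (ap f n) (ap f (succ n))"
    using dependent_choice[where R = Q, OF cd ccode_Nat ccode_inj Qd top_CS tot] by blast
  have fC: "ap f n \<in> elts CS" if "n \<in> Nat" for n using func_ap_in[OF f(1) that] .
  define bit where "bit n a \<longleftrightarrow> (\<exists>i\<in>Nat. \<exists>m\<in>Nat. n = npair i (npair m (ap a m)))" for n a
  define nxt where "nxt a n w = union w (diff (if bit n a then R (ap f (succ n)) else L (ap f (succ n))) (K (ap f n)))" for a n w
  have nxt_d: "dterm s \<Longrightarrow> dterm t \<Longrightarrow> dterm u \<Longrightarrow> dterm (\<lambda>e. nxt (s e) (t e) (u e))" for s t u
  proof -
    assume stu: "dterm s" "dterm t" "dterm u"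
    have "dfn (\<lambda>e. bit (e 0) (e 1))" unfolding bit_def by (intro dfn_intros)
    from dfn_lift2[OF this stu(2,1)] show ?thesis unfolding nxt_def by (intro dfn_intros stu)
  qed
  define gs where "gs a n = recN empty (nxt a) n" for a n
  have gs_d: "dterm t \<Longrightarrow> dterm u \<Longrightarrow> dterm (\<lambda>e. gs (t e) (u e))" for t u
    by (rule dterm_lift2[where f = gs]) (unfold gs_def, intro dfn_intros nxt_d)
  have subN: "elts (K (ap f n)) \<subseteq> Nat" "elts (L (ap f n)) \<subseteq> Nat" "elts (R (ap f n)) \<subseteq> Nat" if "n \<in> Nat" for n
    using CS_sel[OF fC[OF that]] Nat_trans by blast+
  have gs_rec: "gs a empty = empty" "n \<in> Nat \<Longrightarrow> gs a (succ n) = nxt a n (gs a n)" for a n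
  proof -
    have d: "dterm (\<lambda>e. nxt a (e 1) (e 0))" by (intro dfn_intros nxt_d)
    have "nxt a m u \<in> elts (Pw om)" if "m \<in> Nat" "u \<in> elts (Pw om)" for m u
      using that subN[of "succ m"] unfolding nxt_def by auto
    then show "gs a empty = empty" "n \<in> Nat \<Longrightarrow> gs a (succ n) = nxt a n (gs a n)"
      unfolding gs_def using recN_empty[OF d, of empty "Pw om"] recN_succ[OF d, of empty "Pw om"] by auto
  qed
  have step: "le (ap f n) (ap f (succ n))" "elts (K (ap f n)) \<subseteq> elts (K (ap f (succ n)))" if "n \<in> Nat" for n
    using f(3)[OF that] unfolding Q_def sle_def le_iff by blast+
  have gs_sub: "elts (gs a n) \<subseteq> elts (K (ap f n))" if n: "n \<in> Nat" for a n
  proof (rule nat_induct_dfn[OF n])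
    show "dfn (\<lambda>e. elts (gs a (e 0)) \<subseteq> elts (K (ap f (e 0))))" by (intro dfn_intros gs_d)
    show "elts (gs a empty) \<subseteq> elts (K (ap f empty))" using gs_rec(1) by simp
    fix n assume n: "n \<in> Nat" "elts (gs a n) \<subseteq> elts (K (ap f n))"
    then show "elts (gs a (succ n)) \<subseteq> elts (K (ap f (succ n)))"
      using gs_rec(2)[OF n(1)] step(2)[OF n(1)] CS_sel[OF fC[OF succ_Nat[OF n(1)]]] unfolding nxt_def by auto
  qed
  \<comment> \<open>The finite approximations of one real are repeated in both coordinates, which
    makes them a chain of conditions to which \<open>chain_limit\<close> applies.\<close>
  define F where "F a n = trip (K (ap f n)) (gs a n) (gs a n)" for a n
  have F_d: "dterm t \<Longrightarrow> dterm u \<Longrightarrow> dterm (\<lambda>e. F (t e) (u e))" for t u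
    unfolding F_def by (intro dfn_intros gs_d)
  have F_CS: "F a n \<in> elts CS" if "n \<in> Nat" for a n
    unfolding F_def using gs_sub[OF that] CS_sel(1)[OF fC[OF that]] by simp
  have F_le: "le (F a n) (F a (succ n))" if "n \<in> Nat" for a n
    unfolding F_def le_iff using gs_sub[OF that, of a] step(2)[OF that] gs_rec(2)[OF that, of a] unfolding nxt_def by auto
  define G where "G a = UL (F a)" for a
  have Fd1: "dterm (\<lambda>e. F a (e 0))" for a by (intro dfn_intros F_d)
  have G_on: "elts (gs a n) = elts (G a) \<inter> elts (K (ap f n))" if "n \<in> Nat" for a n
    using chain_limit[where F = "F a", OF Fd1 F_CS F_le that] unfolding on_iff G_def F_def trip_sel by blast
  show thesis
  proof (rule that[of G])
    show "dterm (\<lambda>e. G (e 0))" unfolding G_def by (intro dfn_intros F_d)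
    show "elts (G a) \<subseteq> Nat" for a unfolding G_def elts_UL[OF Fd1] by blast
    fix a b assume a: "a \<in> Reals" and b: "b \<in> Reals" and ab: "a \<noteq> b"
    have fa: "func a Nat Nat" and fb: "func b Nat Nat" using a b Reals_iff by simp_all
    obtain m where m: "m \<in> Nat" "ap a m \<noteq> ap b m" using func_ext[OF fa fb] ab by blast
    show "generic D (G a) (G b)" unfolding generic_def
    proof
      fix i assume i: "i \<in> Nat"
      have am: "ap a x \<in> Nat" if "x \<in> Nat" for x using func_ap_in[OF fa that] .
      have bm: "ap b m \<in> Nat" using func_ap_in[OF fb m(1)] .
      define n where "n = npair i (npair m (ap b m))"
      have n: "n \<in> Nat" unfolding n_def using np i m(1) bm by blast
      let ?c = "ap f n" and ?c' = "ap f (succ n)"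
      have "bit n b" unfolding bit_def n_def using i m(1) by blast
      moreover have "\<not> bit n a"
      proof
        assume "bit n a"
        then obtain i' m' where *: "i' \<in> Nat" "m' \<in> Nat" "n = npair i' (npair m' (ap a m'))" unfolding bit_def by blast
        have "npair m (ap b m) = npair m' (ap a m')"
          using npair_inj[OF i np[OF m(1) bm] *(1) np[OF *(2) am[OF *(2)]]] *(3) unfolding n_def by simp
        from npair_inj[OF m(1) bm *(2) am[OF *(2)] this] have "m = m' \<and> ap b m = ap a m'" .
        then show False using m(2) by auto
      qed
      \<comment> \<open>At this stage a takes the left block and b the right one, so the condition
        that \<open>Q\<close> has placed in the i-th dense set is an initial segment of the pair
        \<open>(G a, G b)\<close>.\<close>
      ultimately have "ov ?c' (K ?c) (gs a n) (gs b n) = trip (K ?c') (gs a (succ n)) (gs b (succ n))"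
        unfolding ov_def gs_rec(2)[OF n] nxt_def by simp
      also have "\<dots> = rst (G a) (G b) (K ?c')"
        unfolding rst_def using G_on[OF succ_Nat[OF n]] by (simp add: set_eq_iff[of "gs _ _"])
      finally have eq: "ov ?c' (K ?c) (gs a n) (gs b n) = rst (G a) (G b) (K ?c')" .
      have "pair i (ov ?c' (K ?c) (gs a n) (gs b n)) \<in> elts D"
        using f(3)[OF n] i m(1) bm gs_sub[OF n] unfolding Q_def n_def by blast
      then show "\<exists>k\<in>Nat. pair i (rst (G a) (G b) k) \<in> elts D"
        unfolding eq using CS_sel(1)[OF fC[OF succ_Nat[OF n]]] by blast
    qed
  qed
qed

subsection \<open>The injection into the disjoint union\<close>

definition chr :: "'v \<Rightarrow> 'v" where "chr x = lam om (bt x)"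

lemma dterm_chr [dfn_intros]: "dterm t \<Longrightarrow> dterm (\<lambda>e. chr (t e))"
  by (rule dterm_lift1[where f = chr]) (unfold chr_def, intro dfn_intros)

lemma chr_Reals: "chr x \<in> Reals"
proof -
  have d: "dterm (\<lambda>e. bt x (e 0))" by (intro dfn_intros)
  show ?thesis unfolding Reals_iff chr_def by (rule func_lam[OF d]) simp
qed

lemma chr_inj:
  assumes "elts x \<subseteq> Nat" "elts y \<subseteq> Nat" "chr x = chr y"
  shows "x = y"
proof (rule set_ext)
  have d: "dterm (\<lambda>e. bt x (e 0))" for x by (intro dfn_intros)
  have "bt x n = bt y n" if "n \<in> Nat" for n
    using ap_lam[OF d, of n om x] ap_lam[OF d, of n om y] assms(3) that unfolding chr_def by simp
  then show "elts x = elts y" using assms(1,2) unfolding bt_eq_iff by blast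
qed

lemma injects_disjoint_union_Quot:
  assumes AD: ordinal_determinacy and \<kappa>: "Ord \<kappa>" and E: "func E (elts \<kappa>) UNIV"
    and eqv: "\<And>\<alpha>. \<alpha> \<in> elts \<kappa> \<Longrightarrow> equiv_on_Reals (app E \<alpha>)"
    and count: "\<And>\<alpha> c. \<alpha> \<in> elts \<kappa> \<Longrightarrow> c \<in> Quot (app E \<alpha>) \<Longrightarrow> is_countable (elts c)"
  shows "injects (Times Reals (elts \<kappa>)) (disjoint_union_Quot \<kappa> E)"
proof -
  have appE: "app E \<alpha> = ap E \<alpha>" if "\<alpha> \<in> elts \<kappa>" for \<alpha> using func_app[OF E that] .
  have eqv': "equiv Reals (rel_of (ap E \<alpha>))" if "\<alpha> \<in> elts \<kappa>" for \<alpha>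
    using eqv[OF that] appE[OF that] unfolding equiv_on_Reals_def by simp
  define cl where "cl \<alpha> z = sep Re (\<lambda>w. pair z w \<in> elts (ap E \<alpha>))" for \<alpha> z
  have cl_d: "dterm t \<Longrightarrow> dterm u \<Longrightarrow> dterm (\<lambda>e. cl (t e) (u e))" for t u
    by (rule dterm_lift2[where f = cl]) (unfold cl_def, intro dfn_intros)
  have cl: "elts (cl \<alpha> z) = {w \<in> Reals. pair z w \<in> elts (ap E \<alpha>)}" for \<alpha> z
    unfolding cl_def elts_Re[symmetric] by (rule elts_sep) (intro dfn_intros)
  have cl_Quot: "cl \<alpha> z \<in> Quot (app E \<alpha>)" if \<alpha>: "\<alpha> \<in> elts \<kappa>" and z: "z \<in> Reals" for \<alpha> z
  proof -
    have "rel_of (ap E \<alpha>) \<subseteq> Reals \<times> Reals"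
      using eqv[OF \<alpha>] unfolding appE[OF \<alpha>] equiv_on_Reals_def rel_of_def by fastforce
    then have "elts (cl \<alpha> z) = rel_of (ap E \<alpha>) `` {z}" unfolding cl rel_of_def by auto
    then show ?thesis unfolding Quot_def appE[OF \<alpha>] using quotientI[OF z] by simp
  qed
  define Fr where "Fr x y \<longleftrightarrow> (\<exists>\<alpha>\<in>elts \<kappa>. pair (chr x) (chr y) \<in> elts (ap E \<alpha>))" for x y
  have Fr_d: "dfn (\<lambda>e. Fr (e 0) (e 1))" unfolding Fr_def by (intro dfn_intros)
  have Fr_d': "dterm t \<Longrightarrow> dterm u \<Longrightarrow> dfn (\<lambda>e. Fr (t e) (u e))" for t u using dfn_lift2[of Fr] Fr_d by blast
  have "\<not> comeager Fr p" for p
  proof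
    assume "comeager Fr p"
    then obtain x where x: "elts x \<subseteq> Nat" "comeager (\<lambda>_ y. Fr x y) (trip (K p) (R p) (R p))"
      by (rule comeager_section)
    define \<rho> where "\<rho> y = the1 (\<lambda>\<alpha>. \<alpha> \<in> elts \<kappa> \<and> pair (chr x) (chr y) \<in> elts (ap E \<alpha>) \<and>
       (\<forall>\<beta>\<in>elts \<alpha>. pair (chr x) (chr y) \<notin> elts (ap E \<beta>)))" for y
    have \<rho>_d: "dterm (\<lambda>e. \<rho> (e 0))" unfolding \<rho>_def by (intro dfn_intros)
    have \<rho>_d': "dterm t \<Longrightarrow> dterm (\<lambda>e. \<rho> (t e))" for t using dterm_lift1[of \<rho>] \<rho>_d by blast
    have \<rho>: "\<rho> y \<in> elts \<kappa> \<and> pair (chr x) (chr y) \<in> elts (ap E (\<rho> y))" if Fr: "Fr x y" for y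
    proof -
      obtain \<alpha> where \<alpha>: "\<alpha> \<in> elts \<kappa>" "pair (chr x) (chr y) \<in> elts (ap E \<alpha>)" using Fr unfolding Fr_def by blast
      have d: "dfn (\<lambda>e. pair (chr x) (chr y) \<in> elts (ap E (e 0)))" by (intro dfn_intros)
      obtain \<gamma> where \<gamma>: "\<gamma> \<in> elts \<kappa>" "pair (chr x) (chr y) \<in> elts (ap E \<gamma>)"
        "\<And>z. z \<in> elts \<gamma> \<Longrightarrow> pair (chr x) (chr y) \<notin> elts (ap E z)"
        using d \<kappa> \<alpha> by (rule Ord_least) blast
      have "\<rho> y = \<gamma>" unfolding \<rho>_def
      proof (rule the1_eqI)
        fix z assume z: "z \<in> elts \<kappa> \<and> pair (chr x) (chr y) \<in> elts (ap E z) \<and> (\<forall>\<beta>\<in>elts z. pair (chr x) (chr y) \<notin> elts (ap E \<beta>))"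
        then show "z = \<gamma>" using Ord_linear[of z \<gamma>] Ord_in[OF \<kappa>] \<gamma> by blast
      qed (use \<gamma> in blast)
      then show ?thesis using \<gamma> by blast
    qed
    have fib: "\<not> comeager (\<lambda>_ y. Fr x y \<and> \<rho> y = \<alpha>) q" for \<alpha> q
    proof
      assume com: "comeager (\<lambda>_ y. Fr x y \<and> \<rho> y = \<alpha>) q"
      then obtain y where "Fr x y \<and> \<rho> y = \<alpha>" by (rule comeager_exists)
      then have \<alpha>: "\<alpha> \<in> elts \<kappa>" using \<rho> by blast
      \<comment> \<open>An enumeration is picked for the one class at hand, inside a refutation; no
        simultaneous choice over the \<alpha> in \<kappa> takes place.\<close>
      obtain h where h: "inj_fun h (elts (cl \<alpha> (chr x))) Nat"
        using count[OF \<alpha> cl_Quot[OF \<alpha> chr_Reals]] unfolding is_countable_def injects_def by blast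
      then have hf: "func h (elts (cl \<alpha> (chr x))) Nat" and hi: "inj_on (app h) (elts (cl \<alpha> (chr x)))"
        unfolding inj_fun_def by blast+
      have incl: "chr y \<in> elts (cl \<alpha> (chr x))" if "Fr x y \<and> \<rho> y = \<alpha>" for y
        using \<rho> that chr_Reals unfolding cl by blast
      have "\<not> comeager (\<lambda>_ y. Fr x y \<and> \<rho> y = \<alpha>) q"
      proof (rule not_comeager_countable[where \<iota> = "\<lambda>y. ap h (chr y)"])
        show "dfn (\<lambda>e. Fr x (e 0) \<and> \<rho> (e 0) = \<alpha>)" by (intro dfn_intros Fr_d' \<rho>_d')
        show "dterm (\<lambda>e. ap h (chr (e 0)))" by (intro dfn_intros)
        show "ap h (chr y) \<in> Nat" if "Fr x y \<and> \<rho> y = \<alpha>" for y using func_ap_in[OF hf incl[OF that]] .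
        show "y = z" if "elts y \<subseteq> Nat" "elts z \<subseteq> Nat" "Fr x y \<and> \<rho> y = \<alpha>" "Fr x z \<and> \<rho> z = \<alpha>" "ap h (chr y) = ap h (chr z)" for y z
        proof -
          have "app h (chr y) = app h (chr z)" using func_app[OF hf] incl that(3-5) by simp
          then have "chr y = chr z" using inj_onD[OF hi] incl that(3,4) by blast
          then show ?thesis using chr_inj that(1,2) by blast
        qed
      qed
      then show False using com by blast
    qed
    have Bd: "dfn (\<lambda>e. Fr x (e 0))" by (intro dfn_intros Fr_d')
    have "\<not> comeager (\<lambda>_ y. Fr x y) (trip (K p) (R p) (R p))"
      by (rule wellordered_union_not_comeager[OF AD Bd \<rho>_d \<kappa> _ fib]) (use \<rho> in blast)
    then show False using x(2) by blast
  qed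
  then have "comeager (\<lambda>x y. \<not> Fr x y) top" using baire_dichotomy[OF AD Fr_d] by blast
  then obtain D where D: "open_fam D" "dense_fam D top"
    "\<And>x y. elts x \<subseteq> Nat \<Longrightarrow> elts y \<subseteq> Nat \<Longrightarrow> on top x y \<Longrightarrow> generic D x y \<Longrightarrow> \<not> Fr x y"
    by (rule comeagerE) blast
  obtain G where G: "dterm (\<lambda>e. G (e 0))" "\<And>a. elts (G a) \<subseteq> Nat"
    "\<And>a b. a \<in> Reals \<Longrightarrow> b \<in> Reals \<Longrightarrow> a \<noteq> b \<Longrightarrow> generic D (G a) (G b)"
    using D(1,2) by (rule perfect_generic) blast
  have "on top x y" for x y unfolding on_iff top_def by simp
  \<comment> \<open>Distinct reals have images generic for D, and such pairs lie outside
    \<open>Fr\<close>.\<close>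
  then have free: "a = b" if "a \<in> Reals" "b \<in> Reals" "Fr (G a) (G b)" for a b
    using D(3)[OF G(2) G(2)] G(3) that by blast
  have G': "dterm t \<Longrightarrow> dterm (\<lambda>e. G (t e))" for t using dterm_lift1[of G] G(1) by blast
  define \<Phi> where "\<Phi> p = pair (sn p) (cl (sn p) (chr (G (fs p))))" for p
  have \<Phi>_d: "dterm (\<lambda>e. \<Phi> (e 0))" unfolding \<Phi>_def by (intro dfn_intros cl_d G')
  have dom: "elts (prod Re \<kappa>) = Times Reals (elts \<kappa>)" unfolding elts_prod Times_def by simp
  define f where "f = lam (prod Re \<kappa>) \<Phi>"
  have ff: "func f (Times Reals (elts \<kappa>)) (disjoint_union_Quot \<kappa> E)"
    unfolding f_def dom[symmetric]
  proof (rule func_lam[OF \<Phi>_d])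
    fix p assume "p \<in> elts (prod Re \<kappa>)"
    then obtain a \<alpha> where "p = pair a \<alpha>" "\<alpha> \<in> elts \<kappa>" unfolding elts_prod by blast
    then show "\<Phi> p \<in> disjoint_union_Quot \<kappa> E"
      unfolding disjoint_union_Quot_def \<Phi>_def using cl_Quot[OF _ chr_Reals] by auto
  qed
  moreover have "inj_on (app f) (Times Reals (elts \<kappa>))"
  proof (rule inj_onI)
    fix p q assume pq: "p \<in> Times Reals (elts \<kappa>)" "q \<in> Times Reals (elts \<kappa>)" "app f p = app f q"
    obtain a \<alpha> where p: "p = pair a \<alpha>" "a \<in> Reals" "\<alpha> \<in> elts \<kappa>" using pq(1) unfolding Times_def by blast
    obtain b \<beta> where q: "q = pair b \<beta>" "b \<in> Reals" "\<beta> \<in> elts \<kappa>" using pq(2) unfolding Times_def by blast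
    have "\<Phi> p = \<Phi> q"
      using pq func_app[OF ff] ap_lam[OF \<Phi>_d, of _ "prod Re \<kappa>"] unfolding f_def dom by simp
    then have \<alpha>\<beta>: "\<alpha> = \<beta>" and c: "cl \<alpha> (chr (G a)) = cl \<alpha> (chr (G b))" unfolding \<Phi>_def p q by auto
    \<comment> \<open>By reflexivity \<open>chr (G b)\<close> lies in its own class, which is also
      the class of \<open>chr (G a)\<close>; so the two are related, and \<open>free\<close>
      applies.\<close>
    have "pair (chr (G b)) (chr (G b)) \<in> elts (ap E \<alpha>)"
      using eqv'[OF p(3)] chr_Reals unfolding equiv_def refl_on_def rel_of_def by blast
    then have "chr (G b) \<in> elts (cl \<alpha> (chr (G b)))" unfolding cl using chr_Reals by blast
    then have "pair (chr (G a)) (chr (G b)) \<in> elts (ap E \<alpha>)" using c cl[of \<alpha> "chr (G a)"] by auto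
    then have "Fr (G a) (G b)" unfolding Fr_def using p(3) by blast
    then show "p = q" using free p q \<alpha>\<beta> by blast
  qed
  ultimately show ?thesis unfolding injects_def inj_fun_def by blast
qed

end

theorem theorem4p5:
  fixes mem :: "'v \<Rightarrow> 'v \<Rightarrow> bool" and \<kappa> E :: 'v
  assumes "set_structure.ZF mem"
    and "set_structure.AD_plus mem"
    and "set_structure.V_eq_L_power_Reals mem"
    and "set_structure.Ord mem \<kappa>"
    and "set_structure.func mem E (set_structure.elts mem \<kappa>) UNIV"
    and "\<And>\<alpha>. \<alpha> \<in> set_structure.elts mem \<kappa> \<Longrightarrow>
           set_structure.equiv_on_Reals mem (set_structure.app mem E \<alpha>)"
    and "\<And>\<alpha>. \<alpha> \<in> set_structure.elts mem \<kappa> \<Longrightarrow>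
           set_structure.smooth mem (set_structure.app mem E \<alpha>)"
    and "\<And>\<alpha> c. \<alpha> \<in> set_structure.elts mem \<kappa> \<Longrightarrow>
           c \<in> set_structure.Quot mem (set_structure.app mem E \<alpha>) \<Longrightarrow>
           set_structure.is_countable mem (set_structure.elts mem c)"
  shows "set_structure.injects mem
           (set_structure.Times mem (set_structure.Reals mem) (set_structure.elts mem \<kappa>))
           (set_structure.disjoint_union_Quot mem \<kappa> E)"
proof -
  interpret zf mem by (rule zf.intro) (rule assms(1))
  have "ordinal_determinacy" using assms(2) unfolding AD_plus_def by blast
  then show ?thesis using assms(4,5,6,8) by (rule injects_disjoint_union_Quot)
qed

end
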